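(* Assume $c_n=p/N\to c\in(0,\infty)$, $R_p\Rightarrow\nu$ for a probability measure $\nu$ on $[0,\infty)$, and (RQC): $Q_p(P_p)\to0$ in probability for every deterministic sequence of orthogonal projections $P_p\in\mathbb R^{p\times p}$. Then there is a deterministic probability measure $\mu$ on $[0,\infty)$ such that $\operatorname{ESD}(S)\Rightarrow\mu$ weakly in probability, and for every $z\in\mathbb C_+$ its Stieltjes transform $s=s(z)=\int(\lambda-z)^{-1}\mu(\mathrm d\lambda)$ is the unique solution in $\mathbb C_+$ of $$\frac1s+z=\int_0^\infty\frac{r}{1+crs}\,\nu(\mathrm dr).$$ If the matrices for all $n$ are realized on one probability space and $\sum_ne^{-ap_n}<\infty$ for every $a>0$, the convergence is almost sure.
   Context: Setting: $p=p_n\to\infty$ and $N=N_n$ are positive integers; all limits are as $n\to\infty$. For each $n$, $x_p$ is a random vector in $\mathbb R^p$, $x_1,\dots,x_N$ are independent copies of it, $R_p=\|x_p\|^2/p$, $S=\frac1N\sum_{j=1}^Nx_jx_j^{\mathsf T}$, and $Q_p(A)=\frac{x_p^{\mathsf T}Ax_p}{p}-R_p\frac{\operatorname{tr}A}{p}$ (unnormalized trace). $\mathbb C_+=\{z\in\mathbb C:\operatorname{Im}z>0\}$. $\operatorname{ESD}(S)$ is the empirical spectral distribution of $S$; weak convergence in probability to a deterministic limit means convergence in probability to $0$ of the Lévy distance to the limit. No moments, isotropy, or assumption on the joint law of $R_p$ and $x_p/\|x_p\|$ are made. *)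

theory Defs
  imports "HOL-Probability.Probability" "Jordan_Normal_Form.Char_Poly"
begin

text \<open>A random vector in dimension \<open>p\<close> is a measurable map into the following space. Its points are
  functions on \<open>nat\<close> that only carry information on \<open>{..<p}\<close>; \<open>vec p v\<close> is the associated vector.\<close>

abbreviation rvec :: "nat \<Rightarrow> (nat \<Rightarrow> real) measure" where
  "rvec p \<equiv> Pi\<^sub>M {..<p} (\<lambda>_. borel)"

definition norm_ratio :: "nat \<Rightarrow> (nat \<Rightarrow> real) \<Rightarrow> real" where
  "norm_ratio p v = (\<Sum>i<p. (v i)\<^sup>2) / real p"

definition sample_cov :: "nat \<Rightarrow> nat \<Rightarrow> (nat \<Rightarrow> nat \<Rightarrow> real) \<Rightarrow> real mat" where
  "sample_cov p N X = mat p p (\<lambda>(i, k). (1 / real N) * (\<Sum>j<N. X j i * X j k))"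

definition mat_trace :: "'a::comm_monoid_add mat \<Rightarrow> 'a" where
  "mat_trace A = (\<Sum>i<dim_row A. A $$ (i, i))"

definition quad_dev :: "nat \<Rightarrow> real mat \<Rightarrow> (nat \<Rightarrow> real) \<Rightarrow> real" where
  "quad_dev p A v = (vec p v \<bullet> (A *\<^sub>v vec p v)) / real p - norm_ratio p v * (mat_trace A / real p)"

definition orth_proj :: "nat \<Rightarrow> real mat \<Rightarrow> bool" where
  "orth_proj p P \<longleftrightarrow> P \<in> carrier_mat p p \<and> P * P = P \<and> transpose_mat P = P"

text \<open>Empirical spectral distribution, as a distribution function. Only real eigenvalues are counted
  (with algebraic multiplicity); for a real symmetric matrix these are all the eigenvalues.\<close>

definition ESD :: "real mat \<Rightarrow> real \<Rightarrow> real" where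
  "ESD A t = real (size {#l \<in># proots (char_poly A). l \<le> t#}) / real (dim_row A)"

definition levy_dist :: "(real \<Rightarrow> real) \<Rightarrow> (real \<Rightarrow> real) \<Rightarrow> real" where
  "levy_dist F G = Inf {\<epsilon>. \<epsilon> > 0 \<and> (\<forall>x. F (x - \<epsilon>) - \<epsilon> \<le> G x \<and> G x \<le> F (x + \<epsilon>) + \<epsilon>)}"

text \<open>Convergence in probability to a constant. The probability spaces may vary with \<open>n\<close>.
  Measurability is demanded because \<open>measure\<close> is 0 on non-measurable sets.\<close>

definition conv_in_prob :: "(nat \<Rightarrow> 'a measure) \<Rightarrow> (nat \<Rightarrow> 'a \<Rightarrow> real) \<Rightarrow> real \<Rightarrow> bool" where
  "conv_in_prob M Y l \<longleftrightarrow>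
     (\<forall>n. Y n \<in> borel_measurable (M n)) \<and>
     (\<forall>\<epsilon>>0. (\<lambda>n. measure (M n) {\<omega> \<in> space (M n). \<bar>Y n \<omega> - l\<bar> > \<epsilon>}) \<longlonglongrightarrow> 0)"

definition stieltjes :: "real measure \<Rightarrow> complex \<Rightarrow> complex" where
  "stieltjes \<mu> z = (LINT t|\<mu>. 1 / (complex_of_real t - z))"

definition prob_on_nonneg :: "real measure \<Rightarrow> bool" where
  "prob_on_nonneg \<mu> \<longleftrightarrow> real_distribution \<mu> \<and> measure \<mu> {0..} = 1"

definition solves_eq :: "real \<Rightarrow> real measure \<Rightarrow> complex \<Rightarrow> complex \<Rightarrow> bool" where
  "solves_eq c \<nu> z s \<longleftrightarrow>
     1 / s + z = (LINT r:{0..}|\<nu>. complex_of_real r / (1 + complex_of_real c * complex_of_real r * s))"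

end

theory Submission
  imports Defs "Jordan_Normal_Form.Schur_Decomposition" "HOL-Complex_Analysis.Complex_Analysis"
begin

text \<open>Everything is done at real points \<open>z = - y\<close> with \<open>y > 0\<close>, where all quantities are positive and
  bounded. Let \<open>m = \<E> tr (S + y)\<^sup>-\<^sup>1 / p\<close>. Writing \<open>p - y tr (S + y)\<^sup>-\<^sup>1 = tr (S (S + y)\<^sup>-\<^sup>1)\<close> as a sum over the
  samples and removing one sample at a time gives terms \<open>u / (1 + u)\<close>, where \<open>u\<close> is the quadratic form
  of the removed sample in an independent resolvent. A resolvent is a mixture of spectral projections up
  to a small error, so the projection hypothesis (made uniform by a worst-case choice) replaces \<open>u\<close> by
  \<open>R tr (S + y)\<^sup>-\<^sup>1 / N\<close>; the bounded function \<open>u / (1 + u)\<close> makes moments unnecessary. McDiarmid's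
  inequality, with exponential rate in \<open>p\<close>, replaces the trace by its mean. Hence \<open>m\<close> solves
  \<open>c (1 - y m) = \<integral> c r m / (1 + c r m) d\<nu>\<close> in the limit, and monotonicity in \<open>m\<close> gives convergence. The values
  of the transform at finitely many rational \<open>y\<close> control the Levy distance, and the complex equation
  follows by analytic continuation.\<close>

text \<open>Expectations of quadratic forms, or of \<open>S\<close> itself, may be infinite here, so
  only bounded functions of the samples are ever integrated. At \<open>- y\<close> the removed
  quadratic form \<open>u\<close> is nonnegative, hence \<open>1 + u >= 1\<close> and every summand
  lies in [0, 1]. For the same reason, removing a sample of any size moves the trace of the
  resolvent by at most \<open>1 / y\<close>. This gives bounded differences without truncation, and
  a deviation of order \<open>p\<close>, with \<open>N\<close> coordinates and \<open>N\<close> of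
  the same order as \<open>p\<close>, has probability of order \<open>exp (- a * p)\<close>. The
  hypothesis speaks of deterministic projections, whereas the resolvents are random. The limit
  measure is not found by inverting a transform: with positive probability the empirical measures
  have transforms close to the fixed points, and a weak limit point of such realizations has the
  required transform.\<close>

unbundle no inner_syntax and no vec_syntax

section \<open>Orthogonal diagonalization and resolvents\<close>

lemma mult_mat_regroup:
  fixes A B C D :: "'a :: semiring_0 mat"
  assumes "A \<in> carrier_mat n n" "B \<in> carrier_mat n n" "C \<in> carrier_mat n n" "D \<in> carrier_mat n n"
  shows "(A * B) * (C * D) = A * (B * C) * D"
proof -
  have "B * (C * D) = (B * C) * D" by (rule assoc_mult_mat[symmetric]) (use assms in auto)
  moreover have "(A * B) * (C * D) = A * (B * (C * D))" by (rule assoc_mult_mat) (use assms in auto)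
  moreover have "A * ((B * C) * D) = A * (B * C) * D" by (rule assoc_mult_mat[symmetric]) (use assms in auto)
  ultimately show ?thesis by simp
qed

text \<open>Gram-Schmidt keeps the first vector of its list. Completing \<open>v\<close> to a basis
  with head \<open>v\<close>, orthogonalizing and normalizing therefore gives an orthogonal matrix
  whose first column is still a multiple of \<open>v\<close>.\<close>

lemma orthogonal_completion:
  fixes v :: "real vec"
  assumes v: "v \<in> carrier_vec n" and v0: "v \<noteq> 0\<^sub>v n"
  shows "\<exists>W k. W \<in> carrier_mat n n \<and> W\<^sup>T * W = 1\<^sub>m n \<and> W * W\<^sup>T = 1\<^sub>m n \<and> k \<noteq> 0 \<and> col W 0 = k \<cdot>\<^sub>v v"
proof -
  interpret cof_vec_space n "TYPE(real)" .
  define b where "b = basis_completion v"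
  define ws where "ws = gram_schmidt n b"
  have n: "n \<noteq> 0" using v v0 by (metis carrier_vecD eq_vecI index_zero_vec(2) less_nat_zero_code)
  from basis_completion[OF v v0, folded b_def]
  have dist_b: "distinct b" and indep: "\<not> lin_dep (set b)" and b: "set b \<subseteq> carrier_vec n"
    and hdb: "hd b = v" and len_b: "length b = n" by auto
  from hdb len_b n obtain vs where bv: "b = v # vs" by (cases b, auto)
  from gram_schmidt_result[OF b dist_b indep refl, folded ws_def]
  have ws: "set ws \<subseteq> carrier_vec n" "corthogonal ws" "length ws = n"
    by (auto simp: len_b)
  from gram_schmidt_hd[OF v, of vs, folded bv] have hdws: "hd ws = v" unfolding ws_def .
  have wsc: "ws ! i \<in> carrier_vec n" if "i < n" for i using ws that by (auto simp: subset_iff)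
  have orth: "(ws ! i \<bullet> ws ! j = 0) \<longleftrightarrow> i \<noteq> j" if "i < n" "j < n" for i j
    using corthogonalD[OF ws(2), of i j] that ws(3) by simp
  define d where "d i = 1 / sqrt (ws ! i \<bullet> ws ! i)" for i
  have pos: "ws ! i \<bullet> ws ! i > 0" if "i < n" for i
    using orth[OF that that] sum_nonneg[of "{0..<dim_vec (ws ! i)}" "\<lambda>j. ws ! i $ j * ws ! i $ j"]
    unfolding scalar_prod_def by (simp add: less_le)
  define W where "W = mat_of_cols n (map (\<lambda>i. d i \<cdot>\<^sub>v (ws ! i)) [0..<n])"
  have W: "W \<in> carrier_mat n n" unfolding W_def by auto
  have colW: "col W i = d i \<cdot>\<^sub>v (ws ! i)" if "i < n" for i
    unfolding W_def using that wsc by (subst col_mat_of_cols) auto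
  have WW: "W\<^sup>T * W = 1\<^sub>m n"
  proof (rule eq_matI)
    fix i j assume "i < dim_row (1\<^sub>m n :: real mat)" "j < dim_col (1\<^sub>m n :: real mat)"
    hence ij: "i < n" "j < n" by auto
    have "(W\<^sup>T * W) $$ (i,j) = col W i \<bullet> col W j" using ij W by auto
    also have "\<dots> = d i * d j * (ws ! i \<bullet> ws ! j)"
      using ij wsc[OF ij(1)] wsc[OF ij(2)] unfolding colW[OF ij(1)] colW[OF ij(2)]
      by (simp add: smult_scalar_prod_distrib[of _ n] scalar_prod_smult_distrib[of _ n])
    also have "\<dots> = (if i = j then 1 else 0)"
      using orth[OF ij] pos[OF ij(1)] by (auto simp: d_def)
    finally show "(W\<^sup>T * W) $$ (i,j) = 1\<^sub>m n $$ (i,j)" using ij by auto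
  qed (use W in auto)
  have "W * W\<^sup>T = 1\<^sub>m n"
    using mat_mult_left_right_inverse[of "W\<^sup>T" n W] W WW by auto
  moreover have "col W 0 = d 0 \<cdot>\<^sub>v v"
    using colW[of 0] n hdws ws(3) by (metis gr0I hd_conv_nth length_0_conv)
  moreover have "d 0 \<noteq> 0" using pos[of 0] n by (auto simp: d_def)
  ultimately show ?thesis using W WW by blast
qed

text \<open>Deflation: in an orthonormal basis that starts with an eigenvector for \<open>e\<close>,
  the first column of the matrix is \<open>e\<close> followed by zeros, and symmetry makes the first
  row vanish as well. The remaining block is symmetric, and cancelling the factor of
  \<open>e\<close> shows that its characteristic polynomial splits over the rest of the
  list.\<close>

lemma symmetric_diagonalization_split:
  fixes A :: "real mat"
  assumes "A \<in> carrier_mat n n" and "A\<^sup>T = A"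
    and "char_poly A = (\<Prod>e \<leftarrow> es. [:- e, 1:])"
  shows "\<exists>U. U \<in> carrier_mat n n \<and> U\<^sup>T * U = 1\<^sub>m n \<and> U * U\<^sup>T = 1\<^sub>m n \<and>
    A = U * mat_diag n (\<lambda>i. es ! i) * U\<^sup>T \<and> length es = n"
  using assms
proof (induct es arbitrary: n A)
  case Nil
  hence "n = 0" using degree_monic_char_poly[of A n] by simp
  with Nil show ?case by (intro exI[of _ "1\<^sub>m 0"]) auto
next
  case (Cons e es n A)
  let ?n1 = "n - 1"
  note A = Cons(2)
  have cp: "char_poly A = [: -e, 1 :] * (\<Prod>e \<leftarrow> es. [:- e, 1:])" using Cons(4) by auto
  have mon: "monic (\<Prod>e\<leftarrow> es. [:- e, 1:])" by (rule monic_prod_list, auto)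
  have deg: "degree (char_poly A) = Suc (degree (\<Prod>e\<leftarrow> es. [:- e, 1:]))" unfolding cp
    by (subst degree_mult_eq, insert mon, auto)
  with degree_monic_char_poly[OF A] have n: "n \<noteq> 0" by auto
  have "eigenvalue A e" unfolding eigenvalue_root_char_poly[OF A] cp by simp
  then obtain v where "eigenvector A v e" unfolding eigenvalue_def by auto
  hence v: "v \<in> carrier_vec n" and v0: "v \<noteq> 0\<^sub>v n" and Av: "A *\<^sub>v v = e \<cdot>\<^sub>v v"
    using A unfolding eigenvector_def by auto
  obtain W k where W: "W \<in> carrier_mat n n" and WW: "W\<^sup>T * W = 1\<^sub>m n" and WW': "W * W\<^sup>T = 1\<^sub>m n"
    and k: "k \<noteq> 0" and colW: "col W 0 = k \<cdot>\<^sub>v v" using orthogonal_completion[OF v v0] by blast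
  define A' where "A' = W\<^sup>T * A * W"
  have A': "A' \<in> carrier_mat n n" unfolding A'_def using W A by auto
  have symA': "A'\<^sup>T = A'" unfolding A'_def using W A Cons(3)
    by (simp add: transpose_mult[of _ n n _ n] assoc_mult_mat[of _ n n _ n _ n])
  have col0: "A' $$ (i, 0) = (if i = 0 then e else 0)" if i: "i < n" for i
  proof -
    have "A' = W\<^sup>T * (A * W)" unfolding A'_def using W A by (simp add: assoc_mult_mat[of _ n n _ n _ n])
    hence "A' $$ (i,0) = col W i \<bullet> col (A * W) 0" using i n W A by auto
    also have "col (A * W) 0 = A *\<^sub>v col W 0" using n by (intro col_mult2[OF A W]) auto
    also have "\<dots> = e \<cdot>\<^sub>v col W 0" unfolding colW using A v Av
      by (simp add: mult_mat_vec[of _ n n] smult_smult_assoc mult.commute)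
    also have "col W i \<bullet> (e \<cdot>\<^sub>v col W 0) = e * (col W i \<bullet> col W 0)" using W n i by simp
    also have "col W i \<bullet> col W 0 = (W\<^sup>T * W) $$ (i,0)" using W n i by auto
    finally show ?thesis unfolding WW using n i by auto
  qed
  have row0: "A' $$ (0, i) = (if i = 0 then e else 0)" if i: "i < n" for i
    using col0[OF i] i n arg_cong[OF symA', of "\<lambda>M. M $$ (i,0)"] A' by auto
  define A3 where "A3 = mat ?n1 ?n1 (\<lambda>(i,j). A' $$ (Suc i, Suc j))"
  have A3: "A3 \<in> carrier_mat ?n1 ?n1" unfolding A3_def by auto
  let ?E = "mat 1 1 (\<lambda>_. e)"
  have block: "A' = four_block_mat ?E (0\<^sub>m 1 ?n1) (0\<^sub>m ?n1 1) A3" (is "_ = ?F")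
    by (rule eq_matI) (use A' n in \<open>auto simp: A3_def col0 row0\<close>)
  have symA3: "A3\<^sup>T = A3"
  proof (rule eq_matI)
    fix i j assume "i < dim_row A3" "j < dim_col A3"
    hence "i < ?n1" "j < ?n1" using A3 by auto
    thus "A3\<^sup>T $$ (i,j) = A3 $$ (i,j)" unfolding A3_def
      using arg_cong[OF symA', of "\<lambda>M. M $$ (Suc i, Suc j)"] A' by auto
  qed (use A3 in auto)
  have "similar_mat_wit A' A (W\<^sup>T) W"
    by (rule similar_mat_witI[of _ _ n]) (use W A A' WW WW' in \<open>auto simp: A'_def\<close>)
  hence "similar_mat A' A" unfolding similar_mat_def by blast
  from cp char_poly_similar[OF this]
  have cp': "char_poly A' = [: -e,1 :] * (\<Prod> e \<leftarrow> es. [:- e, 1:])" by simp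
  \<comment> \<open>The zero off-diagonal block makes the characteristic polynomial multiplicative,
    and cancelling the linear factor provides the splitting hypothesis for the smaller
    block.\<close>
  have "char_poly A' = char_poly ?E * char_poly A3"
    unfolding block by (rule char_poly_four_block_zeros_col[OF _ _ A3]) auto
  also have "char_poly ?E = [: -e,1 :]"
    by (simp add: char_poly_defs det_def sign_def)
  finally have "char_poly A3 = (\<Prod> e \<leftarrow> es. [:- e, 1:])" using cp'
    by (metis mult_cancel_left pCons_eq_0_iff zero_neq_one)
  from Cons(1)[OF A3 symA3 this] obtain U where U: "U \<in> carrier_mat ?n1 ?n1" and UU: "U\<^sup>T * U = 1\<^sub>m ?n1"
    and UU': "U * U\<^sup>T = 1\<^sub>m ?n1" and A3U: "A3 = U * mat_diag ?n1 (\<lambda>i. es ! i) * U\<^sup>T"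
    and len: "length es = ?n1" by blast
  let ?V = "four_block_mat (1\<^sub>m 1) (0\<^sub>m 1 ?n1) (0\<^sub>m ?n1 1) U"
  have V: "?V \<in> carrier_mat n n" using U n four_block_carrier_mat[of "1\<^sub>m 1" 1 1 U ?n1 ?n1] by auto
  have VT: "?V\<^sup>T = four_block_mat (1\<^sub>m 1) (0\<^sub>m 1 ?n1) (0\<^sub>m ?n1 1) (U\<^sup>T)"
    using U by (subst transpose_four_block_mat[of _ 1 1 _ ?n1 _ ?n1]) auto
  have one: "four_block_mat (1\<^sub>m 1) (0\<^sub>m 1 ?n1) (0\<^sub>m ?n1 1) (1\<^sub>m ?n1) = (1\<^sub>m n :: real mat)"
    by (rule eq_matI) (use n in auto)
  have VV: "?V\<^sup>T * ?V = 1\<^sub>m n" unfolding VT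
    using U UU by (subst mult_four_block_mat[of _ 1 1 _ ?n1 _ ?n1 _ _ 1 _ ?n1]) (use n in \<open>auto simp: one\<close>)
  have VV': "?V * ?V\<^sup>T = 1\<^sub>m n" unfolding VT
    using U UU' by (subst mult_four_block_mat[of _ 1 1 _ ?n1 _ ?n1 _ _ 1 _ ?n1]) (use n in \<open>auto simp: one\<close>)
  have D: "mat_diag n (\<lambda>i. (e # es) ! i) = four_block_mat ?E (0\<^sub>m 1 ?n1) (0\<^sub>m ?n1 1) (mat_diag ?n1 (\<lambda>i. es ! i))"
    by (rule eq_matI) (use n in \<open>auto simp: mat_diag_def nth_Cons'\<close>)
  have A'V: "A' = ?V * mat_diag n (\<lambda>i. (e # es) ! i) * ?V\<^sup>T"
  proof -
    let ?D' = "mat_diag ?n1 (\<lambda>i. es ! i)"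
    have D': "?D' \<in> carrier_mat ?n1 ?n1" by simp
    have "?V * four_block_mat ?E (0\<^sub>m 1 ?n1) (0\<^sub>m ?n1 1) ?D' =
      four_block_mat ?E (0\<^sub>m 1 ?n1) (0\<^sub>m ?n1 1) (U * ?D')"
      using U D' by (subst mult_four_block_mat[of _ 1 1 _ ?n1 _ ?n1 _ _ 1 _ ?n1])
        (auto simp: left_mult_zero_mat[OF D'] right_mult_zero_mat[OF U] simp del: One_nat_def)
    moreover have "four_block_mat ?E (0\<^sub>m 1 ?n1) (0\<^sub>m ?n1 1) (U * ?D') * ?V\<^sup>T =
      four_block_mat ?E (0\<^sub>m 1 ?n1) (0\<^sub>m ?n1 1) (U * ?D' * U\<^sup>T)"
      unfolding VT using U D' mult_carrier_mat[OF U D']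
      by (subst mult_four_block_mat[of _ 1 1 _ ?n1 _ ?n1 _ _ 1 _ ?n1])
        (auto simp: left_mult_zero_mat[of "U\<^sup>T" ?n1 ?n1] right_mult_zero_mat[OF mult_carrier_mat[OF U D']]
          left_add_zero_mat[of _ ?n1 ?n1] simp del: One_nat_def)
    ultimately show ?thesis unfolding block D A3U by metis
  qed
  define V where "V = ?V"
  define D where "D = mat_diag n (\<lambda>i. (e # es) ! i)"
  note VV = VV[folded V_def] and VV' = VV'[folded V_def] and V = V[folded V_def] and A'V = A'V[folded V_def D_def]
  have Dc: "D \<in> carrier_mat n n" unfolding D_def by simp
  have VTc: "V\<^sup>T \<in> carrier_mat n n" "W\<^sup>T \<in> carrier_mat n n" using V W by auto
  note as = assoc_mult_mat[of _ n n _ n _ n]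
  let ?U = "W * V"
  have Uc: "?U \<in> carrier_mat n n" using W V by auto
  have UT: "?U\<^sup>T = V\<^sup>T * W\<^sup>T" by (rule transpose_mult[OF W V])
  have "?U\<^sup>T * ?U = V\<^sup>T * (W\<^sup>T * W) * V" unfolding UT by (rule mult_mat_regroup[OF VTc W V])
  hence 1: "?U\<^sup>T * ?U = 1\<^sub>m n" unfolding WW right_mult_one_mat[OF VTc(1)] VV .
  have "?U * ?U\<^sup>T = W * (V * V\<^sup>T) * W\<^sup>T" unfolding UT by (rule mult_mat_regroup[OF W V VTc])
  hence 2: "?U * ?U\<^sup>T = 1\<^sub>m n" unfolding VV' right_mult_one_mat[OF W] WW' .
  have "?U * D * ?U\<^sup>T = (W * (V * D)) * (V\<^sup>T * W\<^sup>T)" unfolding UT as[OF W V Dc] ..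
  also have "\<dots> = W * (V * D * V\<^sup>T) * W\<^sup>T" by (rule mult_mat_regroup[OF W mult_carrier_mat[OF V Dc] VTc])
  also have "\<dots> = W * (W\<^sup>T * A * W) * W\<^sup>T" unfolding A'V[symmetric] A'_def ..
  also have "\<dots> = (W * (W\<^sup>T * A)) * (W * W\<^sup>T)"
    by (rule mult_mat_regroup[symmetric, OF W mult_carrier_mat[OF VTc(2) A] W VTc(2)])
  also have "W * (W\<^sup>T * A) = (W * W\<^sup>T) * A" using as[OF W VTc(2) A] by simp
  also have "W * W\<^sup>T * A * (W * W\<^sup>T) = A" unfolding WW' using A by simp
  finally have "A = ?U * D * ?U\<^sup>T" ..
  moreover have "length (e # es) = n" using len n by simp
  ultimately show ?case using Uc 1 2 unfolding D_def by blast
qed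

text \<open>For a complex eigenvector \<open>v\<close>, the Hermitian form of \<open>A\<close> at
  \<open>v\<close> equals its own conjugate by symmetry, and it is \<open>l\<close> times the
  positive number \<open>|v|^2\<close>. The form is expanded into entries so that the symmetry
  becomes an exchange of two sums.\<close>

lemma symmetric_eigenvalue_real:
  fixes A :: "real mat"
  assumes A: "A \<in> carrier_mat n n" and sym: "A\<^sup>T = A"
    and ev: "eigenvalue (map_mat complex_of_real A) l"
  shows "l \<in> \<real>"
proof -
  let ?A = "map_mat complex_of_real A"
  obtain v where "eigenvector ?A v l" using ev unfolding eigenvalue_def by auto
  hence v: "v \<in> carrier_vec n" and v0: "v \<noteq> 0\<^sub>v n" and Av: "?A *\<^sub>v v = l \<cdot>\<^sub>v v"
    using A unfolding eigenvector_def by auto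
  have Ac: "?A \<in> carrier_mat n n" using A by auto
  have e: "(\<Sum>k<n. complex_of_real (A $$ (i,k)) * v $ k) = l * v $ i" if "i < n" for i
    using arg_cong[OF Av, of "\<lambda>w. vec_index w i"] that A v
    by (simp add: scalar_prod_def atLeast0LessThan)
  have s: "A $$ (i,k) = A $$ (k,i)" if "i < n" "k < n" for i k
    using arg_cong[OF sym, of "\<lambda>M. M $$ (i,k)"] that A by auto
  let ?Q = "\<Sum>i<n. \<Sum>k<n. cnj (v $ i) * complex_of_real (A $$ (i,k)) * v $ k"
  have Q: "?Q = l * (\<Sum>i<n. cnj (v $ i) * v $ i)"
  proof -
    have "(\<Sum>k<n. cnj (v $ i) * complex_of_real (A $$ (i,k)) * v $ k) = l * (cnj (v $ i) * v $ i)"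
      if "i < n" for i
    proof -
      have "(\<Sum>k<n. cnj (v $ i) * complex_of_real (A $$ (i,k)) * v $ k) =
        cnj (v $ i) * (\<Sum>k<n. complex_of_real (A $$ (i,k)) * v $ k)"
        by (simp add: sum_distrib_left mult.assoc)
      thus ?thesis using e[OF that] by simp
    qed
    thus ?thesis by (simp add: sum_distrib_left)
  qed
  have "cnj ?Q = (\<Sum>i<n. \<Sum>k<n. v $ i * complex_of_real (A $$ (i,k)) * cnj (v $ k))"
    by simp
  also have "\<dots> = (\<Sum>k<n. \<Sum>i<n. v $ i * complex_of_real (A $$ (i,k)) * cnj (v $ k))"
    by (rule sum.swap)
  also have "\<dots> = ?Q"
  proof (intro sum.cong refl)
    fix k i assume "k \<in> {..<n}" "i \<in> {..<n}"
    hence "A $$ (i,k) = A $$ (k,i)" using s by simp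
    thus "v $ i * complex_of_real (A $$ (i,k)) * cnj (v $ k) = cnj (v $ k) * complex_of_real (A $$ (k,i)) * v $ i"
      by (simp only: mult_ac)
  qed
  finally have r: "?Q \<in> \<real>" by (simp only: Reals_cnj_iff)
  have nr: "(\<Sum>i<n. cnj (v $ i) * v $ i) = complex_of_real (\<Sum>i<n. (cmod (v $ i))\<^sup>2)"
    unfolding of_real_sum by (intro sum.cong refl) (metis complex_norm_square mult.commute)
  have "(\<Sum>i<n. (cmod (v $ i))\<^sup>2) \<noteq> 0"
  proof
    assume "(\<Sum>i<n. (cmod (v $ i))\<^sup>2) = 0"
    hence "\<forall>i<n. v $ i = 0" by (auto simp: sum_nonneg_eq_0_iff)
    with v0 v show False by (auto simp: vec_eq_iff)
  qed
  hence "complex_of_real (\<Sum>i<n. (cmod (v $ i))\<^sup>2) \<noteq> 0" by (simp only: of_real_eq_0_iff not_False_eq_True)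
  moreover have "?Q = l * complex_of_real (\<Sum>i<n. (cmod (v $ i))\<^sup>2)" using Q nr by argo
  ultimately have "l = ?Q / complex_of_real (\<Sum>i<n. (cmod (v $ i))\<^sup>2)" by (simp only: nonzero_mult_div_cancel_right not_False_eq_True)
  show ?thesis unfolding \<open>l = _\<close> using r by (intro Reals_divide Reals_of_real)
qed

text \<open>The characteristic polynomial splits over the complex numbers and all its roots are
  real, so the factorization descends to the reals by injectivity of the coefficient embedding. It
  is returned together with the diagonalization because the spectral distribution is defined through
  the roots of this polynomial.\<close>

theorem symmetric_diagonalization:
  fixes A :: "real mat"
  assumes A: "A \<in> carrier_mat n n" and sym: "A\<^sup>T = A"
  obtains U l where "U \<in> carrier_mat n n" "U\<^sup>T * U = 1\<^sub>m n" "U * U\<^sup>T = 1\<^sub>m n"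
    "A = U * mat_diag n l * U\<^sup>T" "char_poly A = (\<Prod>i<n. [:- l i, 1:])"
proof -
  let ?A = "map_mat complex_of_real A"
  have Ac: "?A \<in> carrier_mat n n" using A by auto
  interpret cr: inj_comm_ring_hom complex_of_real by (unfold_locales) auto
  interpret cp: map_poly_inj_comm_ring_hom complex_of_real ..
  obtain es where es: "char_poly ?A = (\<Prod>e\<leftarrow>es. [:- e, 1:])"
    using char_poly_factorized[OF Ac] by auto
  have re: "e \<in> \<real>" if "e \<in> set es" for e
  proof (rule symmetric_eigenvalue_real[OF A sym])
    show "eigenvalue ?A e" unfolding eigenvalue_root_char_poly[OF Ac] es
      using that by (auto simp: poly_prod_list prod_list_zero_iff)
  qed
  have "map_poly complex_of_real (char_poly A) = map_poly complex_of_real (\<Prod>e\<leftarrow>map Re es. [:- e, 1:])"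
    (is "_ = ?r")
  proof -
    have "?r = (\<Prod>e\<leftarrow>es. [:- e, 1:])" using re
    proof (induct es)
      case (Cons a es)
      have "map_poly complex_of_real [:- Re a, 1:] = [:- a, 1:]" using Cons(2)[of a] by simp
      thus ?case using Cons cp.hom_mult by (simp del: mult_pCons_left)
    qed simp
    thus ?thesis using es of_real_hom.char_poly_hom[OF A, where 'a = complex] by simp
  qed
  hence cp: "char_poly A = (\<Prod>e\<leftarrow>map Re es. [:- e, 1:])"
    by (metis cp.injectivity)
  from symmetric_diagonalization_split[OF A sym this] obtain U where
    U: "U \<in> carrier_mat n n" "U\<^sup>T * U = 1\<^sub>m n" "U * U\<^sup>T = 1\<^sub>m n"
    "A = U * mat_diag n (\<lambda>i. map Re es ! i) * U\<^sup>T" and len: "length (map Re es) = n" by blast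
  have "(\<Prod>e\<leftarrow>map Re es. [:- e, 1:]) = (\<Prod>i<n. [:- (map Re es ! i), 1:])"
    using len by (subst prod.list_conv_set_nth) (simp add: atLeast0LessThan)
  with cp U that show ?thesis by metis
qed

section \<open>Quadratic forms and functional calculus in an eigenbasis\<close>

abbreviation qform :: "nat \<Rightarrow> real mat \<Rightarrow> (nat \<Rightarrow> real) \<Rightarrow> real" where
  "qform p A v \<equiv> vec p v \<bullet> (A *\<^sub>v vec p v)"

lemma qform_sum:
  assumes "A \<in> carrier_mat p p"
  shows "qform p A v = (\<Sum>i<p. \<Sum>k<p. v i * A $$ (i,k) * v k)"
  using assms by (simp add: scalar_prod_def atLeast0LessThan sum_distrib_left mult.assoc)

lemma mat_mult_entry:
  assumes "A \<in> carrier_mat n m" "B \<in> carrier_mat m k" "i < n" "j < k"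
  shows "(A * B) $$ (i,j) = (\<Sum>a<m. A $$ (i,a) * B $$ (a,j))"
  using assms by (simp add: scalar_prod_def atLeast0LessThan)

definition orth_mat :: "nat \<Rightarrow> real mat \<Rightarrow> bool" where
  "orth_mat p U \<longleftrightarrow> U \<in> carrier_mat p p \<and> U\<^sup>T * U = 1\<^sub>m p \<and> U * U\<^sup>T = 1\<^sub>m p"

text \<open>Functional calculus in a fixed orthonormal basis: resolvents, powers and spectral
  projections of one matrix share \<open>U\<close> and differ only in \<open>l\<close>, so matrix
  algebra becomes pointwise algebra of functions on indices below \<open>p\<close>.\<close>

definition conj_diag :: "nat \<Rightarrow> real mat \<Rightarrow> (nat \<Rightarrow> real) \<Rightarrow> real mat" where
  "conj_diag p U l = U * mat_diag p l * U\<^sup>T"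

lemma conj_diag_carrier [simp]:
  assumes "orth_mat p U" shows "conj_diag p U l \<in> carrier_mat p p"
  using assms unfolding orth_mat_def conj_diag_def by auto

lemma conj_diag_dim [simp]:
  assumes "orth_mat p U" shows "dim_row (conj_diag p U l) = p" "dim_col (conj_diag p U l) = p"
  using conj_diag_carrier[OF assms, of l] by auto

lemma conj_diag_transpose:
  assumes "orth_mat p U" shows "(conj_diag p U l)\<^sup>T = conj_diag p U l"
proof -
  have U: "U \<in> carrier_mat p p" using assms unfolding orth_mat_def by auto
  have D: "(mat_diag p l)\<^sup>T = mat_diag p l" by (rule eq_matI) (auto simp: mat_diag_def)
  have "(U * mat_diag p l * U\<^sup>T)\<^sup>T = U\<^sup>T\<^sup>T * (U * mat_diag p l)\<^sup>T"
    by (rule transpose_mult[of _ p p _ p]) (use U in auto)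
  also have "(U * mat_diag p l)\<^sup>T = mat_diag p l * U\<^sup>T"
    using transpose_mult[of U p p "mat_diag p l" p] U D by simp
  also have "U\<^sup>T\<^sup>T * (mat_diag p l * U\<^sup>T) = U * mat_diag p l * U\<^sup>T"
    using assoc_mult_mat[of U p p "mat_diag p l" p "U\<^sup>T" p] U by simp
  finally show ?thesis unfolding conj_diag_def .
qed

lemma conj_diag_mult:
  assumes "orth_mat p U"
  shows "conj_diag p U f * conj_diag p U g = conj_diag p U (\<lambda>i. f i * g i)"
proof -
  have U: "U \<in> carrier_mat p p" "U\<^sup>T * U = 1\<^sub>m p" and T: "U\<^sup>T \<in> carrier_mat p p"
    using assms unfolding orth_mat_def by auto
  have c: "mat_diag p h \<in> carrier_mat p p" for h :: "nat \<Rightarrow> real" by simp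
  note as = assoc_mult_mat[of _ p p _ p _ p]
  have "conj_diag p U f * conj_diag p U g = (U * mat_diag p f * U\<^sup>T) * (U * (mat_diag p g * U\<^sup>T))"
    unfolding conj_diag_def using as[OF U(1) c T] by simp
  also have "\<dots> = (U * mat_diag p f) * (U\<^sup>T * U) * (mat_diag p g * U\<^sup>T)"
    by (rule mult_mat_regroup[OF _ T U(1) mult_carrier_mat[OF c T]]) (use U in auto)
  also have "\<dots> = (U * mat_diag p f) * (mat_diag p g * U\<^sup>T)"
    unfolding U(2) using right_mult_one_mat[of "U * mat_diag p f" p p] U by simp
  also have "\<dots> = U * (mat_diag p f * mat_diag p g) * U\<^sup>T"
    by (rule mult_mat_regroup) (use U in auto)
  finally show ?thesis unfolding conj_diag_def mat_diag_diag .
qed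

lemma conj_diag_one:
  assumes "orth_mat p U" shows "conj_diag p U (\<lambda>_. 1) = 1\<^sub>m p"
proof -
  have "mat_diag p (\<lambda>_. 1) = (1\<^sub>m p :: real mat)" by (rule eq_matI) (auto simp: mat_diag_def)
  thus ?thesis using assms unfolding orth_mat_def conj_diag_def by (metis right_mult_one_mat)
qed

lemma conj_diag_entry:
  assumes "orth_mat p U" "i < p" "k < p"
  shows "conj_diag p U l $$ (i,k) = (\<Sum>j<p. l j * U $$ (i,j) * U $$ (k,j))"
proof -
  have U: "U \<in> carrier_mat p p" using assms unfolding orth_mat_def by auto
  have UD: "U * mat_diag p l \<in> carrier_mat p p" using U by auto
  have "(U * mat_diag p l) $$ (i,j) = l j * U $$ (i,j)" if "j < p" for j
    using mat_diag_mult_right[OF U, of l] that assms by simp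
  moreover have "(U\<^sup>T) $$ (j,k) = U $$ (k,j)" if "j < p" for j using that U assms by auto
  moreover have "conj_diag p U l $$ (i,k) = (\<Sum>j<p. (U * mat_diag p l) $$ (i,j) * (U\<^sup>T) $$ (j,k))"
    unfolding conj_diag_def using U assms by (intro mat_mult_entry[OF UD]) auto
  ultimately show ?thesis by simp
qed

text \<open>The coordinates of \<open>v\<close> in the basis formed by the columns of
  \<open>U\<close>.\<close>

definition rot :: "nat \<Rightarrow> real mat \<Rightarrow> (nat \<Rightarrow> real) \<Rightarrow> nat \<Rightarrow> real" where
  "rot p U v j = (\<Sum>i<p. U $$ (i,j) * v i)"

lemma qform_conj_diag:
  assumes "orth_mat p U"
  shows "qform p (conj_diag p U l) v = (\<Sum>j<p. l j * (rot p U v j)\<^sup>2)"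
proof -
  have "qform p (conj_diag p U l) v = (\<Sum>i<p. \<Sum>k<p. \<Sum>j<p. l j * (U $$ (i,j) * v i) * (U $$ (k,j) * v k))"
    unfolding qform_sum[OF conj_diag_carrier[OF assms]]
    by (intro sum.cong refl) (auto simp: conj_diag_entry[OF assms] sum_distrib_left sum_distrib_right mult_ac)
  also have "\<dots> = (\<Sum>i<p. \<Sum>j<p. \<Sum>k<p. l j * (U $$ (i,j) * v i) * (U $$ (k,j) * v k))"
    by (intro sum.cong refl sum.swap)
  also have "\<dots> = (\<Sum>j<p. \<Sum>i<p. \<Sum>k<p. l j * (U $$ (i,j) * v i) * (U $$ (k,j) * v k))"
    by (rule sum.swap)
  also have "\<dots> = (\<Sum>j<p. l j * (rot p U v j)\<^sup>2)"
    by (intro sum.cong refl) (simp add: rot_def power2_eq_square sum_product sum_distrib_left mult_ac)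
  finally show ?thesis .
qed

lemma qform_one: "qform p (1\<^sub>m p) v = (\<Sum>i<p. (v i)\<^sup>2)"
  by (simp add: scalar_prod_def atLeast0LessThan power2_eq_square)

lemma sum_rot_sq:
  assumes "orth_mat p U" shows "(\<Sum>j<p. (rot p U v j)\<^sup>2) = (\<Sum>i<p. (v i)\<^sup>2)"
  using qform_conj_diag[OF assms, where l = "\<lambda>_. 1" and v = v] by (simp add: conj_diag_one[OF assms] qform_one del: one_mult_mat_vec)

lemma mat_trace_conj_diag:
  assumes "orth_mat p U" shows "mat_trace (conj_diag p U l) = (\<Sum>j<p. l j)"
proof -
  have U: "U \<in> carrier_mat p p" "U\<^sup>T * U = 1\<^sub>m p" using assms unfolding orth_mat_def by auto
  have 1: "(\<Sum>i<p. U $$ (i,j) * U $$ (i,j)) = 1" if "j < p" for j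
    using arg_cong[OF U(2), of "\<lambda>M. M $$ (j,j)"] that U(1)
    by (simp add: scalar_prod_def atLeast0LessThan)
  have "mat_trace (conj_diag p U l) = (\<Sum>i<p. \<Sum>j<p. l j * U $$ (i,j) * U $$ (i,j))"
    unfolding mat_trace_def using conj_diag_carrier[OF assms, of l]
    by (auto intro!: sum.cong simp: conj_diag_entry[OF assms])
  also have "\<dots> = (\<Sum>j<p. l j * (\<Sum>i<p. U $$ (i,j) * U $$ (i,j)))"
    by (subst sum.swap) (simp add: sum_distrib_left mult_ac)
  finally show ?thesis using 1 by simp
qed

lemma conj_diag_pow:
  assumes "orth_mat p U" shows "conj_diag p U l ^\<^sub>m k = conj_diag p U (\<lambda>i. l i ^ k)"
proof (induct k)
  case 0
  have "dim_row (conj_diag p U l) = p" using conj_diag_carrier[OF assms, of l] by auto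
  then show ?case by (simp add: conj_diag_one[OF assms])
qed (simp add: conj_diag_mult[OF assms] mult.commute)

lemma symmetric_conj_diag:
  assumes A: "A \<in> carrier_mat n n" and sym: "A\<^sup>T = A"
  obtains U l where "orth_mat n U" "A = conj_diag n U l" "char_poly A = (\<Prod>i<n. [:- l i, 1:])"
  using symmetric_diagonalization[OF assms] unfolding orth_mat_def conj_diag_def by metis

text \<open>The eigenvalue \<open>l i\<close> is the value of the quadratic form at the
  \<open>i\<close>-th column of \<open>U\<close>.\<close>

lemma psd_conj_diag:
  assumes U: "orth_mat p U" and psd: "\<And>v. qform p (conj_diag p U l) v \<ge> 0" and i: "i < p"
  shows "l i \<ge> 0"
proof -
  have "rot p U (\<lambda>k. U $$ (k,i)) j = (if j = i then 1 else 0)" if "j < p" for j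
  proof -
    have Uc: "U \<in> carrier_mat p p" using U unfolding orth_mat_def by auto
    hence "rot p U (\<lambda>k. U $$ (k,i)) j = (U\<^sup>T * U) $$ (j,i)" unfolding rot_def
      using i that by (subst mat_mult_entry[of _ p p _ p]) auto
    also have "U\<^sup>T * U = 1\<^sub>m p" using U unfolding orth_mat_def by auto
    finally show ?thesis using i that by simp
  qed
  hence "qform p (conj_diag p U l) (\<lambda>k. U $$ (k,i)) = (\<Sum>j<p. l j * (if j = i then 1 else 0))"
    unfolding qform_conj_diag[OF U] by (intro sum.cong) auto
  also have "\<dots> = l i" using i by (simp add: if_distrib cong: if_cong)
  finally show ?thesis using psd by metis
qed

lemma ESD_eq_card:
  assumes "A \<in> carrier_mat p p" "char_poly A = (\<Prod>i<p. [:- l i, 1:])"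
  shows "ESD A t = real (card {i. i < p \<and> l i \<le> t}) / real p"
proof -
  have pr: "proots (\<Prod>i<p. [:- l i, 1:]) = (\<Sum>i<p. {#l i#})"
    by (subst proots_prod) auto
  have "{#x \<in># (\<Sum>i<k. {#l i#}). x \<le> t#} = (\<Sum>i<k. if l i \<le> t then {#l i#} else {#})" for k
    by (induct k) auto
  hence "size {#x \<in># (\<Sum>i<p. {#l i#}). x \<le> t#} = (\<Sum>i<p. if l i \<le> t then 1 else 0)"
    by (simp add: size_multiset_sum if_distrib[of size] cong: if_cong)
  also have "\<dots> = card {i. i < p \<and> l i \<le> t}"
    by (simp add: sum.If_cases Int_def)
  finally show ?thesis unfolding ESD_def assms(2) pr using assms(1) by auto
qed

text \<open>The inverse of \<open>A + x\<close>, that is, the resolvent at the point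
  \<open>- x\<close>. Writing it as adjugate over determinant makes its entries explicit rational
  functions of the entries of \<open>A\<close>, from which measurability is read off.\<close>

definition resolv :: "real \<Rightarrow> real mat \<Rightarrow> real mat" where
  "resolv x A = (let B = A + x \<cdot>\<^sub>m 1\<^sub>m (dim_row A) in inverse (det B) \<cdot>\<^sub>m adj_mat B)"

lemma shift_conj_diag:
  assumes "orth_mat p U"
  shows "conj_diag p U l + x \<cdot>\<^sub>m 1\<^sub>m p = conj_diag p U (\<lambda>i. l i + x)"
proof (rule eq_matI)
  fix i k assume "i < dim_row (conj_diag p U (\<lambda>i. l i + x))" "k < dim_col (conj_diag p U (\<lambda>i. l i + x))"
  hence ik: "i < p" "k < p" using assms by auto
  have "x * (1\<^sub>m p $$ (i,k)) = x * (\<Sum>j<p. 1 * U $$ (i,j) * U $$ (k,j))"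
    unfolding conj_diag_entry[OF assms ik, symmetric] conj_diag_one[OF assms] ..
  thus "(conj_diag p U l + x \<cdot>\<^sub>m 1\<^sub>m p) $$ (i,k) = conj_diag p U (\<lambda>i. l i + x) $$ (i,k)"
    using ik assms
    by (simp add: conj_diag_entry[OF assms ik] algebra_simps sum.distrib sum_distrib_left)
qed (use assms in auto)

lemma resolv_inverse:
  assumes B: "B \<in> carrier_mat p p" and C: "C \<in> carrier_mat p p" and BC: "(B + x \<cdot>\<^sub>m 1\<^sub>m p) * C = 1\<^sub>m p"
  shows "resolv x B = C"
proof -
  let ?B = "B + x \<cdot>\<^sub>m 1\<^sub>m p"
  have B': "?B \<in> carrier_mat p p" using B by auto
  have "det ?B * det C = 1" using det_mult[OF B' C] BC by simp
  hence d: "det ?B \<noteq> 0" by auto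
  have r: "resolv x B = inverse (det ?B) \<cdot>\<^sub>m adj_mat ?B" unfolding resolv_def using B by (simp add: Let_def)
  have adj: "adj_mat ?B \<in> carrier_mat p p" "adj_mat ?B * ?B = det ?B \<cdot>\<^sub>m 1\<^sub>m p" using adj_mat[OF B'] by auto
  have "resolv x B = resolv x B * (?B * C)" unfolding BC r using adj by simp
  also have "\<dots> = (resolv x B * ?B) * C"
    by (rule assoc_mult_mat[symmetric]) (use adj B' C in \<open>auto simp: r\<close>)
  also have "resolv x B * ?B = inverse (det ?B) \<cdot>\<^sub>m (det ?B \<cdot>\<^sub>m 1\<^sub>m p)"
    unfolding r adj(2)[symmetric] by (rule mult_smult_assoc_mat[OF adj(1) B'])
  also have "\<dots> = 1\<^sub>m p" by (rule eq_matI) (use d in auto)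
  finally show ?thesis using C by simp
qed

lemma resolv_conj_diag:
  assumes U: "orth_mat p U" and l: "\<And>i. i < p \<Longrightarrow> l i \<ge> 0" and x: "x > 0"
  shows "resolv x (conj_diag p U l) = conj_diag p U (\<lambda>i. 1 / (l i + x))"
proof (rule resolv_inverse)
  have "conj_diag p U (\<lambda>i. (l i + x) * (1 / (l i + x))) = conj_diag p U (\<lambda>i. 1)"
  proof (rule eq_matI)
    fix i k assume "i < dim_row (conj_diag p U (\<lambda>i. 1))" "k < dim_col (conj_diag p U (\<lambda>i. 1))"
    hence ik: "i < p" "k < p" using U by auto
    have "(l j + x) * (1 / (l j + x)) = 1" if "j < p" for j using l[OF that] x by simp
    thus "conj_diag p U (\<lambda>i. (l i + x) * (1 / (l i + x))) $$ (i,k) = conj_diag p U (\<lambda>i. 1) $$ (i,k)"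
      unfolding conj_diag_entry[OF U ik] by (intro sum.cong refl) simp
  qed (use U in auto)
  thus "(conj_diag p U l + x \<cdot>\<^sub>m 1\<^sub>m p) * conj_diag p U (\<lambda>i. 1 / (l i + x)) = 1\<^sub>m p"
    unfolding shift_conj_diag[OF U] conj_diag_mult[OF U] conj_diag_one[OF U] by simp
qed (use U in auto)

section \<open>Positive semidefinite matrices and rank-one perturbations\<close>

definition psd :: "nat \<Rightarrow> real mat \<Rightarrow> bool" where
  "psd p A \<longleftrightarrow> A \<in> carrier_mat p p \<and> A\<^sup>T = A \<and> (\<forall>v. qform p A v \<ge> 0)"

text \<open>One eigenbasis serves the spectral distribution and the resolvents at all
  \<open>x > 0\<close> simultaneously; the transform of the empirical measure needs exactly
  this.\<close>

lemma psd_spectral: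
  assumes "psd p A"
  obtains U l where "orth_mat p U" "A = conj_diag p U l" "\<And>i. i < p \<Longrightarrow> l i \<ge> 0"
    "\<And>t. ESD A t = real (card {i. i < p \<and> l i \<le> t}) / real p"
    "\<And>x. x > 0 \<Longrightarrow> resolv x A = conj_diag p U (\<lambda>i. 1 / (l i + x))"
proof -
  have A: "A \<in> carrier_mat p p" "A\<^sup>T = A" and q: "\<And>v. qform p A v \<ge> 0" using assms unfolding psd_def by auto
  from symmetric_conj_diag[OF A] obtain U l where U: "orth_mat p U" and Al: "A = conj_diag p U l"
    and cp: "char_poly A = (\<Prod>i<p. [:- l i, 1:])" by metis
  have l: "\<And>i. i < p \<Longrightarrow> l i \<ge> 0" by (rule psd_conj_diag[OF U]) (use q Al in auto)
  show ?thesis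
    by (rule that[OF U Al l ESD_eq_card[OF A(1) cp]]) (auto simp: Al intro: resolv_conj_diag[OF U l])
qed

lemma psd_resolv:
  assumes "psd p A" "x > 0"
  obtains U l where "orth_mat p U" "A = conj_diag p U l" "\<And>i. i < p \<Longrightarrow> l i \<ge> 0"
    "resolv x A = conj_diag p U (\<lambda>i. 1 / (l i + x))"
  by (rule psd_spectral[OF assms(1)]) (use assms(2) in blast)

lemma resolv_carrier:
  assumes "psd p A" "x > 0" shows "resolv x A \<in> carrier_mat p p"
  by (rule psd_resolv[OF assms]) simp

text \<open>Sherman-Morrison. With \<open>R\<close> the matrix of the rank-one term, the resolvent
  identity \<open>GB = GA + GB * R * GA\<close> applied to \<open>w\<close> gives
  \<open>q = s + q * s\<close> for the two quadratic forms at \<open>w\<close>, hence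
  \<open>s = q / (1 + q)\<close>. The difference of the traces is \<open>|GB w|^2 / (1 + q)\<close>,
  and \<open>|GB w|^2 <= q / x\<close> because the eigenvalues of \<open>GB\<close> are at most
  \<open>1 / x\<close>. The resulting bound \<open>1 / x\<close> is independent of the size of
  \<open>w\<close>.\<close>

lemma psd_rank_one_update:
  fixes B :: "real mat" and w :: "nat \<Rightarrow> real"
  assumes B: "psd p B" and Ap: "psd p A" and x: "x > 0"
    and A: "\<And>i k. i < p \<Longrightarrow> k < p \<Longrightarrow> A $$ (i,k) = B $$ (i,k) + w i * w k"
  defines "q \<equiv> qform p (resolv x B) w"
  shows "q \<ge> 0" "qform p (resolv x A) w = q / (1 + q)"
    "\<bar>mat_trace (resolv x A) - mat_trace (resolv x B)\<bar> \<le> 1 / x"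
proof -
  obtain U l where U: "orth_mat p U" and Bl: "B = conj_diag p U l" and l: "\<And>i. i < p \<Longrightarrow> l i \<ge> 0"
    and G: "resolv x B = conj_diag p U (\<lambda>i. 1 / (l i + x))"
    using psd_resolv[OF B x] by blast
  obtain U' l' where U': "orth_mat p U'" and Al: "A = conj_diag p U' l'" and l': "\<And>i. i < p \<Longrightarrow> l' i \<ge> 0"
    and G': "resolv x A = conj_diag p U' (\<lambda>i. 1 / (l' i + x))"
    using psd_resolv[OF Ap x] by blast
  define GB where "GB = resolv x B"
  define GA where "GA = resolv x A"
  define R where "R = mat p p (\<lambda>(i,k). w i * w k)"
  have Rc: "R \<in> carrier_mat p p" unfolding R_def by auto
  have GBc: "GB \<in> carrier_mat p p" and GAc: "GA \<in> carrier_mat p p"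
    unfolding GB_def GA_def G G' using U U' by auto
  have Bc: "B \<in> carrier_mat p p" and Ac: "A \<in> carrier_mat p p" using B Ap unfolding psd_def by auto
  define L where "L = B + x \<cdot>\<^sub>m 1\<^sub>m p"
  define M where "M = A + x \<cdot>\<^sub>m 1\<^sub>m p"
  have Lc: "L \<in> carrier_mat p p" and Mc: "M \<in> carrier_mat p p" unfolding L_def M_def using Bc Ac by auto
  have one: "conj_diag p V (\<lambda>i. h i * (1 / h i)) = 1\<^sub>m p" if "orth_mat p V" "\<And>i. i < p \<Longrightarrow> h i > 0" for V h
  proof -
    have "mat_diag p (\<lambda>i. h i * (1 / h i)) = mat_diag p (\<lambda>i. 1)"
      by (rule eq_matI) (use that(2) in \<open>auto simp: mat_diag_def less_imp_neq[symmetric]\<close>)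
    thus ?thesis using conj_diag_one[OF that(1)] unfolding conj_diag_def by simp
  qed
  have GL: "GB * L = 1\<^sub>m p" unfolding GB_def L_def G unfolding Bl shift_conj_diag[OF U] conj_diag_mult[OF U]
    using one[OF U, of "\<lambda>i. l i + x"] l x by (simp add: mult.commute add_nonneg_pos)
  have MG: "M * GA = 1\<^sub>m p" unfolding GA_def M_def G' unfolding Al shift_conj_diag[OF U'] conj_diag_mult[OF U']
    using one[OF U', of "\<lambda>i. l' i + x"] l' x by (simp add: add_nonneg_pos)
  have MLR: "M = L + R"
    by (rule eq_matI) (use Ac Bc Rc in \<open>auto simp: M_def L_def R_def A\<close>)
  have "GB = GB * (M * GA)" unfolding MG using GBc by simp
  also have "\<dots> = GB * (L + R) * GA" unfolding MLR[symmetric] by (rule assoc_mult_mat[symmetric, OF GBc Mc GAc])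
  also have "GB * (L + R) = 1\<^sub>m p + GB * R" unfolding GL[symmetric] by (rule mult_add_distrib_mat[OF GBc Lc Rc])
  also have "(1\<^sub>m p + GB * R) * GA = GA + GB * R * GA"
    using add_mult_distrib_mat[of "1\<^sub>m p" p p "GB * R" GA p] GBc Rc GAc by simp
  finally have res: "GB = GA + GB * R * GA" .
  have sA: "GA $$ (i,k) = GA $$ (k,i)" if "i < p" "k < p" for i k
    using arg_cong[OF conj_diag_transpose[OF U', of "\<lambda>i. 1 / (l' i + x)"], of "\<lambda>M. M $$ (i,k)"] that U'
    unfolding GA_def G' by simp
  have sB: "GB $$ (i,k) = GB $$ (k,i)" if "i < p" "k < p" for i k
    using arg_cong[OF conj_diag_transpose[OF U, of "\<lambda>i. 1 / (l i + x)"], of "\<lambda>M. M $$ (i,k)"] that U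
    unfolding GB_def G by simp
  \<comment> \<open>\<open>g = GB w\<close> and \<open>y = GA w\<close>; by the resolvent identity
    and the symmetry of \<open>GA\<close>, the two resolvents differ by the rank-one matrix with
    entries \<open>g i * y k\<close>.\<close>
  define g where "g i = (\<Sum>j<p. GB $$ (i,j) * w j)" for i
  define y where "y k = (\<Sum>j<p. GA $$ (k,j) * w j)" for k
  have GR: "(GB * R) $$ (i,m) = g i * w m" if "i < p" "m < p" for i m
    using that by (subst mat_mult_entry[OF GBc Rc]) (auto simp: R_def g_def sum_distrib_right mult.assoc)
  have e: "GB $$ (i,k) = GA $$ (i,k) + g i * y k" if ik: "i < p" "k < p" for i k
  proof -
    have "(GB * R * GA) $$ (i,k) = (\<Sum>m<p. g i * w m * GA $$ (m,k))"
      using ik GR by (subst mat_mult_entry[OF mult_carrier_mat[OF GBc Rc] GAc]) auto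
    also have "\<dots> = g i * y k" unfolding y_def sum_distrib_left
      using ik sA by (intro sum.cong) (auto simp: mult_ac)
    finally show ?thesis using arg_cong[OF res, of "\<lambda>M. M $$ (i,k)"] ik GAc GBc Rc by simp
  qed
  define s where "s = (\<Sum>k<p. y k * w k)"
  have q: "q = (\<Sum>i<p. w i * g i)" unfolding q_def GB_def[symmetric] qform_sum[OF GBc] g_def
    by (simp add: sum_distrib_left mult.assoc)
  have s: "qform p (resolv x A) w = s" unfolding s_def GA_def[symmetric] qform_sum[OF GAc] y_def
    by (simp add: sum_distrib_left mult_ac)
  have gy: "g i = y i + g i * s" if "i < p" for i
  proof -
    have "g i = (\<Sum>k<p. GB $$ (i,k) * w k)" by (fact g_def)
    also have "\<dots> = (\<Sum>k<p. GA $$ (i,k) * w k + g i * (y k * w k))"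
      by (rule sum.cong) (use that e in \<open>auto simp: distrib_right mult.assoc\<close>)
    also have "\<dots> = y i + g i * s" unfolding sum.distrib y_def[symmetric] s_def sum_distrib_left ..
    finally show ?thesis .
  qed
  have "q = (\<Sum>i<p. w i * (y i + g i * s))" unfolding q by (rule sum.cong) (use gy in auto)
  also have "\<dots> = (\<Sum>i<p. y i * w i + (w i * g i) * s)" by (rule sum.cong) (simp_all only: distrib_left mult_ac)
  also have "\<dots> = s + q * s" unfolding sum.distrib s_def[symmetric] sum_distrib_right[symmetric] q[symmetric] ..
  finally have qs: "q = s + q * s" .
  have qrot: "q = (\<Sum>j<p. 1 / (l j + x) * (rot p U w j)\<^sup>2)" unfolding q_def G by (rule qform_conj_diag[OF U])
  show q0: "q \<ge> 0" unfolding qrot using l x by (intro sum_nonneg mult_nonneg_nonneg) (auto intro!: divide_nonneg_pos add_nonneg_pos)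
  have s_eq: "s = q / (1 + q)" using qs q0 by (simp add: field_simps)
  thus "qform p (resolv x A) w = q / (1 + q)" using s by simp
  \<comment> \<open>The squared norm of \<open>GB w\<close> is the quadratic form of
    \<open>GB * GB\<close>, which spectrally is bounded by \<open>1 / x\<close> times the form of
    \<open>GB\<close>.\<close>
  have "(\<Sum>i<p. g i * g i) = qform p (GB * GB) w"
  proof -
    have "qform p (GB * GB) w = (\<Sum>i<p. \<Sum>k<p. \<Sum>j<p. (GB $$ (j,i) * w i) * (GB $$ (j,k) * w k))"
      unfolding qform_sum[OF mult_carrier_mat[OF GBc GBc]]
    proof (intro sum.cong refl)
      fix i k assume "i \<in> {..<p}" "k \<in> {..<p}"
      hence ik: "i < p" "k < p" by auto
      have "(GB * GB) $$ (i,k) = (\<Sum>j<p. GB $$ (j,i) * GB $$ (j,k))"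
        unfolding mat_mult_entry[OF GBc GBc ik] by (rule sum.cong) (use sB ik in auto)
      thus "w i * (GB * GB) $$ (i,k) * w k = (\<Sum>j<p. (GB $$ (j,i) * w i) * (GB $$ (j,k) * w k))"
        by (simp only: sum_distrib_left sum_distrib_right mult_ac)
    qed
    also have "\<dots> = (\<Sum>i<p. \<Sum>j<p. \<Sum>k<p. (GB $$ (j,i) * w i) * (GB $$ (j,k) * w k))"
      by (intro sum.cong refl sum.swap)
    also have "\<dots> = (\<Sum>j<p. \<Sum>i<p. \<Sum>k<p. (GB $$ (j,i) * w i) * (GB $$ (j,k) * w k))"
      by (rule sum.swap)
    also have "\<dots> = (\<Sum>j<p. g j * g j)" by (simp add: g_def sum_product)
    finally show ?thesis ..
  qed
  also have "GB * GB = conj_diag p U (\<lambda>i. 1 / (l i + x) * (1 / (l i + x)))"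
    unfolding GB_def G conj_diag_mult[OF U] ..
  also have "qform p (conj_diag p U (\<lambda>i. 1 / (l i + x) * (1 / (l i + x)))) w =
      (\<Sum>j<p. 1 / (l j + x) * (1 / (l j + x)) * (rot p U w j)\<^sup>2)" by (rule qform_conj_diag[OF U])
  also have "\<dots> \<le> (\<Sum>j<p. 1 / x * (1 / (l j + x)) * (rot p U w j)\<^sup>2)"
    using l x by (intro sum_mono mult_right_mono) (auto simp: add_nonneg_pos frac_le intro!: divide_nonneg_pos)
  also have "\<dots> = q / x" unfolding qrot sum_divide_distrib by (intro sum.cong refl) simp
  finally have gg: "(\<Sum>i<p. g i * g i) \<le> q / x" .
  have yg: "y i = g i / (1 + q)" if "i < p" for i
  proof -
    have "y i = g i * (1 - s)" using gy[OF that] by (simp add: algebra_simps)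
    also have "1 - s = 1 / (1 + q)" using q0 unfolding s_eq by (simp add: field_simps)
    finally show ?thesis by simp
  qed
  have "mat_trace GB - mat_trace GA = (\<Sum>i<p. g i * y i)"
    unfolding mat_trace_def using GAc GBc e by (simp add: sum.distrib)
  also have "\<dots> = (\<Sum>i<p. g i * g i) / (1 + q)" using yg by (simp add: sum_divide_distrib)
  finally have t: "mat_trace GB - mat_trace GA = (\<Sum>i<p. g i * g i) / (1 + q)" .
  have "(\<Sum>i<p. g i * g i) / (1 + q) \<le> (q / x) / (1 + q)" using gg q0 by (intro divide_right_mono) auto
  also have "(q / x) / (1 + q) = (q / (1 + q)) / x" by simp
  also have "\<dots> \<le> 1 / x" using q0 x by (intro divide_right_mono) auto
  finally have "mat_trace GB - mat_trace GA \<le> 1 / x" unfolding t .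
  moreover have "mat_trace GB - mat_trace GA \<ge> 0" unfolding t using q0 by (intro divide_nonneg_nonneg sum_nonneg) auto
  ultimately show "\<bar>mat_trace (resolv x A) - mat_trace (resolv x B)\<bar> \<le> 1 / x"
    unfolding GA_def GB_def by linarith
qed

section \<open>Sample covariance matrices with one sample removed\<close>

lemma psd_sample_cov: "psd p (sample_cov p N X)"
proof -
  have c: "sample_cov p N X \<in> carrier_mat p p" unfolding sample_cov_def by auto
  have q: "qform p (sample_cov p N X) v = (1 / real N) * (\<Sum>j<N. (\<Sum>i<p. X j i * v i)\<^sup>2)" for v
  proof -
    have "qform p (sample_cov p N X) v = (\<Sum>i<p. \<Sum>k<p. \<Sum>j<N. (1 / real N) * ((X j i * v i) * (X j k * v k)))"
      unfolding qform_sum[OF c]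
      by (intro sum.cong refl) (auto simp: sample_cov_def sum_distrib_left sum_distrib_right mult_ac)
    also have "\<dots> = (\<Sum>i<p. \<Sum>j<N. \<Sum>k<p. (1 / real N) * ((X j i * v i) * (X j k * v k)))"
      by (intro sum.cong refl sum.swap)
    also have "\<dots> = (\<Sum>j<N. \<Sum>i<p. \<Sum>k<p. (1 / real N) * ((X j i * v i) * (X j k * v k)))"
      by (rule sum.swap)
    also have "\<dots> = (1 / real N) * (\<Sum>j<N. (\<Sum>i<p. X j i * v i)\<^sup>2)"
    proof -
      have "(\<Sum>i<p. X j i * v i)\<^sup>2 = (\<Sum>i<p. \<Sum>k<p. (X j i * v i) * (X j k * v k))" for j
        unfolding power2_eq_square sum_product ..
      thus ?thesis by (simp only: sum_distrib_left)
    qed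
    finally show ?thesis .
  qed
  have "(sample_cov p N X)\<^sup>T = sample_cov p N X"
    by (rule eq_matI) (auto simp: sample_cov_def mult.commute)
  thus "psd p (sample_cov p N X)" unfolding psd_def using c q by (auto intro!: divide_nonneg_nonneg sum_nonneg)
qed

text \<open>A sample is removed by replacing it with the zero vector, which leaves the index set and
  the factor \<open>1 / N\<close> unchanged; the difference is the rank-one term of
  \<open>X j / sqrt N\<close>.\<close>

lemma sample_cov_split:
  assumes "j < N" "N > 0" "i < p" "k < p"
  shows "sample_cov p N X $$ (i,k) = sample_cov p N (X(j := (\<lambda>_. 0))) $$ (i,k) +
    (X j i / sqrt (real N)) * (X j k / sqrt (real N))"
proof -
  have "(\<Sum>m<N. X m i * X m k) = X j i * X j k + (\<Sum>m\<in>{..<N} - {j}. X m i * X m k)"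
    using assms by (intro sum.remove) auto
  moreover have "(\<Sum>m<N. (X(j := (\<lambda>_. 0))) m i * (X(j := (\<lambda>_. 0))) m k) = (\<Sum>m\<in>{..<N} - {j}. X m i * X m k)"
    using assms by (subst sum.remove[of _ j]) auto
  ultimately show ?thesis using assms unfolding sample_cov_def by (simp add: field_simps)
qed

lemma qform_scale:
  assumes "A \<in> carrier_mat p p" shows "qform p A (\<lambda>i. v i / a) = qform p A v / a\<^sup>2"
  unfolding qform_sum[OF assms] power2_eq_square sum_divide_distrib by (intro sum.cong refl) simp

lemma
  fixes X :: "nat \<Rightarrow> nat \<Rightarrow> real" and p :: nat
  assumes j: "j < N" and N: "N > 0" and x: "x > 0"
  defines "u \<equiv> qform p (resolv x (sample_cov p N (X(j := (\<lambda>_. 0))))) (X j) / real N"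
  shows loo_nonneg: "u \<ge> 0"
    and loo_qform: "qform p (resolv x (sample_cov p N X)) (X j) / real N = u / (1 + u)"
    and loo_trace: "\<bar>mat_trace (resolv x (sample_cov p N X)) - mat_trace (resolv x (sample_cov p N (X(j := (\<lambda>_. 0)))))\<bar> \<le> 1 / x"
proof -
  let ?w = "\<lambda>i. X j i / sqrt (real N)"
  have c: "resolv x (sample_cov p N Y) \<in> carrier_mat p p" for Y
    by (rule resolv_carrier[OF psd_sample_cov x])
  have q: "qform p (resolv x (sample_cov p N Y)) ?w = qform p (resolv x (sample_cov p N Y)) (X j) / real N" for Y
    using qform_scale[OF c, where v = "X j" and a = "sqrt (real N)"] by simp
  note r = psd_rank_one_update[OF psd_sample_cov psd_sample_cov x sample_cov_split[OF j N, where p = p and X = X], unfolded q, folded u_def]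
  from r show "u \<ge> 0" "qform p (resolv x (sample_cov p N X)) (X j) / real N = u / (1 + u)"
    "\<bar>mat_trace (resolv x (sample_cov p N X)) - mat_trace (resolv x (sample_cov p N (X(j := (\<lambda>_. 0)))))\<bar> \<le> 1 / x" by simp_all
qed

text \<open>Two evaluations of the trace of \<open>(S + x)^-1 S\<close>: spectrally through
  \<open>l / (l + x) = 1 - x / (l + x)\<close>, and by expanding \<open>S\<close> as the average of
  the rank-one matrices of the samples.\<close>

lemma trace_resolv_identity:
  assumes x: "x > 0" and N: "N > 0"
  shows "real p - x * mat_trace (resolv x (sample_cov p N X)) =
    (\<Sum>j<N. qform p (resolv x (sample_cov p N X)) (X j) / real N)"
proof -
  let ?S = "sample_cov p N X"
  obtain U l where U: "orth_mat p U" and Sl: "?S = conj_diag p U l" and l: "\<And>i. i < p \<Longrightarrow> l i \<ge> 0"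
    and G: "resolv x ?S = conj_diag p U (\<lambda>i. 1 / (l i + x))"
    using psd_resolv[OF psd_sample_cov x] by blast
  have Sc: "?S \<in> carrier_mat p p" unfolding sample_cov_def by auto
  have Gc: "resolv x ?S \<in> carrier_mat p p" unfolding G using U by simp
  have "mat_trace (resolv x ?S * ?S) = mat_trace (conj_diag p U (\<lambda>i. 1 / (l i + x) * l i))"
    unfolding G unfolding Sl conj_diag_mult[OF U] ..
  also have "\<dots> = (\<Sum>i<p. 1 - x * (1 / (l i + x)))"
    unfolding mat_trace_conj_diag[OF U]
  proof (intro sum.cong refl)
    fix i assume "i \<in> {..<p}"
    hence "l i + x > 0" using l[of i] x by simp
    thus "1 / (l i + x) * l i = 1 - x * (1 / (l i + x))" by (simp add: field_simps)
  qed
  also have "\<dots> = real p - x * mat_trace (resolv x ?S)"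
    unfolding G mat_trace_conj_diag[OF U] by (simp add: sum_subtractf sum_distrib_left)
  finally have 1: "real p - x * mat_trace (resolv x ?S) = mat_trace (resolv x ?S * ?S)" ..
  have "mat_trace (resolv x ?S * ?S) = (\<Sum>i<p. \<Sum>k<p. \<Sum>j<N. X j i * resolv x ?S $$ (i,k) * X j k / real N)"
  proof -
    have "(resolv x ?S * ?S) $$ (i,i) = (\<Sum>k<p. \<Sum>j<N. X j i * resolv x ?S $$ (i,k) * X j k / real N)"
      if "i < p" for i
      unfolding mat_mult_entry[OF Gc Sc that that]
    proof (intro sum.cong refl)
      fix k assume "k \<in> {..<p}"
      hence "?S $$ (k,i) = (\<Sum>j<N. X j k * X j i / real N)" using that
        by (simp add: sample_cov_def sum_divide_distrib)
      thus "resolv x ?S $$ (i,k) * ?S $$ (k,i) = (\<Sum>j<N. X j i * resolv x ?S $$ (i,k) * X j k / real N)"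
        by (simp add: sum_distrib_left mult_ac)
    qed
    thus ?thesis unfolding mat_trace_def using Gc by simp
  qed
  also have "\<dots> = (\<Sum>i<p. \<Sum>j<N. \<Sum>k<p. X j i * resolv x ?S $$ (i,k) * X j k / real N)"
    by (intro sum.cong refl sum.swap)
  also have "\<dots> = (\<Sum>j<N. \<Sum>i<p. \<Sum>k<p. X j i * resolv x ?S $$ (i,k) * X j k / real N)"
    by (rule sum.swap)
  also have "\<dots> = (\<Sum>j<N. qform p (resolv x ?S) (X j) / real N)"
    unfolding qform_sum[OF Gc] sum_divide_distrib ..
  finally show ?thesis using 1 by simp
qed

lemma trace_resolv_bounds:
  assumes "psd p A" "x > 0"
  shows "0 \<le> mat_trace (resolv x A)" "mat_trace (resolv x A) \<le> real p / x"
proof -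
  obtain U l where U: "orth_mat p U" and l: "\<And>i. i < p \<Longrightarrow> l i \<ge> 0"
    and G: "resolv x A = conj_diag p U (\<lambda>i. 1 / (l i + x))"
    using psd_resolv[OF assms] by blast
  show "0 \<le> mat_trace (resolv x A)" unfolding G mat_trace_conj_diag[OF U]
    using l assms by (intro sum_nonneg) (auto intro!: divide_nonneg_nonneg add_nonneg_nonneg)
  have "(\<Sum>i<p. 1 / (l i + x)) \<le> (\<Sum>i<p. 1 / x)" using l assms by (intro sum_mono frac_le) auto
  thus "mat_trace (resolv x A) \<le> real p / x" unfolding G mat_trace_conj_diag[OF U] by simp
qed

section \<open>A bounded differences inequality\<close>

text \<open>The constant is not the optimal one of McDiarmid's inequality; only the exponential decay matters.\<close>

lemma bounded_difference_mgf:
  fixes D :: "'b measure" and f :: "('i \<Rightarrow> 'b) \<Rightarrow> real"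
  assumes D: "prob_space D" and "finite I" and l: "l > 0" and c: "c \<ge> 0"
    and "f \<in> borel_measurable (Pi\<^sub>M I (\<lambda>_. D))"
    and "\<And>w. w \<in> space (Pi\<^sub>M I (\<lambda>_. D)) \<Longrightarrow> \<bar>f w\<bar> \<le> B"
    and "\<And>w i y. w \<in> space (Pi\<^sub>M I (\<lambda>_. D)) \<Longrightarrow> i \<in> I \<Longrightarrow> y \<in> space D \<Longrightarrow> \<bar>f (w(i := y)) - f w\<bar> \<le> c"
  shows "(\<integral>\<^sup>+ w. ennreal (exp (l * (f w - integral\<^sup>L (Pi\<^sub>M I (\<lambda>_. D)) f))) \<partial>Pi\<^sub>M I (\<lambda>_. D))
    \<le> ennreal (exp (l\<^sup>2 * real (card I) * c\<^sup>2 / 2))"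
  using assms(2,5-)
proof (induct I arbitrary: f rule: finite_induct)
  case empty
  interpret product_sigma_finite "\<lambda>_. D"
    using D by (simp add: product_sigma_finite_def prob_space_imp_sigma_finite)
  have "integral\<^sup>L (Pi\<^sub>M {} (\<lambda>_. D)) f = f (\<lambda>_. undefined)" by (simp add: PiM_empty lebesgue_integral_count_space_finite)
  moreover have "(\<integral>\<^sup>+ w. ennreal (exp (l * (f w - f (\<lambda>_. undefined)))) \<partial>Pi\<^sub>M {} (\<lambda>_. D)) = 1"
    by (subst nn_integral_empty) auto
  ultimately show ?case by simp
next
  case (insert i I)
  interpret D: prob_space D by fact
  interpret product_sigma_finite "\<lambda>_. D"
    using D by (simp add: product_sigma_finite_def prob_space_imp_sigma_finite)
  let ?P = "Pi\<^sub>M I (\<lambda>_. D)" and ?Q = "Pi\<^sub>M (insert i I) (\<lambda>_. D)"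
  interpret P: prob_space ?P by (intro prob_space_PiM D)
  interpret Q: prob_space ?Q by (intro prob_space_PiM D)
  note [measurable] = insert.prems(1)
  have sp: "w(i := y) \<in> space ?Q" if "w \<in> space ?P" "y \<in> space D" for w y
    using that by (auto simp: space_PiM PiE_def extensional_def Pi_def)
  have fm[measurable]: "(\<lambda>y. f (w(i := y))) \<in> borel_measurable D" if "w \<in> space ?P" for w
  proof -
    have "(\<lambda>y. w(i := y)) \<in> measurable D ?Q"
      using that by (intro measurable_fun_upd[where J = I]) auto
    thus ?thesis by (rule measurable_compose[OF _ insert.prems(1)])
  qed
  have fi: "integrable D (\<lambda>y. f (w(i := y)))" if "w \<in> space ?P" for w
    using that fm[OF that] by (intro D.integrable_const_bound[where B = B]) (auto intro!: AE_I2 insert.prems(2) sp)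
  \<comment> \<open>Integrating out the coordinate \<open>i\<close> preserves measurability, the
    bound and the bounded differences in the remaining coordinates, so the induction hypothesis
    applies to \<open>g\<close>.\<close>
  define g where "g w = (\<integral>y. f (w(i := y)) \<partial>D)" for w
  have mupd: "(\<lambda>(w, y). w(i := y)) \<in> measurable (?P \<Otimes>\<^sub>M D) ?Q"
    by (rule measurable_add_dim)
  have "(\<lambda>(w,y). f (w(i := y))) \<in> borel_measurable (?P \<Otimes>\<^sub>M D)"
    using measurable_compose[OF mupd insert.prems(1)] by (simp add: case_prod_beta')
  hence gm[measurable]: "g \<in> borel_measurable ?P" unfolding g_def
    by (rule D.borel_measurable_lebesgue_integral)
  have gB: "\<bar>g w\<bar> \<le> B" if "w \<in> space ?P" for w
  proof -
    have "\<bar>g w\<bar> \<le> (\<integral>y. \<bar>f (w(i := y))\<bar> \<partial>D)" unfolding g_def by (rule integral_abs_bound)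
    also have "\<dots> \<le> (\<integral>y. B \<partial>D)" using that fi[OF that] by (intro integral_mono) (auto intro!: insert.prems(2) sp)
    finally show ?thesis using D.prob_space by simp
  qed
  have gd: "\<bar>g (w(j := z)) - g w\<bar> \<le> c" if w: "w \<in> space ?P" and j: "j \<in> I" and z: "z \<in> space D" for w j z
  proof -
    have w': "w(j := z) \<in> space ?P" using w j z by (auto simp: space_PiM PiE_def extensional_def Pi_def)
    have ij: "i \<noteq> j" using j insert.hyps by auto
    have "\<bar>g (w(j := z)) - g w\<bar> = \<bar>\<integral>y. f ((w(j := z))(i := y)) - f (w(i := y)) \<partial>D\<bar>"
      unfolding g_def using fi[OF w] fi[OF w'] by (subst Bochner_Integration.integral_diff) auto
    also have "\<dots> \<le> (\<integral>y. \<bar>f ((w(j := z))(i := y)) - f (w(i := y))\<bar> \<partial>D)" by (rule integral_abs_bound)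
    also have "\<dots> \<le> (\<integral>y. c \<partial>D)"
    proof (rule integral_mono)
      fix y assume y: "y \<in> space D"
      have "(w(j := z))(i := y) = (w(i := y))(j := z)" using ij by (simp add: fun_upd_twist)
      thus "\<bar>f ((w(j := z))(i := y)) - f (w(i := y))\<bar> \<le> c"
        using insert.prems(3)[OF sp[OF w y], of j z] j z by (metis insertI2)
    qed (use fi[OF w] fi[OF w'] in auto)
    finally show ?thesis using D.prob_space by simp
  qed
  have fint: "integrable ?Q f"
    by (intro Q.integrable_const_bound[where B = B]) (auto intro!: AE_I2 insert.prems(2))
  have Ef: "integral\<^sup>L ?Q f = integral\<^sup>L ?P g"
    unfolding g_def by (rule product_integral_insert[OF insert.hyps(1,2) fint])
  let ?E = "integral\<^sup>L ?P g"
  have inner: "(\<integral>\<^sup>+ y. ennreal (exp (l * (f (w(i := y)) - g w))) \<partial>D) \<le> ennreal (exp (l\<^sup>2 * c\<^sup>2 / 2))"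
    if w: "w \<in> space ?P" for w
  proof -
    \<comment> \<open>Bounded differences keep all values within \<open>c\<close> of the value at
      one fixed \<open>y0\<close>. This interval has length \<open>2 * c\<close>, so Hoeffding's
      lemma contributes \<open>(2 * c)^2 / 8 = c^2 / 2\<close> to the exponent.\<close>
    obtain y0 where y0: "y0 \<in> space D" using D.not_empty by auto
    let ?v = "f (w(i := y0))"
    have "\<bar>f (w(i := y)) - ?v\<bar> \<le> c" if "y \<in> space D" for y
      using insert.prems(3)[OF sp[OF w y0], of i y] that by (metis fun_upd_upd insertI1)
    hence "f (w(i := y)) \<in> {?v - c .. ?v + c}" if "y \<in> space D" for y using that by fastforce
    then interpret interval_bounded_random_variable D "\<lambda>y. f (w(i := y))" "?v - c" "?v + c"
      using fm[OF w] by unfold_locales auto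
    have "(\<integral>\<^sup>+ y. ennreal (exp (l * (f (w(i := y)) - g w))) \<partial>D) \<le> ennreal (exp (l\<^sup>2 * ((?v + c) - (?v - c))\<^sup>2 / 8))"
      using Hoeffdings_lemma_nn_integral[OF l] unfolding g_def .
    also have "l\<^sup>2 * ((?v + c) - (?v - c))\<^sup>2 / 8 = l\<^sup>2 * c\<^sup>2 / 2" by (simp add: power2_eq_square)
    finally show ?thesis .
  qed
  have "(\<integral>\<^sup>+ w. ennreal (exp (l * (f w - integral\<^sup>L ?Q f))) \<partial>?Q) =
    (\<integral>\<^sup>+ w. (\<integral>\<^sup>+ y. ennreal (exp (l * (f (w(i := y)) - ?E))) \<partial>D) \<partial>?P)"
    unfolding Ef by (rule product_nn_integral_insert[OF insert.hyps(1,2)]) measurable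
  also have "\<dots> \<le> (\<integral>\<^sup>+ w. ennreal (exp (l\<^sup>2 * c\<^sup>2 / 2)) * ennreal (exp (l * (g w - ?E))) \<partial>?P)"
  proof (rule nn_integral_mono)
    fix w assume w: "w \<in> space ?P"
    note [measurable] = fm[OF w]
    have "(\<integral>\<^sup>+ y. ennreal (exp (l * (f (w(i := y)) - ?E))) \<partial>D) =
      (\<integral>\<^sup>+ y. ennreal (exp (l * (f (w(i := y)) - g w))) * ennreal (exp (l * (g w - ?E))) \<partial>D)"
      by (intro nn_integral_cong) (simp add: ennreal_mult[symmetric] exp_add[symmetric] algebra_simps)
    also have "\<dots> = (\<integral>\<^sup>+ y. ennreal (exp (l * (f (w(i := y)) - g w))) \<partial>D) * ennreal (exp (l * (g w - ?E)))"
      by (rule nn_integral_multc) measurable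
    also have "\<dots> \<le> ennreal (exp (l\<^sup>2 * c\<^sup>2 / 2)) * ennreal (exp (l * (g w - ?E)))"
      by (intro mult_right_mono inner w) auto
    finally show "(\<integral>\<^sup>+ y. ennreal (exp (l * (f (w(i := y)) - ?E))) \<partial>D) \<le>
      ennreal (exp (l\<^sup>2 * c\<^sup>2 / 2)) * ennreal (exp (l * (g w - ?E)))" .
  qed
  also have "\<dots> = ennreal (exp (l\<^sup>2 * c\<^sup>2 / 2)) * (\<integral>\<^sup>+ w. ennreal (exp (l * (g w - ?E))) \<partial>?P)"
    by (rule nn_integral_cmult) measurable
  also have "\<dots> \<le> ennreal (exp (l\<^sup>2 * c\<^sup>2 / 2)) * ennreal (exp (l\<^sup>2 * real (card I) * c\<^sup>2 / 2))"
    by (intro mult_left_mono insert.hyps(3) gm gB gd) auto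
  also have "\<dots> = ennreal (exp (l\<^sup>2 * real (card (insert i I)) * c\<^sup>2 / 2))"
    using insert.hyps by (simp add: ennreal_mult[symmetric] exp_add[symmetric] algebra_simps add_divide_distrib)
  finally show ?case .
qed

text \<open>Chernoff's bound with the preceding exponential moment, applied to \<open>f\<close> and
  to \<open>- f\<close>.\<close>

lemma bounded_difference_tail:
  fixes D :: "'b measure" and f :: "('i \<Rightarrow> 'b) \<Rightarrow> real"
  assumes D: "prob_space D" and I: "finite I" "I \<noteq> {}" and c: "c > 0" and e: "e > 0"
    and f: "f \<in> borel_measurable (Pi\<^sub>M I (\<lambda>_. D))"
    and B: "\<And>w. w \<in> space (Pi\<^sub>M I (\<lambda>_. D)) \<Longrightarrow> \<bar>f w\<bar> \<le> B"
    and d: "\<And>w i y. w \<in> space (Pi\<^sub>M I (\<lambda>_. D)) \<Longrightarrow> i \<in> I \<Longrightarrow> y \<in> space D \<Longrightarrow> \<bar>f (w(i := y)) - f w\<bar> \<le> c"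
  shows "measure (Pi\<^sub>M I (\<lambda>_. D)) {w \<in> space (Pi\<^sub>M I (\<lambda>_. D)). \<bar>f w - integral\<^sup>L (Pi\<^sub>M I (\<lambda>_. D)) f\<bar> \<ge> e}
    \<le> 2 * exp (- (e\<^sup>2 / (2 * real (card I) * c\<^sup>2)))"
proof -
  let ?P = "Pi\<^sub>M I (\<lambda>_. D)"
  interpret P: prob_space ?P by (intro prob_space_PiM D)
  define k where "k = real (card I)"
  have k: "k > 0" using I by (simp add: k_def card_gt_0_iff)
  have one: "measure ?P {w \<in> space ?P. h w - integral\<^sup>L ?P h \<ge> e} \<le> exp (- (e\<^sup>2 / (2 * k * c\<^sup>2)))"
    if h[measurable]: "h \<in> borel_measurable ?P"
      and hB: "\<And>w. w \<in> space ?P \<Longrightarrow> \<bar>h w\<bar> \<le> B"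
      and hd: "\<And>w i y. w \<in> space ?P \<Longrightarrow> i \<in> I \<Longrightarrow> y \<in> space D \<Longrightarrow> \<bar>h (w(i := y)) - h w\<bar> \<le> c" for h
  proof -
    \<comment> \<open>The minimizer of the exponent
      \<open>- l * e + l^2 * k * c^2 / 2\<close>.\<close>
    define l where "l = e / (k * c\<^sup>2)"
    have l: "l > 0" using e k c by (simp add: l_def)
    have "emeasure ?P {w \<in> space ?P. h w - integral\<^sup>L ?P h \<ge> e} \<le>
        ennreal (exp (- l * e)) * (\<integral>\<^sup>+ w. ennreal (exp (l * (h w - integral\<^sup>L ?P h))) \<partial>?P)"
    proof -
      have "(\<integral>\<^sup>+ w. ennreal (exp (l * (h w - integral\<^sup>L ?P h))) * indicator (space ?P) w \<partial>?P) =
          (\<integral>\<^sup>+ w. ennreal (exp (l * (h w - integral\<^sup>L ?P h))) \<partial>?P)"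
        by (rule nn_integral_cong) simp
      thus ?thesis
        using Chernoff_ineq_nn_integral_ge[OF l, of "space ?P" ?P "\<lambda>w. h w - integral\<^sup>L ?P h" e] by simp
    qed
    also have "\<dots> \<le> ennreal (exp (- l * e)) * ennreal (exp (l\<^sup>2 * k * c\<^sup>2 / 2))"
      unfolding k_def by (intro mult_left_mono bounded_difference_mgf[OF D I(1) l _ h hB hd]) (use c in auto)
    also have "\<dots> = ennreal (exp (- l * e + l\<^sup>2 * k * c\<^sup>2 / 2))"
      by (simp add: ennreal_mult[symmetric] exp_add[symmetric])
    also have "- l * e + l\<^sup>2 * k * c\<^sup>2 / 2 = - (e\<^sup>2 / (2 * k * c\<^sup>2))"
      unfolding l_def using k c by (simp add: field_simps power2_eq_square)
    finally show ?thesis by (simp add: P.emeasure_eq_measure)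
  qed
  note [measurable] = f
  have "{w \<in> space ?P. \<bar>f w - integral\<^sup>L ?P f\<bar> \<ge> e} \<subseteq>
    {w \<in> space ?P. f w - integral\<^sup>L ?P f \<ge> e} \<union> {w \<in> space ?P. - f w - integral\<^sup>L ?P (\<lambda>w. - f w) \<ge> e}"
    by auto
  hence "measure ?P {w \<in> space ?P. \<bar>f w - integral\<^sup>L ?P f\<bar> \<ge> e} \<le>
    measure ?P ({w \<in> space ?P. f w - integral\<^sup>L ?P f \<ge> e} \<union> {w \<in> space ?P. - f w - integral\<^sup>L ?P (\<lambda>w. - f w) \<ge> e})"
    by (rule P.finite_measure_mono) measurable
  also have "\<dots> \<le> measure ?P {w \<in> space ?P. f w - integral\<^sup>L ?P f \<ge> e} +
      measure ?P {w \<in> space ?P. - f w - integral\<^sup>L ?P (\<lambda>w. - f w) \<ge> e}"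
    by (rule measure_Un_le) measurable
  also have "\<dots> \<le> exp (- (e\<^sup>2 / (2 * k * c\<^sup>2))) + exp (- (e\<^sup>2 / (2 * k * c\<^sup>2)))"
    by (intro add_mono one) (use B d in \<open>auto simp: abs_minus_commute\<close>)
  finally show ?thesis by (simp add: k_def)
qed

section \<open>Transforms of measures on the half-line\<close>

text \<open>Steep ramps converge to the step function, and Stone-Weierstrass replaces each ramp by a
  polynomial. The uniform bound 2 is the majorant for dominated convergence. The lemma serves both
  the uniqueness of the transform and the measurability of the spectral distribution.\<close>

lemma step_function_limit_of_polynomials:
  fixes y0 :: real
  shows "\<exists>(a :: nat \<Rightarrow> nat \<Rightarrow> real) d. \<forall>y\<in>{0..1}.
    (\<lambda>m. \<Sum>i\<le>d m. a m i * y ^ i) \<longlonglongrightarrow> (if y0 \<le> y then 1 else 0) \<and> (\<forall>m. \<bar>\<Sum>i\<le>d m. a m i * y ^ i\<bar> \<le> 2)"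
proof -
  \<comment> \<open>The ramp reaches 1 at \<open>y0\<close> itself, so the limit at
    \<open>y0\<close> is 1; this matches distribution functions, which include the end
    point.\<close>
  define \<phi> where "\<phi> m y = max 0 (min 1 (1 + real m * (y - y0)))" for m :: nat and y :: real
  have "\<exists>g. real_polynomial_function g \<and> (\<forall>y\<in>{0..1}. \<bar>\<phi> m y - g y\<bar> < 1 / real (Suc m))" for m
  proof -
    have "continuous_on {0..1} (\<phi> m)" unfolding \<phi>_def by (intro continuous_intros)
    from Stone_Weierstrass_real_polynomial_function[OF compact_Icc this, of "1 / real (Suc m)"]
    obtain g where "real_polynomial_function g" "\<And>x. x \<in> {0..1} \<Longrightarrow> \<bar>\<phi> m x - g x\<bar> < 1 / real (Suc m)"
      by auto
    thus ?thesis by blast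
  qed
  then obtain g where g: "\<And>m. real_polynomial_function (g m)"
    "\<And>m y. y \<in> {0..1} \<Longrightarrow> \<bar>\<phi> m y - g m y\<bar> < 1 / real (Suc m)" by metis
  from g(1) have "\<exists>a n. g m = (\<lambda>x. \<Sum>i\<le>n. a i * x ^ i)" for m
    using real_polynomial_function_iff_sum by blast
  then obtain a d where ad: "\<And>m. g m = (\<lambda>x. \<Sum>i\<le>d m. a m i * x ^ i)" by metis
  have "(\<lambda>m. g m y) \<longlonglongrightarrow> (if y0 \<le> y then 1 else 0) \<and> (\<forall>m. \<bar>g m y\<bar> \<le> 2)" if y: "y \<in> {0..1}" for y
  proof
    have "(\<lambda>m. \<phi> m y) \<longlonglongrightarrow> (if y0 \<le> y then 1 else 0)"
    proof (cases "y0 \<le> y")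
      case True
      hence "\<phi> m y = 1" for m unfolding \<phi>_def by (auto simp: min_def max_def)
      thus ?thesis using True by simp
    next
      case False
      obtain k :: nat where k: "1 < real k * (y0 - y)" using False reals_Archimedean3[of "y0 - y"] by auto
      have "\<phi> m y = 0" if "m \<ge> k" for m
      proof -
        have "real k * (y0 - y) \<le> real m * (y0 - y)" using that False by (intro mult_right_mono) auto
        hence "1 + real m * (y - y0) \<le> 0" using k by (simp add: algebra_simps)
        thus ?thesis unfolding \<phi>_def by simp
      qed
      hence "eventually (\<lambda>m. \<phi> m y = 0) sequentially" using eventually_sequentially by blast
      thus ?thesis using False by (simp add: tendsto_eventually)
    qed
    moreover have "(\<lambda>m. g m y - \<phi> m y) \<longlonglongrightarrow> 0"
    proof (rule tendsto_rabs_zero_cancel, rule tendsto_sandwich[of "\<lambda>_. 0" _ _ "\<lambda>m. 1 / real (Suc m)"])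
      show "(\<lambda>m. 1 / real (Suc m)) \<longlonglongrightarrow> 0" using LIMSEQ_inverse_real_of_nat by (simp add: inverse_eq_divide)
      show "\<forall>\<^sub>F m in sequentially. \<bar>g m y - \<phi> m y\<bar> \<le> 1 / real (Suc m)"
        using g(2)[OF y] by (auto intro!: always_eventually less_imp_le simp: abs_minus_commute)
    qed auto
    ultimately show "(\<lambda>m. g m y) \<longlonglongrightarrow> (if y0 \<le> y then 1 else 0)"
      using tendsto_add[of "\<lambda>m. \<phi> m y" _ _ "\<lambda>m. g m y - \<phi> m y" 0] by simp
    show "\<forall>m. \<bar>g m y\<bar> \<le> 2"
    proof
      fix m
      have "\<bar>\<phi> m y\<bar> \<le> 1" "1 / real (Suc m) \<le> 1" unfolding \<phi>_def by auto
      thus "\<bar>g m y\<bar> \<le> 2" using g(2)[OF y, of m] by linarith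
    qed
  qed
  thus ?thesis unfolding ad by blast
qed

text \<open>The \<open>max\<close> keeps the kernel bounded on the whole line; measures on the half-line do not see it.\<close>

definition rker :: "real \<Rightarrow> real \<Rightarrow> real" where "rker x t = 1 / (max t 0 + x)"

definition rst :: "real measure \<Rightarrow> real \<Rightarrow> real" where "rst \<mu> x = (LINT t|\<mu>. rker x t)"

lemma rker_bounds: "x > 0 \<Longrightarrow> 0 < rker x t" "x > 0 \<Longrightarrow> rker x t \<le> 1 / x"
  by (auto simp: rker_def intro!: divide_pos_pos add_nonneg_pos frac_le)

lemma rker_measurable [measurable]: "rker x \<in> borel_measurable borel"
  unfolding rker_def by measurable

lemma prob_on_nonneg_AE:
  assumes "prob_on_nonneg \<mu>" shows "AE t in \<mu>. t \<ge> 0"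
proof -
  interpret real_distribution \<mu> using assms unfolding prob_on_nonneg_def by auto
  have "prob {0..} = 1" using assms unfolding prob_on_nonneg_def by auto
  hence "AE t in \<mu>. t \<in> {0..}" using prob_eq_1[of "{0..}"] by simp
  thus ?thesis by auto
qed

lemma prob_on_nonneg_rd: "prob_on_nonneg \<mu> \<Longrightarrow> real_distribution \<mu>"
  unfolding prob_on_nonneg_def by auto

lemma prob_on_nonnegI:
  assumes "real_distribution \<mu>" "AE t in \<mu>. t \<ge> 0" shows "prob_on_nonneg \<mu>"
proof -
  interpret real_distribution \<mu> by fact
  have "prob {0..} = 1" using assms(2) prob_eq_1[of "{0..}"] by simp
  thus ?thesis using assms unfolding prob_on_nonneg_def by auto
qed

lemma (in real_distribution) integrable_bounded:
  fixes f :: "real \<Rightarrow> real"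
  assumes "f \<in> borel_measurable borel" "\<And>t. \<bar>f t\<bar> \<le> B"
  shows "integrable M f"
  using assms by (intro integrable_const_bound[where B = B]) auto

lemma (in real_distribution) rker_integrable: "x > 0 \<Longrightarrow> integrable M (rker x)"
  using rker_bounds[of x] by (intro integrable_bounded[where B = "1/x"]) (auto simp: abs_of_pos)

lemma rker_diff:
  assumes "x > 0" "y > 0" shows "\<bar>rker x t - rker y t\<bar> \<le> \<bar>x - y\<bar> / (x * y)"
proof -
  have p: "max t 0 + x > 0" "max t 0 + y > 0" using assms by auto
  have "rker x t - rker y t = (y - x) * (rker x t * rker y t)"
    using p unfolding rker_def by (simp add: field_simps)
  hence "\<bar>rker x t - rker y t\<bar> = \<bar>x - y\<bar> * (rker x t * rker y t)"
    using rker_bounds(1)[OF assms(1), of t] rker_bounds(1)[OF assms(2), of t] by (simp add: abs_mult abs_minus_commute)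
  also have "\<dots> \<le> \<bar>x - y\<bar> * ((1 / x) * (1 / y))"
    using rker_bounds[OF assms(1), of t] rker_bounds[OF assms(2), of t] assms
    by (intro mult_left_mono mult_mono) auto
  finally show ?thesis by simp
qed

section \<open>The transform on the negative axis determines the measure\<close>

lemma rst_continuous:
  assumes "real_distribution \<mu>" "x > 0" shows "isCont (rst \<mu>) x"
proof -
  interpret real_distribution \<mu> by fact
  have "((\<lambda>y. rst \<mu> y - rst \<mu> x) \<longlongrightarrow> 0) (at x)"
  proof (rule tendsto_rabs_zero_cancel, rule tendsto_sandwich[of "\<lambda>_. 0" _ _ "\<lambda>y. \<bar>y - x\<bar> / (y * x)"])
    show "((\<lambda>y. \<bar>y - x\<bar> / (y * x)) \<longlongrightarrow> 0) (at x)" using assms(2)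
      by (auto intro!: tendsto_eq_intros)
    show "\<forall>\<^sub>F y in at x. \<bar>rst \<mu> y - rst \<mu> x\<bar> \<le> \<bar>y - x\<bar> / (y * x)"
    proof -
      have "\<forall>\<^sub>F y in at x. y > 0" using assms(2) by (intro order_tendstoD(1)[OF tendsto_ident_at])
      thus ?thesis
      proof eventually_elim
        case (elim y)
        have "\<bar>rst \<mu> y - rst \<mu> x\<bar> = \<bar>LINT t|\<mu>. (rker y t - rker x t)\<bar>"
          unfolding rst_def using rker_integrable elim assms(2) by simp
        also have "\<dots> \<le> (LINT t|\<mu>. \<bar>rker y t - rker x t\<bar>)" by (rule integral_abs_bound)
        also have "\<dots> \<le> (LINT t|\<mu>. \<bar>y - x\<bar> / (y * x))"
          using rker_integrable elim assms(2) rker_diff by (intro integral_mono) auto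
        finally show ?case using prob_space by simp
      qed
    qed
  qed auto
  thus ?thesis unfolding isCont_def by (simp add: LIM_zero_cancel)
qed

text \<open>By continuity a countable set of points carries all the information, so that later
  arguments can exhaust it by finite sets.\<close>

lemma rst_eq_of_rational:
  assumes "real_distribution \<mu>" "real_distribution \<nu>"
    and eq: "\<And>x. x \<in> \<rat> \<Longrightarrow> x > 0 \<Longrightarrow> rst \<mu> x = rst \<nu> x" and x: "x > 0"
  shows "rst \<mu> x = rst \<nu> x"
proof -
  have "\<exists>q\<in>\<rat>. x < q \<and> q < x + 1 / real (Suc n)" for n using Rats_dense_in_real[of x "x + 1 / real (Suc n)"] by auto
  then obtain q where q: "\<And>n. q n \<in> \<rat>" "\<And>n. x < q n" "\<And>n. q n < x + 1 / real (Suc n)" by metis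
  have lim: "q \<longlonglongrightarrow> x"
  proof (rule tendsto_sandwich[of "\<lambda>_. x" _ _ "\<lambda>n. x + 1 / real (Suc n)"])
    show "(\<lambda>n. x + 1 / real (Suc n)) \<longlonglongrightarrow> x"
      using tendsto_add[OF tendsto_const[of x] LIMSEQ_inverse_real_of_nat] by (simp add: inverse_eq_divide)
  qed (use q in \<open>auto intro!: always_eventually less_imp_le\<close>)
  have "(\<lambda>n. rst \<mu> (q n)) \<longlonglongrightarrow> rst \<mu> x" "(\<lambda>n. rst \<nu> (q n)) \<longlonglongrightarrow> rst \<nu> x"
    using isCont_tendsto_compose[OF rst_continuous[OF assms(1) x] lim]
      isCont_tendsto_compose[OF rst_continuous[OF assms(2) x] lim] by auto
  moreover have "rst \<mu> (q n) = rst \<nu> (q n)" for n using eq q(1,2) x by (meson less_trans)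
  ultimately show ?thesis using LIMSEQ_unique by auto
qed

text \<open>The derivative of \<open>rker x t ^ k\<close> in \<open>x\<close> is
  \<open>- k * rker x t ^ (k + 1)\<close>, so difference quotients of one power integral converge to
  a multiple of the next. Restricting to \<open>x >= 1\<close> keeps the kernels below 1 and
  provides a constant majorant.\<close>

lemma (in real_distribution) rker_pow_limit:
  assumes x: "x \<ge> 1"
  shows "(\<lambda>n. real (Suc n) * ((LINT t|M. rker x t ^ Suc k) - (LINT t|M. rker (x + 1 / real (Suc n)) t ^ Suc k)))
     \<longlonglongrightarrow> real (Suc k) * (LINT t|M. rker x t ^ Suc (Suc k))"
proof -
  have b: "0 \<le> rker y t \<and> rker y t \<le> 1" if "y \<ge> 1" for y t
  proof -
    have "1 / y \<le> 1" using that by simp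
    thus ?thesis using rker_bounds[of y t] that by linarith
  qed
  have int: "integrable M (\<lambda>t. rker y t ^ j)" if "y \<ge> 1" for y j
    using b[OF that] by (intro integrable_bounded[where B = 1]) (auto simp: power_le_one abs_of_nonneg)
  have xn: "x + 1 / real (Suc n) \<ge> 1" for n using x by (simp add: add_increasing2)
  let ?d = "\<lambda>n t. real (Suc n) * (rker x t ^ Suc k - rker (x + 1 / real (Suc n)) t ^ Suc k)"
  have "(\<lambda>n. LINT t|M. ?d n t) \<longlonglongrightarrow> (LINT t|M. real (Suc k) * rker x t ^ Suc (Suc k))"
  proof (rule integral_dominated_convergence[where w = "\<lambda>_. real (Suc k)"])
    show "AE t in M. (\<lambda>n. ?d n t) \<longlonglongrightarrow> real (Suc k) * rker x t ^ Suc (Suc k)"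
    proof (rule AE_I2)
      fix t :: real
      define s where "s = max t 0"
      have sx: "s + x > 0" using x by (auto simp: s_def)
      have "((\<lambda>y. 1 / (s + y)) has_real_derivative - ((1 / (s + x)) * (1 / (s + x)))) (at x)"
        using sx by (auto intro!: derivative_eq_intros)
      from DERIV_power[OF this, of "Suc k"]
      have "((\<lambda>y. (1 / (s + y)) ^ Suc k) has_real_derivative - (real (Suc k) * (1 / (s + x)) ^ Suc (Suc k))) (at x)"
        by (simp add: mult_ac)
      hence "((\<lambda>h. ((1 / (s + (x + h))) ^ Suc k - (1 / (s + x)) ^ Suc k) / h) \<longlongrightarrow> - (real (Suc k) * (1 / (s + x)) ^ Suc (Suc k))) (at 0)"
        unfolding DERIV_def .
      moreover have "filterlim (\<lambda>n. 1 / real (Suc n)) (at 0) sequentially"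
        using LIMSEQ_inverse_real_of_nat by (auto simp: filterlim_at inverse_eq_divide)
      ultimately have "(\<lambda>n. ((1 / (s + (x + 1 / real (Suc n)))) ^ Suc k - (1 / (s + x)) ^ Suc k) / (1 / real (Suc n))) \<longlonglongrightarrow>
        - (real (Suc k) * (1 / (s + x)) ^ Suc (Suc k))"
        by (rule filterlim_compose)
      from tendsto_minus[OF this] show "(\<lambda>n. ?d n t) \<longlonglongrightarrow> real (Suc k) * rker x t ^ Suc (Suc k)"
        unfolding rker_def s_def[symmetric] by (simp add: algebra_simps del: power_Suc)
    qed
    show "AE t in M. norm (?d n t) \<le> real (Suc k)" for n
    proof (rule AE_I2)
      fix t :: real
      let ?y = "x + 1 / real (Suc n)"
      have "norm (rker x t ^ Suc k - rker ?y t ^ Suc k) \<le> real (Suc k) * norm (rker x t - rker ?y t)"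
        using b[OF x, of t] b[OF xn[of n], of t] by (intro norm_power_diff) auto
      also have "norm (rker x t - rker ?y t) \<le> \<bar>x - ?y\<bar> / (x * ?y)"
        using rker_diff[of x ?y t] x xn[of n] by simp
      also have "\<dots> \<le> (1 / real (Suc n)) / 1"
        using x xn[of n] mult_mono[of 1 x 1 ?y] by (intro frac_le) auto
      finally have "norm (rker x t ^ Suc k - rker ?y t ^ Suc k) \<le> real (Suc k) * (1 / real (Suc n))"
        by (simp add: mult_left_mono)
      hence "real (Suc n) * norm (rker x t ^ Suc k - rker ?y t ^ Suc k) \<le> real (Suc n) * (real (Suc k) * (1 / real (Suc n)))"
        by (rule mult_left_mono) auto
      thus "norm (?d n t) \<le> real (Suc k)" by (simp add: abs_mult del: power_Suc)
    qed
  qed auto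
  moreover have "(LINT t|M. ?d n t) = real (Suc n) * ((LINT t|M. rker x t ^ Suc k) - (LINT t|M. rker (x + 1 / real (Suc n)) t ^ Suc k))" for n
    by (simp only: integral_mult_right_zero Bochner_Integration.integral_diff[OF int[OF x] int[OF xn[of n]]])
  ultimately show ?thesis by (simp del: power_Suc)
qed

text \<open>Induction on the exponent, for all \<open>x >= 1\<close> at once: the difference
  quotients use points to the right of \<open>x\<close>, which stay in that range.\<close>

lemma rker_pow_eq:
  assumes "real_distribution \<mu>" "real_distribution \<nu>"
    and eq: "\<And>x. x > 0 \<Longrightarrow> rst \<mu> x = rst \<nu> x" and x: "x \<ge> 1"
  shows "(LINT t|\<mu>. rker x t ^ k) = (LINT t|\<nu>. rker x t ^ k)"
proof -
  interpret \<mu>: real_distribution \<mu> by fact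
  interpret \<nu>: real_distribution \<nu> by fact
  have "\<forall>x\<ge>1. (LINT t|\<mu>. rker x t ^ Suc k) = (LINT t|\<nu>. rker x t ^ Suc k)" for k
  proof (induct k)
    case 0
    then show ?case using eq unfolding rst_def by auto
  next
    case (Suc k)
    show ?case
    proof (intro allI impI)
      fix x :: real assume x: "x \<ge> 1"
      have xn: "x + 1 / real (Suc n) \<ge> 1" for n using x by (simp add: add_increasing2)
      have "(LINT t|\<mu>. rker x t ^ Suc k) - (LINT t|\<mu>. rker (x + 1 / real (Suc n)) t ^ Suc k) =
        (LINT t|\<nu>. rker x t ^ Suc k) - (LINT t|\<nu>. rker (x + 1 / real (Suc n)) t ^ Suc k)" for n
        unfolding Suc[rule_format, OF x] Suc[rule_format, OF xn[of n]] ..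
      from LIMSEQ_unique[OF \<mu>.rker_pow_limit[OF x, of k, unfolded this] \<nu>.rker_pow_limit[OF x, of k]]
      have "real (Suc k) * (LINT t|\<mu>. rker x t ^ Suc (Suc k)) = real (Suc k) * (LINT t|\<nu>. rker x t ^ Suc (Suc k))" .
      thus "(LINT t|\<mu>. rker x t ^ Suc (Suc k)) = (LINT t|\<nu>. rker x t ^ Suc (Suc k))" by (simp del: power_Suc)
    qed
  qed
  thus ?thesis using x \<mu>.prob_space \<nu>.prob_space by (cases k) auto
qed

text \<open>The kernel \<open>rker 1\<close> decreases on the half-line, so a lower half-line
  becomes an upper level set with threshold \<open>1 / (1 + x)\<close>.\<close>

lemma rker_le_iff:
  assumes "x \<ge> 0" shows "1 / (1 + x) \<le> rker 1 t \<longleftrightarrow> t \<le> x"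
proof -
  have "1 / (1 + x) \<le> rker 1 t \<longleftrightarrow> max t 0 + 1 \<le> 1 + x"
    unfolding rker_def inverse_eq_divide[symmetric] using assms by (intro inverse_le_iff_le) auto
  thus ?thesis using assms by auto
qed

lemma integral_polynomial:
  fixes f :: "'a \<Rightarrow> real"
  assumes "\<And>i. integrable M (\<lambda>t. f t ^ i)"
  shows "(LINT t|M. (\<Sum>i\<le>n. a i * f t ^ i)) = (\<Sum>i\<le>n. a i * (LINT t|M. f t ^ i))"
  using assms by (subst Bochner_Integration.integral_sum) auto

text \<open>Difference quotients of the transform give all moments of the bounded variable \<open>rker 1\<close>, and
  polynomials in this variable approximate the indicators of half-lines.\<close>

lemma rst_unique:
  assumes \<mu>: "prob_on_nonneg \<mu>" and \<nu>: "prob_on_nonneg \<nu>"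
    and eq: "\<And>x. x \<in> \<rat> \<Longrightarrow> x > 0 \<Longrightarrow> rst \<mu> x = rst \<nu> x"
  shows "\<mu> = \<nu>"
proof -
  note rd = prob_on_nonneg_rd[OF \<mu>] prob_on_nonneg_rd[OF \<nu>]
  have pw: "(LINT t|\<mu>. rker 1 t ^ k) = (LINT t|\<nu>. rker 1 t ^ k)" for k
    by (rule rker_pow_eq[OF rd]) (auto intro: rst_eq_of_rational[OF rd eq])
  have lim: "(\<lambda>m. \<Sum>i\<le>d m. a m i * (LINT t|\<rho>. rker 1 t ^ i)) \<longlonglongrightarrow> cdf \<rho> x"
    if \<rho>: "prob_on_nonneg \<rho>" and x: "x \<ge> 0" and
      ad: "\<And>y. y \<in> {0..1} \<Longrightarrow> (\<lambda>m. \<Sum>i\<le>d m. a m i * y ^ i) \<longlonglongrightarrow> (if 1 / (1 + x) \<le> y then 1 else 0)"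
        "\<And>y m. y \<in> {0..1} \<Longrightarrow> \<bar>\<Sum>i\<le>d m. a m i * y ^ i\<bar> \<le> 2"
    for \<rho> x and a :: "nat \<Rightarrow> nat \<Rightarrow> real" and d
  proof -
    interpret real_distribution \<rho> using \<rho> by (rule prob_on_nonneg_rd)
    have b: "rker 1 t \<in> {0..1}" for t using rker_bounds[of 1 t] by auto
    have int: "integrable \<rho> (\<lambda>t. rker 1 t ^ j)" for j
      using b by (intro integrable_bounded[where B = 1]) (auto simp: power_le_one abs_of_nonneg)
    have "(\<lambda>m. LINT t|\<rho>. (\<Sum>i\<le>d m. a m i * rker 1 t ^ i)) \<longlonglongrightarrow> (LINT t|\<rho>. indicator {..x} t)"
    proof (rule integral_dominated_convergence[where w = "\<lambda>_. 2"])
      show "AE t in \<rho>. (\<lambda>m. \<Sum>i\<le>d m. a m i * rker 1 t ^ i) \<longlonglongrightarrow> indicator {..x} t"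
      proof (rule AE_I2)
        fix t :: real
        show "(\<lambda>m. \<Sum>i\<le>d m. a m i * rker 1 t ^ i) \<longlonglongrightarrow> indicator {..x} t"
          using ad(1)[OF b[of t]] unfolding rker_le_iff[OF x] by (cases "t \<le> x") auto
      qed
      show "AE t in \<rho>. norm (\<Sum>i\<le>d m. a m i * rker 1 t ^ i) \<le> 2" for m
        using ad(2)[OF b] by simp
    qed auto
    moreover have "(LINT t|\<rho>. (\<Sum>i\<le>d m. a m i * rker 1 t ^ i)) = (\<Sum>i\<le>d m. a m i * (LINT t|\<rho>. rker 1 t ^ i))" for m
      by (rule integral_polynomial[OF int])
    moreover have "(LINT t|\<rho>. indicator {..x} t) = cdf \<rho> x" by (simp add: cdf_def)
    ultimately show ?thesis by (simp only:)
  qed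
  have "cdf \<mu> x = cdf \<nu> x" for x
  proof (cases "x \<ge> 0")
    case True
    obtain a :: "nat \<Rightarrow> nat \<Rightarrow> real" and d where
      ad: "\<And>y. y \<in> {0..1} \<Longrightarrow> (\<lambda>m. \<Sum>i\<le>d m. a m i * y ^ i) \<longlonglongrightarrow> (if 1 / (1 + x) \<le> y then 1 else 0)"
        "\<And>y m. y \<in> {0..1} \<Longrightarrow> \<bar>\<Sum>i\<le>d m. a m i * y ^ i\<bar> \<le> 2"
      using step_function_limit_of_polynomials[of "1 / (1 + x)"] by blast
    have "(\<lambda>m. \<Sum>i\<le>d m. a m i * (LINT t|\<nu>. rker 1 t ^ i)) \<longlonglongrightarrow> cdf \<mu> x"
      using lim[OF \<mu> True ad] unfolding pw .
    from LIMSEQ_unique[OF this lim[OF \<nu> True ad]] show ?thesis .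
  next
    case False
    have "cdf \<rho> x = 0" if "prob_on_nonneg \<rho>" for \<rho>
    proof -
      interpret real_distribution \<rho> using that by (rule prob_on_nonneg_rd)
      have "AE t in \<rho>. t \<notin> {..x}" using prob_on_nonneg_AE[OF that] by eventually_elim (use False in auto)
      thus ?thesis unfolding cdf_def using prob_eq_0[of "{..x}"] by simp
    qed
    from this[OF \<mu>] this[OF \<nu>] show ?thesis by simp
  qed
  thus ?thesis by (intro cdf_unique[OF rd]) auto
qed

section \<open>Tightness and weak convergence through the transform\<close>

lemma (in real_distribution) rst_tail:
  assumes x: "x > 0"
  shows "measure M {x<..} \<le> 2 * (1 - x * rst M x)"
proof -
  \<comment> \<open>On the half-line the left side is \<open>t / (t + x)\<close>, which exceeds 1/2
    beyond \<open>x\<close>.\<close>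
  have "(1 - x * rker x t) \<ge> 1 / 2 * indicator {x<..} t" for t
  proof -
    have 1: "x * rker x t \<le> 1" using rker_bounds(2)[OF x, of t] x by (simp add: field_simps)
    have 2: "x * rker x t \<le> 1 / 2" if "t > x" using that x unfolding rker_def by (simp add: field_simps)
    show ?thesis using 1 2 by (cases "t > x") (auto simp: indicator_def)
  qed
  hence "(LINT t|M. 1 / 2 * indicator {x<..} t) \<le> (LINT t|M. 1 - x * rker x t)"
  proof (intro integral_mono)
    show "integrable M (\<lambda>t. 1 / 2 * indicator {x<..} t :: real)"
      by (rule integrable_bounded[where B = 1]) (auto simp: indicator_def)
  qed (use rker_integrable[OF x] in auto)
  also have "\<dots> = 1 - x * rst M x" unfolding rst_def using rker_integrable[OF x] prob_space by simp
  finally show ?thesis by simp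
qed

text \<open>The condition on \<open>m\<close> says that no mass escapes: the tail bound at one
  suitable \<open>x\<close> controls all large \<open>n\<close>, and the finitely many remaining
  measures are handled one by one.\<close>

lemma tight_of_rst:
  assumes \<rho>: "\<And>n. prob_on_nonneg (\<rho> n)"
    and lim: "\<And>x. x \<in> \<rat> \<Longrightarrow> x > 0 \<Longrightarrow> (\<lambda>n. rst (\<rho> n) x) \<longlonglongrightarrow> m x"
    and m: "\<And>\<epsilon>. \<epsilon> > 0 \<Longrightarrow> \<exists>x\<in>\<rat>. x > 0 \<and> 1 - x * m x < \<epsilon>"
  shows "tight \<rho>"
  unfolding tight_def
proof (intro conjI allI impI)
  show rd: "real_distribution (\<rho> n)" for n using \<rho> prob_on_nonneg_rd by blast
  fix \<epsilon> :: real assume e: "\<epsilon> > 0"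
  \<comment> \<open>The left end \<open>-1\<close> keeps a possible atom at 0 inside the half-open
    interval.\<close>
  have meas: "measure (\<rho> n) {-1<..b} = 1 - measure (\<rho> n) {b<..}" if "b > -1" for n b
  proof -
    interpret real_distribution "\<rho> n" by (rule rd)
    have "prob {..-1} = 0"
    proof -
      have "AE t in \<rho> n. t \<notin> {..-1}" using prob_on_nonneg_AE[OF \<rho>, of n] by eventually_elim auto
      thus ?thesis using prob_eq_0[of "{..-1}"] by simp
    qed
    moreover have "prob {-1<..b} = prob {..b} - prob {..-1}"
      using cdf_diff_eq[of "-1" b] that unfolding cdf_def by simp
    moreover have "prob {..b} = 1 - prob {b<..}"
      using prob_compl[of "{b<..}"] by (simp add: Compl_eq_Diff_UNIV[symmetric])
    ultimately show ?thesis by simp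
  qed
  obtain x where x: "x \<in> \<rat>" "x > 0" "1 - x * m x < \<epsilon> / 2" using m[of "\<epsilon> / 2"] e by auto
  have "(\<lambda>n. 2 * (1 - x * rst (\<rho> n) x)) \<longlonglongrightarrow> 2 * (1 - x * m x)"
    by (intro tendsto_intros lim x)
  hence "\<forall>\<^sub>F n in sequentially. 2 * (1 - x * rst (\<rho> n) x) < \<epsilon>"
    by (rule order_tendstoD(2)) (use x(3) in simp)
  then obtain n0 where n0: "\<And>n. n \<ge> n0 \<Longrightarrow> 2 * (1 - x * rst (\<rho> n) x) < \<epsilon>"
    unfolding eventually_sequentially by blast
  have "\<exists>b. measure (\<rho> n) {b<..} < \<epsilon>" for n
  proof -
    interpret real_distribution "\<rho> n" by (rule rd)
    have "\<forall>\<^sub>F i in sequentially. cdf (\<rho> n) (real i) > 1 - \<epsilon>"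
      using cdf_lim_infty_prob e by (intro order_tendstoD(1)) auto
    then obtain i where "cdf (\<rho> n) (real i) > 1 - \<epsilon>" by (auto simp: eventually_sequentially)
    moreover have "prob {..real i} = 1 - prob {real i<..}"
      using prob_compl[of "{real i<..}"] by (simp add: Compl_eq_Diff_UNIV[symmetric])
    ultimately show ?thesis unfolding cdf_def by (intro exI[of _ "real i"]) auto
  qed
  then obtain bb where bb: "\<And>n. measure (\<rho> n) {bb n<..} < \<epsilon>" by metis
  define b where "b = Max (insert x (bb ` {..<n0}))"
  have bx: "b \<ge> x" unfolding b_def by (intro Max_ge) auto
  have bbn: "b \<ge> bb n" if "n < n0" for n unfolding b_def using that by (intro Max_ge) auto
  have "measure (\<rho> n) {b<..} < \<epsilon>" for n
  proof -
    interpret real_distribution "\<rho> n" by (rule rd)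
    show ?thesis
    proof (cases "n < n0")
      case True
      have "prob {b<..} \<le> prob {bb n<..}" using bbn[OF True] by (intro finite_measure_mono) auto
      thus ?thesis using bb[of n] by simp
    next
      case False
      have "prob {b<..} \<le> prob {x<..}" using bx by (intro finite_measure_mono) auto
      also have "\<dots> \<le> 2 * (1 - x * rst (\<rho> n) x)" by (rule rst_tail[OF x(2)])
      finally show ?thesis using n0[of n] False by simp
    qed
  qed
  hence "\<forall>n. measure (\<rho> n) {-1<..b} > 1 - \<epsilon>" using meas[of b] bx x(2) by auto
  moreover have "-1 < b" using bx x(2) by simp
  ultimately show "\<exists>a b. a < b \<and> (\<forall>n. measure (\<rho> n) {a<..b} > 1 - \<epsilon>)" by blast
qed

lemma weak_conv_integral:
  fixes f :: "real \<Rightarrow> real"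
  assumes "\<And>n. real_distribution (\<rho> n)" "real_distribution \<mu>" "weak_conv_m \<rho> \<mu>"
    and "\<And>x. isCont f x" "\<And>x. \<bar>f x\<bar> \<le> B"
  shows "(\<lambda>n. integral\<^sup>L (\<rho> n) f) \<longlonglongrightarrow> integral\<^sup>L \<mu> f"
  by (rule weak_conv_imp_integral_bdd_continuous_conv[OF assms(1-4), of B]) (use assms(5) in auto)

lemma weak_conv_rst:
  assumes "\<And>n. real_distribution (\<rho> n)" "real_distribution \<mu>" "weak_conv_m \<rho> \<mu>" and x: "x > 0"
  shows "(\<lambda>n. rst (\<rho> n) x) \<longlonglongrightarrow> rst \<mu> x"
  unfolding rst_def
proof (rule weak_conv_integral[OF assms(1-3)])
  have "max t 0 + x \<noteq> 0" for t using x by (auto simp: max_def)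
  thus "isCont (rker x) t" for t unfolding rker_def by (intro continuous_intros)
  show "\<bar>rker x t\<bar> \<le> 1 / x" for t using rker_bounds[OF x, of t] by auto
qed

text \<open>Tested on the bounded continuous function \<open>f\<close>, which is nonnegative and
  vanishes exactly on the half-line.\<close>

lemma weak_conv_nonneg:
  assumes \<rho>: "\<And>n. prob_on_nonneg (\<rho> n)" and \<mu>: "real_distribution \<mu>" and w: "weak_conv_m \<rho> \<mu>"
  shows "prob_on_nonneg \<mu>"
proof (rule prob_on_nonnegI[OF \<mu>])
  interpret real_distribution \<mu> by fact
  define f where "f t = min 1 (max (-t) 0)" for t :: real
  have fm: "f \<in> borel_measurable borel" unfolding f_def by measurable
  have "(\<lambda>n. integral\<^sup>L (\<rho> n) f) \<longlonglongrightarrow> integral\<^sup>L \<mu> f"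
  proof (rule weak_conv_integral[OF _ \<mu> w, where B = 1])
    show "isCont f x" for x unfolding f_def by (intro continuous_intros)
  qed (auto simp: f_def prob_on_nonneg_rd[OF \<rho>])
  moreover have "integral\<^sup>L (\<rho> n) f = 0" for n
  proof -
    have "AE t in \<rho> n. f t = 0" using prob_on_nonneg_AE[OF \<rho>[of n]] by eventually_elim (auto simp: f_def)
    thus ?thesis by (rule integral_eq_zero_AE)
  qed
  ultimately have "integral\<^sup>L \<mu> f = 0" using LIMSEQ_unique[OF tendsto_const] by fastforce
  moreover have "integrable \<mu> f" by (rule integrable_bounded[where B = 1, OF fm]) (auto simp: f_def)
  ultimately have "AE t in \<mu>. f t = 0"
    by (subst (asm) integral_nonneg_eq_0_iff_AE) (auto simp: f_def)
  thus "AE t in \<mu>. t \<ge> 0" by eventually_elim (auto simp: f_def min_def max_def split: if_splits)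
qed

text \<open>Tightness yields a weak limit point along a subsequence, and its transform is the limit
  of the transforms.\<close>

lemma rst_limit_exists:
  assumes \<rho>: "\<And>n. prob_on_nonneg (\<rho> n)"
    and lim: "\<And>x. x \<in> \<rat> \<Longrightarrow> x > 0 \<Longrightarrow> (\<lambda>n. rst (\<rho> n) x) \<longlonglongrightarrow> m x"
    and m: "\<And>\<epsilon>. \<epsilon> > 0 \<Longrightarrow> \<exists>x\<in>\<rat>. x > 0 \<and> 1 - x * m x < \<epsilon>"
  shows "\<exists>\<mu>. prob_on_nonneg \<mu> \<and> (\<forall>x\<in>\<rat>. x > 0 \<longrightarrow> rst \<mu> x = m x)"
proof -
  obtain r \<mu> where r: "strict_mono (r :: nat \<Rightarrow> nat)" and \<mu>: "real_distribution \<mu>"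
    and w: "weak_conv_m (\<rho> \<circ> id \<circ> r) \<mu>"
    using tight_imp_convergent_subsubsequence[OF tight_of_rst[OF assms] strict_mono_id] by blast
  have p: "prob_on_nonneg \<mu>" by (rule weak_conv_nonneg[OF _ \<mu> w]) (auto intro: \<rho>)
  have "rst \<mu> x = m x" if x: "x \<in> \<rat>" "x > 0" for x
  proof -
    have "(\<lambda>n. rst ((\<rho> \<circ> id \<circ> r) n) x) \<longlonglongrightarrow> rst \<mu> x"
      by (rule weak_conv_rst[OF _ \<mu> w x(2)]) (auto intro: \<rho> prob_on_nonneg_rd)
    moreover have "(\<lambda>n. rst ((\<rho> \<circ> id \<circ> r) n) x) \<longlonglongrightarrow> m x"
      using LIMSEQ_subseq_LIMSEQ[OF lim[OF x] r] by (simp add: o_def)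
    ultimately show ?thesis by (rule LIMSEQ_unique)
  qed
  thus ?thesis using p by blast
qed

text \<open>For fixed \<open>t\<close>, the quantity \<open>x * rker x t\<close> tends to 1 as
  \<open>x\<close> grows and never exceeds 1; the total mass is 1.\<close>

lemma rst_no_escape:
  assumes \<mu>: "prob_on_nonneg \<mu>" and e: "\<epsilon> > 0"
  shows "\<exists>x\<in>\<rat>. x > 0 \<and> 1 - x * rst \<mu> x < \<epsilon>"
proof -
  interpret real_distribution \<mu> using \<mu> by (rule prob_on_nonneg_rd)
  have "(\<lambda>n. LINT t|\<mu>. real (Suc n) * rker (real (Suc n)) t) \<longlonglongrightarrow> (LINT t|\<mu>. 1)"
  proof (rule integral_dominated_convergence[where w = "\<lambda>_. 1"])
    show "AE t in \<mu>. (\<lambda>n. real (Suc n) * rker (real (Suc n)) t) \<longlonglongrightarrow> 1"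
    proof (rule AE_I2)
      fix t :: real
      define s where "s = max t 0"
      have "(\<lambda>n. 1 / (1 + s * inverse (real (Suc n)))) \<longlonglongrightarrow> 1 / (1 + s * 0)"
        by (intro tendsto_intros LIMSEQ_inverse_real_of_nat) auto
      moreover have "1 / (1 + s * inverse (real (Suc n))) = real (Suc n) * rker (real (Suc n)) t" for n
        unfolding rker_def s_def[symmetric] by (simp add: field_simps s_def)
      ultimately show "(\<lambda>n. real (Suc n) * rker (real (Suc n)) t) \<longlonglongrightarrow> 1" by (simp del: of_nat_Suc)
    qed
    show "AE t in \<mu>. norm (real (Suc n) * rker (real (Suc n)) t) \<le> 1" for n
    proof (rule AE_I2)
      fix t :: real
      have "real (Suc n) * rker (real (Suc n)) t \<le> real (Suc n) * (1 / real (Suc n))"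
        using rker_bounds[of "real (Suc n)" t] by (intro mult_left_mono) auto
      thus "norm (real (Suc n) * rker (real (Suc n)) t) \<le> 1"
        using rker_bounds(1)[of "real (Suc n)" t] by simp
    qed
  qed auto
  hence "(\<lambda>n. real (Suc n) * rst \<mu> (real (Suc n))) \<longlonglongrightarrow> 1"
    unfolding rst_def using prob_space by simp
  hence "\<forall>\<^sub>F n in sequentially. real (Suc n) * rst \<mu> (real (Suc n)) > 1 - \<epsilon>"
    using e by (intro order_tendstoD(1)) auto
  then obtain n where "real (Suc n) * rst \<mu> (real (Suc n)) > 1 - \<epsilon>" by (auto simp: eventually_sequentially)
  thus ?thesis by (intro bexI[of _ "real (Suc n)"]) (auto simp del: of_nat_Suc)
qed

text \<open>Tightness reduces the claim to weak limits of subsequences, and all of these have the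
  same transform as \<mu>, hence equal \<mu>.\<close>

theorem weak_conv_of_rst:
  assumes \<rho>: "\<And>n. prob_on_nonneg (\<rho> n)" and \<mu>: "prob_on_nonneg \<mu>"
    and lim: "\<And>x. x \<in> \<rat> \<Longrightarrow> x > 0 \<Longrightarrow> (\<lambda>n. rst (\<rho> n) x) \<longlonglongrightarrow> rst \<mu> x"
  shows "weak_conv_m \<rho> \<mu>"
proof (rule tight_subseq_weak_converge)
  show "tight \<rho>" by (rule tight_of_rst[OF \<rho> lim rst_no_escape[OF \<mu>]])
  fix s :: "nat \<Rightarrow> nat" and \<nu> assume s: "strict_mono s" and \<nu>: "real_distribution \<nu>" and w: "weak_conv_m (\<rho> \<circ> s) \<nu>"
  have p: "prob_on_nonneg \<nu>" by (rule weak_conv_nonneg[OF _ \<nu> w]) (auto intro: \<rho>)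
  have "rst \<nu> x = rst \<mu> x" if x: "x \<in> \<rat>" "x > 0" for x
  proof -
    have "(\<lambda>n. rst ((\<rho> \<circ> s) n) x) \<longlonglongrightarrow> rst \<nu> x"
      by (rule weak_conv_rst[OF _ \<nu> w x(2)]) (auto intro: \<rho> prob_on_nonneg_rd)
    moreover have "(\<lambda>n. rst ((\<rho> \<circ> s) n) x) \<longlonglongrightarrow> rst \<mu> x"
      using LIMSEQ_subseq_LIMSEQ[OF lim[OF x] s] by (simp add: o_def)
    ultimately show ?thesis by (rule LIMSEQ_unique)
  qed
  hence "\<nu> = \<mu>" by (rule rst_unique[OF p \<mu>])
  thus "weak_conv_m (\<rho> \<circ> s) \<mu>" using w by simp
qed (intro prob_on_nonneg_rd \<rho> \<mu>)+

section \<open>The Levy distance\<close>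

lemma levy_dist_nonneg_le:
  assumes F: "\<And>x. 0 \<le> F x" "\<And>x. F x \<le> 1" and G: "\<And>x. 0 \<le> G x" "\<And>x. G x \<le> 1"
  shows "levy_dist F G \<ge> 0"
    and "\<epsilon> > 0 \<Longrightarrow> (\<And>x. F (x - \<epsilon>) - \<epsilon> \<le> G x \<and> G x \<le> F (x + \<epsilon>) + \<epsilon>) \<Longrightarrow> levy_dist F G \<le> \<epsilon>"
proof -
  let ?S = "{\<epsilon>. \<epsilon> > 0 \<and> (\<forall>x. F (x - \<epsilon>) - \<epsilon> \<le> G x \<and> G x \<le> F (x + \<epsilon>) + \<epsilon>)}"
  have "F (x - 1) - 1 \<le> G x \<and> G x \<le> F (x + 1) + 1" for x
    using F(2)[of "x - 1"] F(1)[of "x + 1"] G(1)[of x] G(2)[of x] by linarith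
  \<comment> \<open>Both functions take values in [0, 1], so 1 is always admissible and the infimum
    is taken over a nonempty set.\<close>
  hence "1 \<in> ?S" by (intro CollectI conjI allI) auto
  hence ne: "?S \<noteq> {}" by blast
  show "levy_dist F G \<ge> 0" unfolding levy_dist_def by (rule cInf_greatest[OF ne]) auto
  assume "\<epsilon> > 0" "\<And>x. F (x - \<epsilon>) - \<epsilon> \<le> G x \<and> G x \<le> F (x + \<epsilon>) + \<epsilon>"
  thus "levy_dist F G \<le> \<epsilon>" unfolding levy_dist_def by (intro cInf_lower bdd_belowI[of _ 0]) auto
qed

lemma (in real_distribution) dense_continuity_points:
  assumes "a < b" shows "\<exists>t. a < t \<and> t < b \<and> isCont (cdf M) t"
proof -
  have "\<not> {a<..<b} \<subseteq> {x. measure M {x} > 0}"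
    using countable_subset[OF _ countable_atoms] uncountable_open_interval[of a b] assms by blast
  then obtain t where "t \<in> {a<..<b}" "\<not> measure M {t} > 0" by blast
  thus ?thesis using isCont_cdf[of t] by (auto simp: zero_less_measure_iff)
qed

text \<open>Closeness at finitely many continuity points suffices: between neighbouring points,
  which are less than \<epsilon> apart, monotonicity transfers the estimate with a horizontal shift
  of \<epsilon>, and outside the grid both tails are small.\<close>

theorem weak_conv_levy:
  assumes \<rho>: "\<And>n. real_distribution (\<rho> n)" and \<mu>: "real_distribution \<mu>" and w: "weak_conv_m \<rho> \<mu>" and e: "\<epsilon> > 0"
  shows "\<forall>\<^sub>F n in sequentially. levy_dist (cdf (\<rho> n)) (cdf \<mu>) \<le> \<epsilon>"
proof -
  interpret real_distribution \<mu> by fact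
  define G where "G = cdf \<mu>"
  obtain k :: nat where k: "G (- real k) < \<epsilon> / 2" "G (real k) > 1 - \<epsilon> / 2"
  proof -
    have "\<forall>\<^sub>F k in sequentially. G (- real k) < \<epsilon> / 2" unfolding G_def
      using cdf_lim_neg_infty e by (intro order_tendstoD(2)) auto
    moreover have "\<forall>\<^sub>F k in sequentially. G (real k) > 1 - \<epsilon> / 2" unfolding G_def
      using cdf_lim_infty_prob e by (intro order_tendstoD(1)) auto
    ultimately have "\<forall>\<^sub>F k in sequentially. G (- real k) < \<epsilon> / 2 \<and> G (real k) > 1 - \<epsilon> / 2" by eventually_elim auto
    thus ?thesis using that by (auto simp: eventually_sequentially)
  qed
  \<comment> \<open>The ends are placed so that \<open>t 0 < - real k\<close> and
    \<open>t m > real k\<close>. With one point in each cell of width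
    \<open>h = \<epsilon> / 2\<close>, consecutive points differ by less than
    \<open>2 * h = \<epsilon>\<close>.\<close>
  define a where "a = - real k - \<epsilon> / 2"
  define b where "b = real k + \<epsilon>"
  define h where "h = \<epsilon> / 2"
  have h: "h > 0" using e by (simp add: h_def)
  have "\<exists>t. a + real i * h < t \<and> t < a + real (Suc i) * h \<and> isCont G t" for i :: nat
    unfolding G_def using h by (intro dense_continuity_points) auto
  then obtain t where t: "\<And>i. a + real i * h < t i" "\<And>i. t i < a + real (Suc i) * h" "\<And>i. isCont G (t i)" by metis
  obtain m :: nat where "b - a < real m * h" using reals_Archimedean3[OF h] by blast
  hence m: "a + real m * h > b" by simp
  have ev: "\<forall>\<^sub>F n in sequentially. \<forall>i\<in>{..m}. \<bar>cdf (\<rho> n) (t i) - G (t i)\<bar> < \<epsilon> / 2"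
  proof (rule eventually_ball_finite)
    show "\<forall>i\<in>{..m}. \<forall>\<^sub>F n in sequentially. \<bar>cdf (\<rho> n) (t i) - G (t i)\<bar> < \<epsilon> / 2"
    proof
      fix i
      have "(\<lambda>n. cdf (\<rho> n) (t i)) \<longlonglongrightarrow> G (t i)" using w t(3)[of i] unfolding weak_conv_m_def weak_conv_def G_def by auto
      from tendstoD[OF this, of "\<epsilon> / 2"] show "\<forall>\<^sub>F n in sequentially. \<bar>cdf (\<rho> n) (t i) - G (t i)\<bar> < \<epsilon> / 2"
        using e by (simp add: dist_real_def)
    qed
  qed auto
  have G01: "0 \<le> G x" "G x \<le> 1" "x \<le> y \<Longrightarrow> G x \<le> G y" for x y unfolding G_def
    by (auto intro: cdf_nonneg cdf_bounded_prob cdf_nondecreasing)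
  have t0: "t 0 < - real k" using t(2)[of 0] by (simp add: a_def h_def)
  have tm: "t m > real k" using t(1)[of m] m e by (simp add: b_def)
  have grid: "\<exists>i\<le>m. y \<le> t i \<and> t i \<le> y + \<epsilon>" if y: "y \<ge> t 0 - \<epsilon>" "y \<le> t m" for y
  proof -
    define i where "i = (LEAST i. y \<le> t i)"
    have i: "y \<le> t i" unfolding i_def by (rule LeastI[of _ m]) (rule y(2))
    have im: "i \<le> m" unfolding i_def by (rule Least_le) (rule y(2))
    have "t i \<le> y + \<epsilon>"
    proof (cases i)
      case 0
      thus ?thesis using y(1) by simp
    next
      case (Suc j)
      have "\<not> y \<le> t j" using not_less_Least[of j "\<lambda>i. y \<le> t i"] Suc unfolding i_def by simp
      moreover have "t (Suc j) < t j + 2 * h" using t(2)[of "Suc j"] t(1)[of j] by (simp add: algebra_simps)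
      ultimately show ?thesis using Suc by (simp add: h_def)
    qed
    thus ?thesis using i im by blast
  qed
  show ?thesis using ev
  proof eventually_elim
    case (elim n)
    interpret N: real_distribution "\<rho> n" by (rule \<rho>)
    define F where "F = cdf (\<rho> n)"
    have F01: "0 \<le> F x" "F x \<le> 1" "x \<le> y \<Longrightarrow> F x \<le> F y" for x y unfolding F_def
      by (auto intro: N.cdf_nonneg N.cdf_bounded_prob N.cdf_nondecreasing)
    have cl: "\<bar>F (t i) - G (t i)\<bar> < \<epsilon> / 2" if "i \<le> m" for i using elim that unfolding F_def by simp
    have "F (x - \<epsilon>) - \<epsilon> \<le> G x \<and> G x \<le> F (x + \<epsilon>) + \<epsilon>" for x
    proof
      show "F (x - \<epsilon>) - \<epsilon> \<le> G x"
      proof -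
        consider "x - \<epsilon> < t 0 - \<epsilon>" | "x - \<epsilon> > t m" | "t 0 - \<epsilon> \<le> x - \<epsilon>" "x - \<epsilon> \<le> t m" by linarith
        thus ?thesis
        proof cases
          case 1
          have "F (x - \<epsilon>) \<le> F (t 0)" using 1 e by (intro F01) auto
          moreover have "G (t 0) \<le> G (- real k)" using t0 by (intro G01) auto
          ultimately show ?thesis using cl[of 0] k(1) G01(1)[of x] by (auto simp: abs_if split: if_splits)
        next
          case 2
          have "G (real k) \<le> G x" using 2 tm e by (intro G01) auto
          thus ?thesis using k(2) F01(2)[of "x - \<epsilon>"] e by linarith
        next
          case 3
          then obtain i where i: "i \<le> m" "x - \<epsilon> \<le> t i" "t i \<le> x" using grid[of "x - \<epsilon>"] by auto
          have "F (x - \<epsilon>) \<le> F (t i)" "G (t i) \<le> G x" using i by (auto intro: F01 G01)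
          thus ?thesis using cl[OF i(1)] e by linarith
        qed
      qed
      show "G x \<le> F (x + \<epsilon>) + \<epsilon>"
      proof -
        consider "x < t 0 - \<epsilon>" | "x > t m" | "t 0 - \<epsilon> \<le> x" "x \<le> t m" by linarith
        thus ?thesis
        proof cases
          case 1
          have "G x \<le> G (- real k)" using 1 t0 e by (intro G01) auto
          thus ?thesis using k(1) F01(1)[of "x + \<epsilon>"] e by linarith
        next
          case 2
          have "F (t m) \<le> F (x + \<epsilon>)" using 2 e by (intro F01) auto
          moreover have "G (real k) \<le> G (t m)" using tm by (intro G01) auto
          ultimately show ?thesis using cl[of m] k(2) G01(2)[of x] by (auto simp: abs_if split: if_splits)
        next
          case 3
          then obtain i where i: "i \<le> m" "x \<le> t i" "t i \<le> x + \<epsilon>" using grid[of x] by auto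
          have "F (t i) \<le> F (x + \<epsilon>)" "G x \<le> G (t i)" using i by (auto intro: F01 G01)
          thus ?thesis using cl[OF i(1)] e by linarith
        qed
      qed
    qed
    thus ?case using levy_dist_nonneg_le(2)[of F G \<epsilon>] F01 G01 e unfolding F_def G_def by blast
  qed
qed

text \<open>Compactness by contradiction: otherwise some sequence of measures is Levy-far from \<mu>
  although its \<open>k\<close>-th member matches the transform of \<mu> up to
  \<open>1 / (k + 1)\<close> at the first \<open>k + 1\<close> rational points of an enumeration.
  Such a sequence converges weakly to \<mu>. Reducing the Levy distance to finitely many scalars
  lets a union bound keep the exponential rate.\<close>

theorem rst_close_levy:
  assumes \<mu>: "prob_on_nonneg \<mu>" and e: "\<epsilon> > 0"
  obtains F \<delta> where "finite F" "F \<subseteq> {x\<in>\<rat>. x > 0}" "\<delta> > 0"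
    "\<And>\<rho>. prob_on_nonneg \<rho> \<Longrightarrow> (\<And>x. x \<in> F \<Longrightarrow> \<bar>rst \<rho> x - rst \<mu> x\<bar> < \<delta>) \<Longrightarrow> levy_dist (cdf \<rho>) (cdf \<mu>) \<le> \<epsilon>"
proof (rule ccontr)
  let ?Q = "{x\<in>\<rat>. x > (0::real)}"
  have cnt: "countable ?Q" "?Q \<noteq> {}" using countable_rat by (auto intro: countable_subset[of _ \<rat>] exI[of _ 1])
  define f where "f = from_nat_into ?Q"
  have fQ: "f i \<in> ?Q" for i unfolding f_def using from_nat_into[OF cnt(2)] .
  have fsurj: "\<exists>i. f i = x" if "x \<in> ?Q" for x unfolding f_def using from_nat_into_surj[OF cnt(1) that] .
  assume neg: "\<not> thesis"
  have "\<exists>\<rho>. prob_on_nonneg \<rho> \<and> (\<forall>i\<le>k. \<bar>rst \<rho> (f i) - rst \<mu> (f i)\<bar> < 1 / real (Suc k)) \<and> \<not> levy_dist (cdf \<rho>) (cdf \<mu>) \<le> \<epsilon>" for k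
  proof (rule ccontr)
    assume c: "\<not> (\<exists>\<rho>. prob_on_nonneg \<rho> \<and> (\<forall>i\<le>k. \<bar>rst \<rho> (f i) - rst \<mu> (f i)\<bar> < 1 / real (Suc k)) \<and> \<not> levy_dist (cdf \<rho>) (cdf \<mu>) \<le> \<epsilon>)"
    have thesis
    proof (rule that[of "f ` {..k}" "1 / real (Suc k)"])
      show "f ` {..k} \<subseteq> ?Q" using fQ by blast
    qed (use c in auto)
    thus False using neg by simp
  qed
  then obtain \<rho> where \<rho>: "\<And>k. prob_on_nonneg (\<rho> k)"
    "\<And>k i. i \<le> k \<Longrightarrow> \<bar>rst (\<rho> k) (f i) - rst \<mu> (f i)\<bar> < 1 / real (Suc k)"
    "\<And>k. \<not> levy_dist (cdf (\<rho> k)) (cdf \<mu>) \<le> \<epsilon>" by metis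
  have "weak_conv_m \<rho> \<mu>"
  proof (rule weak_conv_of_rst[OF \<rho>(1) \<mu>])
    fix x :: real assume "x \<in> \<rat>" "x > 0"
    then obtain i where i: "f i = x" using fsurj[of x] by auto
    have "(\<lambda>k. rst (\<rho> k) x - rst \<mu> x) \<longlonglongrightarrow> 0"
    proof (rule tendsto_rabs_zero_cancel, rule tendsto_sandwich[of "\<lambda>_. 0" _ _ "\<lambda>m. 1 / real (Suc m)"])
      show "(\<lambda>m. 1 / real (Suc m)) \<longlonglongrightarrow> 0" using LIMSEQ_inverse_real_of_nat by (simp add: inverse_eq_divide)
      show "\<forall>\<^sub>F k in sequentially. \<bar>rst (\<rho> k) x - rst \<mu> x\<bar> \<le> 1 / real (Suc k)"
        using \<rho>(2)[of i] unfolding i eventually_sequentially by (intro exI[of _ i]) (auto intro: less_imp_le simp del: of_nat_Suc)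
    qed auto
    thus "(\<lambda>k. rst (\<rho> k) x) \<longlonglongrightarrow> rst \<mu> x" by (rule LIM_zero_cancel)
  qed
  from weak_conv_levy[OF prob_on_nonneg_rd[OF \<rho>(1)] prob_on_nonneg_rd[OF \<mu>] this e]
  have "\<forall>\<^sub>F n in sequentially. levy_dist (cdf (\<rho> n)) (cdf \<mu>) \<le> \<epsilon>" .
  thus False using \<rho>(3) by (auto simp: eventually_sequentially)
qed

section \<open>The limiting equation on the upper half-plane\<close>

lemma halfline_dist:
  fixes \<tau> :: real assumes "\<tau> \<ge> 0"
  shows "cmod (of_real \<tau> - z) \<ge> max \<bar>Im z\<bar> (- Re z)"
proof -
  have "\<bar>Im z\<bar> \<le> cmod (of_real \<tau> - z)" using abs_Im_le_cmod[of "of_real \<tau> - z"] by simp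
  moreover have "- Re z \<le> cmod (of_real \<tau> - z)" using complex_Re_le_cmod[of "of_real \<tau> - z"] assms by simp
  ultimately show ?thesis by simp
qed

text \<open>Differentiation under the integral with an explicit remainder, linear in
  \<open>|h|\<close> because \<open>z\<close> has distance at least \<open>d\<close> from the
  half-line. The weight \<open>w\<close> and the position \<open>\<tau>\<close> are kept general in
  order to cover the Stieltjes transform and also the right-hand side of the limiting
  equation.\<close>

lemma (in finite_measure) cauchy_transform_deriv:
  fixes w \<tau> :: "'a \<Rightarrow> real" and z :: complex
  assumes [measurable]: "w \<in> borel_measurable M" "\<tau> \<in> borel_measurable M"
    and w: "\<And>t. \<bar>w t\<bar> \<le> 1" and \<tau>: "\<And>t. \<tau> t \<ge> 0" and z: "Im z \<noteq> 0 \<or> Re z < 0"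
  shows "((\<lambda>z. LINT t|M. of_real (w t) / (of_real (\<tau> t) - z)) has_field_derivative
    (LINT t|M. of_real (w t) / (of_real (\<tau> t) - z)\<^sup>2)) (at z)"
proof -
  define d where "d = max \<bar>Im z\<bar> (- Re z)"
  have d: "d > 0" using z by (auto simp: d_def less_max_iff_disj)
  have kz: "cmod (of_real (\<tau> t) - z) \<ge> d" for t unfolding d_def by (rule halfline_dist[OF \<tau>])
  have kh: "cmod (of_real (\<tau> t) - (z + h)) \<ge> d / 2" if "cmod h \<le> d / 2" for t h
    using kz[of t] that norm_triangle_ineq2[of "of_real (\<tau> t) - z" h] by (simp add: algebra_simps)
  have bnd: "integrable M (\<lambda>t. of_real (w t) / (of_real (\<tau> t) - v) ^ j)"
    if "\<And>t. cmod (of_real (\<tau> t) - v) \<ge> e" "e > 0" for v e j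
  proof (rule integrable_const_bound[where B = "1 / e ^ j"])
    show "AE t in M. norm (of_real (w t) / (of_real (\<tau> t) - v) ^ j) \<le> 1 / e ^ j"
      using that w by (intro AE_I2) (auto simp: norm_divide norm_power intro!: frac_le power_mono)
  qed auto
  let ?F = "\<lambda>z. LINT t|M. of_real (w t) / (of_real (\<tau> t) - z)"
  let ?D = "LINT t|M. of_real (w t) / (of_real (\<tau> t) - z)\<^sup>2"
  have est: "cmod ((?F (z + h) - ?F z) / h - ?D) \<le> cmod h * (2 / d ^ 3 * measure M (space M))"
    if h: "cmod h \<le> d / 2" "h \<noteq> 0" for h
  proof -
    let ?g = "\<lambda>t. (of_real (w t) / (of_real (\<tau> t) - (z + h)) - of_real (w t) / (of_real (\<tau> t) - z)) / h - of_real (w t) / (of_real (\<tau> t) - z)\<^sup>2"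
    have i1: "integrable M (\<lambda>t. of_real (w t) / (of_real (\<tau> t) - (z + h)))"
      using bnd[of "d / 2" "z + h" 1] kh[OF h(1)] d by simp
    have i2: "integrable M (\<lambda>t. of_real (w t) / (of_real (\<tau> t) - z))" using bnd[of d z 1] kz d by simp
    have i3: "integrable M (\<lambda>t. of_real (w t) / (of_real (\<tau> t) - z)\<^sup>2)" using bnd[of d z 2] kz d by simp
    have D: "(?F (z + h) - ?F z) / h - ?D = (LINT t|M. ?g t)" using i1 i2 i3 by simp
    have "cmod (LINT t|M. ?g t) \<le> (LINT t|M. cmod (?g t))" by (rule Bochner_Integration.integral_norm_bound)
    also have "\<dots> \<le> (LINT t|M. cmod h * (2 / d ^ 3))"
    proof (rule Bochner_Integration.integral_mono)
      show "integrable M (\<lambda>t. cmod (?g t))" using i1 i2 i3 by (intro integrable_norm) simp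
      fix t
      let ?a = "of_real (\<tau> t) - (z + h)" and ?b = "of_real (\<tau> t) - z"
      have a: "cmod ?a \<ge> d / 2" "?a \<noteq> 0" using kh[OF h(1), of t] d by auto
      have b: "cmod ?b \<ge> d" "?b \<noteq> 0" using kz[of t] d by auto
      have e: "?b = ?a + h" by simp
      \<comment> \<open>The second-order remainder of \<open>1 / (\<tau> - z)\<close> in closed
        form; the factors \<open>d / 2\<close> and \<open>d^2\<close> below bound its
        denominator.\<close>
      have "?g t = of_real (w t) * (h / (?a * ?b\<^sup>2))"
      proof -
        have "(of_real (w t) / A - of_real (w t) / (A + h)) / h - of_real (w t) / (A + h)\<^sup>2 = of_real (w t) * (h / (A * (A + h)\<^sup>2))"
          if "A \<noteq> 0" "A + h \<noteq> 0" for A :: complex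
          using that h(2) by (simp add: divide_simps power2_eq_square) (simp add: algebra_simps)
        from this[of ?a] a(2) b(2) show ?thesis unfolding e by simp
      qed
      hence "cmod (?g t) = \<bar>w t\<bar> * (cmod h / (cmod ?a * (cmod ?b)\<^sup>2))" by (simp add: norm_mult norm_divide norm_power)
      also have "\<dots> \<le> 1 * (cmod h / ((d / 2) * d\<^sup>2))"
        using w[of t] a b d by (intro mult_mono frac_le power_mono) auto
      also have "\<dots> = cmod h * (2 / d ^ 3)" by (simp add: power2_eq_square power3_eq_cube)
      finally show "norm (?g t) \<le> cmod h * (2 / d ^ 3)" .
    qed auto
    also have "\<dots> = cmod h * (2 / d ^ 3 * measure M (space M))" by (simp add: mult_ac)
    finally show ?thesis unfolding D .
  qed
  have "((\<lambda>h. (?F (z + h) - ?F z) / h - ?D) \<longlongrightarrow> 0) (at 0)"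
  proof (rule tendsto_norm_zero_cancel, rule tendsto_sandwich[of "\<lambda>_. 0" _ _ "\<lambda>h. cmod h * (2 / d ^ 3 * measure M (space M))"])
    show "((\<lambda>h. cmod h * (2 / d ^ 3 * measure M (space M))) \<longlongrightarrow> 0) (at 0)"
      by (rule tendsto_mult_left_zero, rule tendsto_norm_zero, rule tendsto_ident_at)
    show "\<forall>\<^sub>F h in at 0. norm ((?F (z + h) - ?F z) / h - ?D) \<le> cmod h * (2 / d ^ 3 * measure M (space M))"
      unfolding eventually_at using est d by (intro exI[of _ "d / 2"]) auto
  qed auto
  thus ?thesis unfolding DERIV_def by (rule LIM_zero_cancel)
qed

text \<open>A connected region that contains both the upper half-plane and the negative axis, for analytic
  continuation from the latter to the former.\<close>

definition sdom :: "complex set" where "sdom = {z. Im z > 0 \<or> Re z < 0}"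

lemma sdom_open: "open sdom" and sdom_connected: "connected sdom"
proof -
  have e: "sdom = {z. Im z > 0} \<union> {z. Re z < 0}" by (auto simp: sdom_def)
  show "open sdom" unfolding e by (intro open_Un open_halfspace_Im_gt open_halfspace_Re_lt)
  have "Complex (-1) 1 \<in> {z. Im z > 0} \<inter> {z. Re z < 0}" by simp
  thus "connected sdom" unfolding e
    by (intro connected_Un convex_connected convex_halfspace_Im_gt convex_halfspace_Re_lt) blast
qed

text \<open>The factor \<open>of_real 1\<close> gives the integrand the shape of
  \<open>cauchy_transform_deriv\<close> with constant weight, and \<open>max\<close> places the pole
  on the half-line for every \<open>t\<close>.\<close>

definition cst :: "real measure \<Rightarrow> complex \<Rightarrow> complex" where
  "cst \<mu> z = (LINT t|\<mu>. of_real 1 / (of_real (max t 0) - z))"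

lemma stieltjes_eq_cst:
  assumes "prob_on_nonneg \<mu>" shows "stieltjes \<mu> z = cst \<mu> z"
proof -
  interpret real_distribution \<mu> using assms by (rule prob_on_nonneg_rd)
  show ?thesis unfolding stieltjes_def cst_def
  proof (rule integral_cong_AE)
    show "AE t in \<mu>. 1 / (complex_of_real t - z) = of_real 1 / (of_real (max t 0) - z)"
      using prob_on_nonneg_AE[OF assms] by eventually_elim (simp add: max_def)
  qed auto
qed

text \<open>The right-hand side of the limiting equation as a function of \<open>s\<close>
  alone.\<close>

definition srf :: "real \<Rightarrow> real measure \<Rightarrow> complex \<Rightarrow> complex" where
  "srf c \<nu> s = (LINT r|\<nu>. of_real (max r 0) / (1 + of_real c * of_real (max r 0) * s))"

lemma solves_eq_iff:
  assumes "prob_on_nonneg \<nu>"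
  shows "solves_eq c \<nu> z s \<longleftrightarrow> 1 / s + z = srf c \<nu> s"
proof -
  interpret real_distribution \<nu> using assms by (rule prob_on_nonneg_rd)
  have "(LINT r:{0..}|\<nu>. complex_of_real r / (1 + complex_of_real c * complex_of_real r * s)) = srf c \<nu> s"
    unfolding srf_def set_lebesgue_integral_def
  proof (rule integral_cong_AE)
    show "AE r in \<nu>. indicat_real {0..} r *\<^sub>R (complex_of_real r / (1 + complex_of_real c * complex_of_real r * s)) =
      of_real (max r 0) / (1 + of_real c * of_real (max r 0) * s)"
      using prob_on_nonneg_AE[OF assms] by eventually_elim (simp add: max_def)
  qed auto
  thus ?thesis unfolding solves_eq_def by simp
qed

text \<open>For \<open>r > 0\<close> the integrand is \<open>(1 / c) / (1 / (c * r) + s)\<close>: a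
  Cauchy transform evaluated at \<open>- s\<close>, with pole \<open>1 / (c * r)\<close> on the
  half-line. The weight removes \<open>r = 0\<close>, where \<open>1 / 0 = 0\<close> would put a
  spurious pole at the origin.\<close>

lemma srf_eq_transform:
  assumes "c > 0"
  shows "srf c \<nu> s = (1 / of_real c) * (LINT r|\<nu>. of_real (indicator {0<..} r) / (of_real (1 / (c * max r 0)) - (- s)))"
proof -
  have "of_real (max r 0) / (1 + of_real c * of_real (max r 0) * s) =
    (1 / of_real c) * (of_real (indicator {0<..} r) / (of_real (1 / (c * max r 0)) - (- s)))" for r
  proof (cases "r > 0")
    case True
    have "of_real r / (1 + of_real c * of_real r * s) = (1 / of_real c) * (1 / (1 / (of_real c * of_real r) + s))"
      using True assms by (simp add: field_simps)
    thus ?thesis using True by simp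
  qed simp
  thus ?thesis unfolding srf_def by (simp only: integral_mult_right_zero)
qed

lemma cst_holomorphic:
  assumes "prob_on_nonneg \<mu>" shows "cst \<mu> holomorphic_on {z. Im z \<noteq> 0 \<or> Re z < 0}"
proof -
  interpret real_distribution \<mu> using assms by (rule prob_on_nonneg_rd)
  show ?thesis
  proof (rule holomorphic_onI)
    fix z assume "z \<in> {z. Im z \<noteq> 0 \<or> Re z < 0}"
    hence "(cst \<mu> has_field_derivative (LINT t|\<mu>. of_real 1 / (of_real (max t 0) - z)\<^sup>2)) (at z)"
      unfolding cst_def[abs_def] by (intro cauchy_transform_deriv[where w = "\<lambda>_. 1" and \<tau> = "\<lambda>t. max t 0"]) auto
    thus "cst \<mu> field_differentiable at z within {z. Im z \<noteq> 0 \<or> Re z < 0}"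
      unfolding field_differentiable_def by (intro exI) (rule has_field_derivative_at_within)
  qed
qed

lemma srf_holomorphic:
  assumes "prob_on_nonneg \<nu>" "c > 0" shows "srf c \<nu> holomorphic_on {s. Im s \<noteq> 0 \<or> Re s > 0}"
proof -
  interpret real_distribution \<nu> using assms(1) by (rule prob_on_nonneg_rd)
  let ?F = "\<lambda>z. LINT r|\<nu>. of_real (indicator {0<..} r) / (of_real (1 / (c * max r 0)) - z)"
  have F: "?F holomorphic_on {z. Im z \<noteq> 0 \<or> Re z < 0}"
  proof (rule holomorphic_onI)
    fix z assume "z \<in> {z. Im z \<noteq> 0 \<or> Re z < 0}"
    hence "(?F has_field_derivative (LINT r|\<nu>. of_real (indicator {0<..} r) / (of_real (1 / (c * max r 0)) - z)\<^sup>2)) (at z)"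
      using assms(2) by (intro cauchy_transform_deriv[where w = "indicator {0<..}" and \<tau> = "\<lambda>r. 1 / (c * max r 0)"])
        (auto simp: indicator_def)
    thus "?F field_differentiable at z within {z. Im z \<noteq> 0 \<or> Re z < 0}"
      unfolding field_differentiable_def by (intro exI) (rule has_field_derivative_at_within)
  qed
  have "(\<lambda>s. (1 / of_real c) * (?F \<circ> uminus) s) holomorphic_on {s. Im s \<noteq> 0 \<or> Re s > 0}"
    by (intro holomorphic_intros holomorphic_on_compose_gen[OF _ F]) auto
  thus ?thesis unfolding srf_eq_transform[OF assms(2), abs_def] o_def .
qed

lemma (in real_distribution) kernel_integrable:
  assumes "Im z \<noteq> 0 \<or> Re z < 0"
  shows "integrable M (\<lambda>t. of_real 1 / (of_real (max t 0) - z))"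
proof -
  define d where "d = max \<bar>Im z\<bar> (- Re z)"
  have d: "d > 0" using assms by (auto simp: d_def less_max_iff_disj)
  show ?thesis
  proof (rule integrable_const_bound[where B = "1 / d"])
    show "AE t in M. norm (of_real 1 / (of_real (max t 0) - z)) \<le> 1 / d"
      using halfline_dist[of "max t 0" z for t] d unfolding d_def
      by (intro AE_I2) (auto simp: norm_divide intro!: frac_le)
  qed auto
qed

lemma (in real_distribution) integral_pos:
  fixes f :: "real \<Rightarrow> real"
  assumes "integrable M f" "\<And>t. f t > 0" shows "integral\<^sup>L M f > 0"
proof (rule ccontr)
  assume "\<not> integral\<^sup>L M f > 0"
  moreover have "integral\<^sup>L M f \<ge> 0" using assms(2) by (intro integral_nonneg_AE AE_I2 less_imp_le)
  ultimately have "integral\<^sup>L M f = 0" by simp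
  hence "AE t in M. f t = 0" using assms by (subst (asm) integral_nonneg_eq_0_iff_AE) (auto intro: less_imp_le)
  hence "AE t in M. False" by eventually_elim (use assms(2) in \<open>auto simp: less_imp_neq[symmetric]\<close>)
  thus False by simp
qed

lemma cst_Im_pos:
  assumes "prob_on_nonneg \<mu>" "Im z > 0" shows "Im (cst \<mu> z) > 0"
proof -
  interpret real_distribution \<mu> using assms(1) by (rule prob_on_nonneg_rd)
  have i: "integrable \<mu> (\<lambda>t. of_real 1 / (of_real (max t 0) - z))" using assms(2) by (intro kernel_integrable) auto
  have "Im (of_real 1 / (of_real (max t 0) - z)) > 0" for t
  proof -
    have "(max t 0 - Re z)\<^sup>2 + (Im z)\<^sup>2 > 0" using assms(2) by (intro add_nonneg_pos) auto
    thus ?thesis using assms(2) by (simp add: Im_divide)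
  qed
  hence "(LINT t|\<mu>. Im (of_real 1 / (of_real (max t 0) - z))) > 0" using i by (intro integral_pos integrable_Im)
  thus ?thesis unfolding cst_def using integral_Im[OF i] by simp
qed

lemma cst_Re_pos:
  assumes "prob_on_nonneg \<mu>" "Re z < 0" shows "Re (cst \<mu> z) > 0"
proof -
  interpret real_distribution \<mu> using assms(1) by (rule prob_on_nonneg_rd)
  have i: "integrable \<mu> (\<lambda>t. of_real 1 / (of_real (max t 0) - z))" using assms(2) by (intro kernel_integrable) auto
  have "Re (of_real 1 / (of_real (max t 0) - z)) > 0" for t
  proof -
    have "max t 0 - Re z > 0" using assms(2) by (simp add: max_def)
    moreover from this have "(max t 0 - Re z)\<^sup>2 + (Im z)\<^sup>2 > 0" by (intro add_pos_nonneg) auto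
    ultimately show ?thesis by (simp add: Re_divide)
  qed
  hence "(LINT t|\<mu>. Re (of_real 1 / (of_real (max t 0) - z))) > 0" using i by (intro integral_pos integrable_Re)
  thus ?thesis unfolding cst_def using integral_Re[OF i] by simp
qed

lemma cst_neg_real:
  assumes "x > 0" shows "cst \<mu> (- of_real x) = of_real (rst \<mu> x)"
proof -
  have "of_real 1 / (of_real (max t 0) - (- of_real x)) = complex_of_real (rker x t)" for t
    by (simp add: rker_def)
  thus ?thesis unfolding cst_def rst_def by simp
qed

lemma srf_of_real: "srf c \<nu> (of_real m) = of_real (LINT r|\<nu>. max r 0 / (1 + c * max r 0 * m))"
proof -
  have "of_real (max r 0) / (1 + of_real c * of_real (max r 0) * of_real m) = complex_of_real (max r 0 / (1 + c * max r 0 * m))" for r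
    by simp
  thus ?thesis unfolding srf_def by (simp only: integral_complex_of_real)
qed

text \<open>The difference \<open>f\<close> of the two sides is holomorphic on \<open>sdom\<close>:
  there the transform has positive imaginary or positive real part, so it is nonzero and stays where
  \<open>srf\<close> is holomorphic. At \<open>z = - x\<close> the equation is the real one, so
  \<open>f\<close> vanishes at all negative rationals, and the identity theorem applies.\<close>

theorem stieltjes_solves_eq:
  assumes \<mu>: "prob_on_nonneg \<mu>" and \<nu>: "prob_on_nonneg \<nu>" and c: "c > 0"
    and eq: "\<And>x. x \<in> \<rat> \<Longrightarrow> x > 0 \<Longrightarrow> 1 / rst \<mu> x - x = (LINT r|\<nu>. max r 0 / (1 + c * max r 0 * rst \<mu> x))"
    and z: "Im z > 0"
  shows "solves_eq c \<nu> z (stieltjes \<mu> z)"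
proof -
  define f where "f z = 1 / cst \<mu> z + z - srf c \<nu> (cst \<mu> z)" for z
  have nz: "cst \<mu> z \<noteq> 0" "Im (cst \<mu> z) \<noteq> 0 \<or> Re (cst \<mu> z) > 0" if "z \<in> sdom" for z
    using that cst_Im_pos[OF \<mu>, of z] cst_Re_pos[OF \<mu>, of z] unfolding sdom_def by auto
  have h1: "cst \<mu> holomorphic_on sdom"
    by (rule holomorphic_on_subset[OF cst_holomorphic[OF \<mu>]]) (auto simp: sdom_def)
  have h2: "(srf c \<nu> \<circ> cst \<mu>) holomorphic_on sdom"
    by (rule holomorphic_on_compose_gen[OF h1 srf_holomorphic[OF \<nu> c]]) (use nz in auto)
  have hol: "f holomorphic_on sdom" unfolding f_def[abs_def]
    using h2 nz unfolding o_def by (intro holomorphic_intros h1) auto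
  \<comment> \<open>The accumulation point \<open>- 1\<close> lies inside \<open>sdom\<close>, as
    the identity theorem requires.\<close>
  have lim: "(- of_real 1 :: complex) islimpt ((\<lambda>x. - complex_of_real x) ` {x\<in>\<rat>. x > 0})"
    unfolding islimpt_approachable
  proof (intro allI impI)
    fix e :: real assume "e > 0"
    then obtain q where q: "q \<in> \<rat>" "1 < q" "q < 1 + e" using Rats_dense_in_real[of 1 "1 + e"] by auto
    have "- complex_of_real q - - of_real 1 = of_real (1 - q)" by simp
    hence "dist (- complex_of_real q) (- of_real 1) = \<bar>1 - q\<bar>" unfolding dist_norm by (simp only: norm_of_real)
    thus "\<exists>x'\<in>(\<lambda>x. - complex_of_real x) ` {x \<in> \<rat>. 0 < x}. x' \<noteq> - of_real 1 \<and> dist x' (- of_real 1) < e"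
      using q by (intro bexI[of _ "- complex_of_real q"]) auto
  qed
  have zero: "f v = 0" if "v \<in> (\<lambda>x. - complex_of_real x) ` {x\<in>\<rat>. x > 0}" for v
  proof -
    obtain x where x: "x \<in> \<rat>" "x > 0" "v = - complex_of_real x" using \<open>v \<in> _\<close> by auto
    have "f v = of_real (1 / rst \<mu> x - x - (LINT r|\<nu>. max r 0 / (1 + c * max r 0 * rst \<mu> x)))"
      unfolding f_def x(3) cst_neg_real[OF x(2)] srf_of_real by simp
    thus ?thesis using eq[OF x(1,2)] by simp
  qed
  have "f z = 0"
    by (rule analytic_continuation[OF hol sdom_open sdom_connected _ _ lim zero]) (use z in \<open>auto simp: sdom_def\<close>)
  thus ?thesis unfolding solves_eq_iff[OF \<nu>] stieltjes_eq_cst[OF \<mu>] f_def by simp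
qed

text \<open>With \<open>q s r = r / (1 + c r s)\<close>, the imaginary part of the equation gives \<open>c |s|\<^sup>2 \<integral> |q s|\<^sup>2 d\<nu> < 1\<close> for every
  solution, whereas subtracting the equations of two different solutions gives
  \<open>c s1 s2 \<integral> q s1 q s2 d\<nu> = 1\<close>; this contradicts the Cauchy-Schwarz inequality.\<close>

theorem solves_eq_unique:
  assumes \<nu>: "prob_on_nonneg \<nu>" and c: "c > 0" and z: "Im z > 0"
    and s1: "Im s1 > 0" "solves_eq c \<nu> z s1" and s2: "Im s2 > 0" "solves_eq c \<nu> z s2"
  shows "s1 = s2"
proof (rule ccontr)
  assume ne: "s1 \<noteq> s2"
  interpret real_distribution \<nu> using \<nu> by (rule prob_on_nonneg_rd)
  define q where "q s r = of_real (max r 0) / (1 + of_real c * of_real (max r 0) * s)" for s :: complex and r :: real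
  have den: "1 + of_real c * of_real (max r 0) * s \<noteq> 0" if "Im s > 0" for s r
  proof
    assume 0: "1 + of_real c * of_real (max r 0) * s = 0"
    hence "Im (1 + of_real c * of_real (max r 0) * s) = 0" by simp
    hence "max r 0 = 0" using that c by simp
    thus False using 0 by simp
  qed
  \<comment> \<open>The bound is uniform in \<open>r\<close>, so \<open>q s\<close> and products of
    such functions are integrable whatever the tail of \<nu>.\<close>
  have qb: "cmod (q s r) \<le> 1 / (c * Im s)" if "Im s > 0" for s r
  proof -
    have "c * max r 0 * Im s \<le> cmod (1 + of_real c * of_real (max r 0) * s)"
      using abs_Im_le_cmod[of "1 + of_real c * of_real (max r 0) * s"] by simp
    moreover have "cmod (1 + of_real c * of_real (max r 0) * s) > 0" using den[OF that] by simp
    ultimately show ?thesis using c that unfolding q_def by (simp add: norm_divide field_simps)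
  qed
  have qi: "integrable \<nu> (q s)" if "Im s > 0" for s
    using qb[OF that] by (intro integrable_const_bound[where B = "1 / (c * Im s)"]) (auto simp: q_def[abs_def])
  have qq: "integrable \<nu> (\<lambda>r. q s r * q t r)" if "Im s > 0" "Im t > 0" for s t
  proof (rule integrable_const_bound[where B = "1 / (c * Im s) * (1 / (c * Im t))"])
    show "AE r in \<nu>. norm (q s r * q t r) \<le> 1 / (c * Im s) * (1 / (c * Im t))"
      unfolding norm_mult using qb[OF that(1)] qb[OF that(2)] c that by (intro AE_I2 mult_mono) auto
  qed (auto simp: q_def)
  have q2: "integrable \<nu> (\<lambda>r. (cmod (q s r))\<^sup>2)" if "Im s > 0" for s
    using integrable_norm[OF qq[OF that that]] by (simp add: norm_mult power2_eq_square)
  have eq: "1 / s + z = (LINT r|\<nu>. q s r)" if "solves_eq c \<nu> z s" for s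
    using that unfolding solves_eq_iff[OF \<nu>] srf_def q_def .
  have key: "c * (cmod s)\<^sup>2 * (LINT r|\<nu>. (cmod (q s r))\<^sup>2) < 1" if s: "Im s > 0" and e: "solves_eq c \<nu> z s" for s
  proof -
    have s0: "s \<noteq> 0" using s by auto
    have "Im (q s r) = - c * Im s * (cmod (q s r))\<^sup>2" for r
    proof -
      let ?R = "max r 0" and ?d = "1 + of_real c * of_real (max r 0) * s"
      have "Im (q s r) = - (?R * (c * ?R * Im s)) / (cmod ?d)\<^sup>2"
        unfolding q_def Im_divide cmod_power2 by simp
      moreover have "(cmod (q s r))\<^sup>2 = ?R\<^sup>2 / (cmod ?d)\<^sup>2" unfolding q_def by (simp add: norm_divide power_divide)
      ultimately show ?thesis by (simp add: power2_eq_square)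
    qed
    hence "Im (LINT r|\<nu>. q s r) = - c * Im s * (LINT r|\<nu>. (cmod (q s r))\<^sup>2)"
      using integral_Im[OF qi[OF s]] by simp
    moreover have "Im (1 / s) = - Im s / (cmod s)\<^sup>2" by (simp add: Im_divide cmod_power2)
    ultimately have "Im z = Im s / (cmod s)\<^sup>2 - c * Im s * (LINT r|\<nu>. (cmod (q s r))\<^sup>2)"
      using arg_cong[OF eq[OF e], of Im] by simp
    hence "0 < Im s / (cmod s)\<^sup>2 - c * Im s * (LINT r|\<nu>. (cmod (q s r))\<^sup>2)" using z by simp
    \<comment> \<open>Multiplying the inequality by the positive number
      \<open>(cmod s)\<^sup>2 / Im s\<close> isolates the quantity to be bounded by 1.\<close>
    hence "0 < (Im s / (cmod s)\<^sup>2 - c * Im s * (LINT r|\<nu>. (cmod (q s r))\<^sup>2)) * ((cmod s)\<^sup>2 / Im s)"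
      using s s0 by (intro mult_pos_pos) auto
    also have "\<dots> = 1 - c * (cmod s)\<^sup>2 * (LINT r|\<nu>. (cmod (q s r))\<^sup>2)"
      using s s0 by (simp add: algebra_simps)
    finally show ?thesis by simp
  qed
  have n0: "s1 \<noteq> 0" "s2 \<noteq> 0" using s1 s2 by auto
  have "q s1 r - q s2 r = (of_real c * (s2 - s1)) * (q s1 r * q s2 r)" for r
    using den[OF s1(1), of r] den[OF s2(1), of r] unfolding q_def by (simp add: divide_simps) (simp add: algebra_simps)
  hence "(LINT r|\<nu>. q s1 r - q s2 r) = (of_real c * (s2 - s1)) * (LINT r|\<nu>. q s1 r * q s2 r)" by simp
  hence "(1 / s1 + z) - (1 / s2 + z) = (of_real c * (s2 - s1)) * (LINT r|\<nu>. q s1 r * q s2 r)"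
    using qi[OF s1(1)] qi[OF s2(1)] eq[OF s1(2)] eq[OF s2(2)] by simp
  moreover have "(1 / s1 + z) - (1 / s2 + z) = (s2 - s1) / (s1 * s2)" using n0 by (simp add: field_simps)
  ultimately have "(s2 - s1) * 1 = (s2 - s1) * (of_real c * s1 * s2 * (LINT r|\<nu>. q s1 r * q s2 r))"
    using n0 by (simp add: field_simps)
  hence "1 = of_real c * s1 * s2 * (LINT r|\<nu>. q s1 r * q s2 r)" using ne by (subst (asm) mult_cancel_left) simp
  hence "1 = cmod (of_real c * s1 * s2 * (LINT r|\<nu>. q s1 r * q s2 r))" by (metis norm_one)
  also have "\<dots> = c * cmod s1 * cmod s2 * cmod (LINT r|\<nu>. q s1 r * q s2 r)" using c by (simp add: norm_mult)
  also have "\<dots> \<le> c * cmod s1 * cmod s2 * (LINT r|\<nu>. cmod (q s1 r * q s2 r))"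
    using c by (intro mult_left_mono Bochner_Integration.integral_norm_bound) auto
  also have "\<dots> = c * (LINT r|\<nu>. (cmod s1 * cmod (q s1 r)) * (cmod s2 * cmod (q s2 r)))"
    by (simp add: norm_mult mult_ac)
  \<comment> \<open>Cauchy-Schwarz in the pointwise form \<open>a * b <= (a^2 + b^2) / 2\<close>,
    which is enough because both square integrals obey the same strict bound.\<close>
  also have "\<dots> \<le> c * (LINT r|\<nu>. ((cmod s1)\<^sup>2 * (cmod (q s1 r))\<^sup>2 + (cmod s2)\<^sup>2 * (cmod (q s2 r))\<^sup>2) / 2)"
  proof (intro mult_left_mono integral_mono)
    have "integrable \<nu> (\<lambda>r. cmod (q s1 r * q s2 r))" using qq[OF s1(1) s2(1)] by (rule integrable_norm)
    hence "integrable \<nu> (\<lambda>r. (cmod s1 * cmod s2) * cmod (q s1 r * q s2 r))" by (rule integrable_mult_right)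
    thus "integrable \<nu> (\<lambda>r. (cmod s1 * cmod (q s1 r)) * (cmod s2 * cmod (q s2 r)))" by (simp add: norm_mult mult_ac)
    show "(cmod s1 * cmod (q s1 r)) * (cmod s2 * cmod (q s2 r)) \<le> ((cmod s1)\<^sup>2 * (cmod (q s1 r))\<^sup>2 + (cmod s2)\<^sup>2 * (cmod (q s2 r))\<^sup>2) / 2" for r
      using sum_squares_bound[of "cmod s1 * cmod (q s1 r)" "cmod s2 * cmod (q s2 r)"] by (simp add: power_mult_distrib)
  qed (use q2[OF s1(1)] q2[OF s2(1)] c in auto)
  also have "\<dots> = (c * (cmod s1)\<^sup>2 * (LINT r|\<nu>. (cmod (q s1 r))\<^sup>2) + c * (cmod s2)\<^sup>2 * (LINT r|\<nu>. (cmod (q s2 r))\<^sup>2)) / 2"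
    using q2[OF s1(1)] q2[OF s2(1)] by (simp add: algebra_simps)
  also have "\<dots> < 1" using key[OF s1] key[OF s2] by simp
  finally show False by simp
qed

section \<open>Measurability and empirical measures\<close>

lemma det_measurable:
  fixes A :: "'b \<Rightarrow> real mat"
  assumes c: "\<And>w. A w \<in> carrier_mat n n"
    and m: "\<And>i k. i < n \<Longrightarrow> k < n \<Longrightarrow> (\<lambda>w. A w $$ (i,k)) \<in> borel_measurable M"
  shows "(\<lambda>w. det (A w)) \<in> borel_measurable M"
proof -
  have "det (A w) = (\<Sum>q\<in>{q. q permutes {0..<n}}. signof q * (\<Prod>i = 0..<n. A w $$ (i, q i)))" for w
    by (rule det_def'[OF c])
  moreover have "(\<lambda>w. \<Sum>q\<in>{q. q permutes {0..<n}}. signof q * (\<Prod>i = 0..<n. A w $$ (i, q i))) \<in> borel_measurable M"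
  proof (intro borel_measurable_sum borel_measurable_times borel_measurable_prod borel_measurable_const)
    fix q i assume "q \<in> {q. q permutes {0..<n}}" "i \<in> {0..<n}"
    hence "q i < n" "i < n" using permutes_in_image[of q "{0..<n}" i] by auto
    thus "(\<lambda>w. A w $$ (i, q i)) \<in> borel_measurable M" using m by simp
  qed
  ultimately show ?thesis by simp
qed

lemma resolv_entry_measurable:
  fixes A :: "'b \<Rightarrow> real mat"
  assumes c: "\<And>w. A w \<in> carrier_mat n n"
    and m: "\<And>i k. i < n \<Longrightarrow> k < n \<Longrightarrow> (\<lambda>w. A w $$ (i,k)) \<in> borel_measurable M"
    and ik: "i < n" "k < n"
  shows "(\<lambda>w. resolv x (A w) $$ (i,k)) \<in> borel_measurable M"
proof -
  define B where "B w = A w + x \<cdot>\<^sub>m 1\<^sub>m n" for w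
  have Bc: "B w \<in> carrier_mat n n" for w using c[of w] by (auto simp: B_def)
  have Bm: "(\<lambda>w. B w $$ (i,k)) \<in> borel_measurable M" if "i < n" "k < n" for i k
  proof -
    have "B w $$ (i,k) = A w $$ (i,k) + x * (if i = k then 1 else 0)" for w
      using that c[of w] by (auto simp: B_def)
    thus ?thesis using m[OF that] by simp
  qed
  have Dm: "(\<lambda>w. det (mat_delete (B w) k i)) \<in> borel_measurable M"
  proof (rule det_measurable[where n = "n - 1"])
    show "mat_delete (B w) k i \<in> carrier_mat (n - 1) (n - 1)" for w using Bc by (rule mat_delete_carrier)
    fix a b assume ab: "a < n - 1" "b < n - 1"
    have "mat_delete (B w) k i $$ (a,b) = B w $$ (if a < k then a else Suc a, if b < i then b else Suc b)" for w
      using ab Bc[of w] by (simp add: mat_delete_def)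
    moreover have "(if a < k then a else Suc a) < n" "(if b < i then b else Suc b) < n" using ab by auto
    ultimately show "(\<lambda>w. mat_delete (B w) k i $$ (a,b)) \<in> borel_measurable M" using Bm by simp
  qed
  have "resolv x (A w) $$ (i,k) = inverse (det (B w)) * ((-1) ^ (k + i) * det (mat_delete (B w) k i))" for w
  proof -
    have dr: "dim_row (A w) = n" "dim_row (B w) = n" "dim_col (B w) = n" using c[of w] Bc[of w] by auto
    show ?thesis unfolding resolv_def Let_def dr(1) B_def[symmetric]
      using ik dr by (simp add: adj_mat_def cofactor_def)
  qed
  thus ?thesis using Dm det_measurable[OF Bc Bm] by simp
qed

lemma pow_entry_measurable:
  fixes A :: "'b \<Rightarrow> real mat"
  assumes c: "\<And>w. A w \<in> carrier_mat n n"
    and m: "\<And>i k. i < n \<Longrightarrow> k < n \<Longrightarrow> (\<lambda>w. A w $$ (i,k)) \<in> borel_measurable M"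
  shows "i < n \<Longrightarrow> k < n \<Longrightarrow> (\<lambda>w. (A w ^\<^sub>m j) $$ (i,k)) \<in> borel_measurable M"
proof (induct j arbitrary: i k)
  case 0
  have "dim_row (A w) = n" for w using c[of w] by auto
  then show ?case using 0 by simp
next
  case (Suc j)
  have p: "A w ^\<^sub>m j \<in> carrier_mat n n" for w using c[of w] by (rule pow_carrier_mat)
  have "(A w ^\<^sub>m Suc j) $$ (i,k) = (\<Sum>a<n. (A w ^\<^sub>m j) $$ (i,a) * A w $$ (a,k))" for w
    using mat_mult_entry[OF p[of w] c[of w] Suc(2,3)] by simp
  moreover have "(\<lambda>w. \<Sum>a<n. (A w ^\<^sub>m j) $$ (i,a) * A w $$ (a,k)) \<in> borel_measurable M"
    using Suc by (intro borel_measurable_sum borel_measurable_times Suc(1) m) auto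
  ultimately show ?case by simp
qed

section \<open>Empirical spectral measures\<close>

lemma empirical_measure:
  fixes l :: "nat \<Rightarrow> real"
  assumes p: "p > 0" and l: "\<And>i. i < p \<Longrightarrow> l i \<ge> 0"
  defines "\<rho> \<equiv> distr (measure_pmf (pmf_of_set {..<p})) borel l"
  shows "prob_on_nonneg \<rho>" "cdf \<rho> t = real (card {i. i < p \<and> l i \<le> t}) / real p"
    "rst \<rho> x = (\<Sum>i<p. rker x (l i)) / real p"
proof -
  have ne: "{..<p} \<noteq> {}" using p by auto
  have rd: "real_distribution \<rho>" unfolding \<rho>_def by (rule prob_space.real_distribution_distr[OF measure_pmf.prob_space_axioms]) simp
  have "AE i in measure_pmf (pmf_of_set {..<p}). l i \<ge> 0"
    using ne l by (simp add: AE_measure_pmf_iff)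
  hence "AE t in \<rho>. t \<ge> 0" unfolding \<rho>_def by (subst AE_distr_iff) auto
  thus "prob_on_nonneg \<rho>" by (rule prob_on_nonnegI[OF rd])
  have "cdf \<rho> t = measure (measure_pmf (pmf_of_set {..<p})) {i. l i \<le> t}"
    unfolding cdf_def \<rho>_def by (subst measure_distr) (auto simp: vimage_def)
  also have "\<dots> = real (card ({..<p} \<inter> {i. l i \<le> t})) / real p"
    using ne by (subst measure_pmf_of_set) auto
  also have "{..<p} \<inter> {i. l i \<le> t} = {i. i < p \<and> l i \<le> t}" by auto
  finally show "cdf \<rho> t = real (card {i. i < p \<and> l i \<le> t}) / real p" .
  have "rst \<rho> x = (\<integral>i. rker x (l i) \<partial>measure_pmf (pmf_of_set {..<p}))"
    unfolding rst_def \<rho>_def by (subst integral_distr) auto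
  also have "\<dots> = (\<Sum>i<p. rker x (l i)) / real p"
    using ne by (subst integral_pmf_of_set) auto
  finally show "rst \<rho> x = (\<Sum>i<p. rker x (l i)) / real p" .
qed

text \<open>Realizes the spectral distribution as the distribution function of a probability
  measure, the uniform law on the indices pushed forward by the eigenvalues, so that the results on
  transforms apply to it.\<close>

lemma psd_empirical:
  assumes A: "psd p A" and p: "p > 0"
  obtains \<rho> where "prob_on_nonneg \<rho>" "ESD A = cdf \<rho>" "\<And>x. x > 0 \<Longrightarrow> rst \<rho> x = mat_trace (resolv x A) / real p"
proof -
  obtain U l where U: "orth_mat p U" and "A = conj_diag p U l" and l: "\<And>i. i < p \<Longrightarrow> l i \<ge> 0"
    and E: "\<And>t. ESD A t = real (card {i. i < p \<and> l i \<le> t}) / real p"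
    and R: "\<And>x. x > 0 \<Longrightarrow> resolv x A = conj_diag p U (\<lambda>i. 1 / (l i + x))"
    by (rule psd_spectral[OF A]) (rule that)
  let ?\<rho> = "distr (measure_pmf (pmf_of_set {..<p})) borel l"
  have r: "rst ?\<rho> x = mat_trace (resolv x A) / real p" if "x > 0" for x
  proof -
    have "rst ?\<rho> x = (\<Sum>i<p. rker x (l i)) / real p" by (rule empirical_measure(3)[OF p l])
    moreover have "(\<Sum>i<p. rker x (l i)) = (\<Sum>i<p. 1 / (l i + x))"
      by (intro sum.cong refl) (use l in \<open>auto simp: rker_def\<close>)
    ultimately show ?thesis unfolding R[OF that] mat_trace_conj_diag[OF U] by simp
  qed
  have "ESD A = cdf ?\<rho>" by (rule ext) (simp only: empirical_measure(2)[where l = l, OF p l] E)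
  from that[OF empirical_measure(1)[where l = l, OF p l] this r] show ?thesis .
qed

lemma psd_resolv_pow_trace:
  assumes A: "psd p A"
  obtains l where "\<And>i. i < p \<Longrightarrow> l i \<ge> 0" "\<And>t. ESD A t = real (card {i. i < p \<and> l i \<le> t}) / real p"
    "\<And>k. mat_trace (resolv 1 A ^\<^sub>m k) = (\<Sum>i<p. rker 1 (l i) ^ k)"
proof -
  obtain U l where U: "orth_mat p U" and "A = conj_diag p U l" and l: "\<And>i. i < p \<Longrightarrow> l i \<ge> 0"
    and E: "\<And>t. ESD A t = real (card {i. i < p \<and> l i \<le> t}) / real p"
    and R: "\<And>x. x > 0 \<Longrightarrow> resolv x A = conj_diag p U (\<lambda>i. 1 / (l i + x))"
    by (rule psd_spectral[OF A]) (rule that)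
  have R1: "resolv 1 A = conj_diag p U (\<lambda>i. 1 / (l i + 1))" by (rule R) simp
  have "mat_trace (resolv 1 A ^\<^sub>m k) = (\<Sum>i<p. rker 1 (l i) ^ k)" for k
    unfolding R1 conj_diag_pow[OF U] mat_trace_conj_diag[OF U]
    using l by (intro sum.cong) (auto simp: rker_def)
  from that[OF l E this] show ?thesis .
qed

text \<open>No measurable choice of eigenvalues is made. For \<open>t >= 0\<close> the counting
  function is a pointwise limit of polynomials in \<open>(A + 1)^-1\<close> under the trace, and
  traces of powers of this resolvent are measurable because its entries are; for
  \<open>t < 0\<close> it is zero.\<close>

lemma ESD_measurable:
  fixes A :: "'b \<Rightarrow> real mat"
  assumes psd: "\<And>w. psd p (A w)"
    and m: "\<And>i k. i < p \<Longrightarrow> k < p \<Longrightarrow> (\<lambda>w. A w $$ (i,k)) \<in> borel_measurable M"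
  shows "(\<lambda>w. ESD (A w) t) \<in> borel_measurable M"
proof (cases "t \<ge> 0")
  case False
  have "ESD (A w) t = 0" for w
  proof -
    show ?thesis
    proof (rule psd_resolv_pow_trace[OF psd[of w]])
      fix l :: "nat \<Rightarrow> real"
      assume l: "\<And>i. i < p \<Longrightarrow> l i \<ge> 0" and E: "\<And>t. ESD (A w) t = real (card {i. i < p \<and> l i \<le> t}) / real p"
      have "\<not> l i \<le> t" if "i < p" for i using l[OF that] False by linarith
      hence "{i. i < p \<and> l i \<le> t} = {}" by blast
      thus "ESD (A w) t = 0" unfolding E by simp
    qed
  qed
  thus ?thesis by simp
next
  case True
  obtain a :: "nat \<Rightarrow> nat \<Rightarrow> real" and d where
    ad: "\<And>y. y \<in> {0..1} \<Longrightarrow> (\<lambda>m. \<Sum>i\<le>d m. a m i * y ^ i) \<longlonglongrightarrow> (if 1 / (1 + t) \<le> y then 1 else 0)"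
    "\<And>y m. y \<in> {0..1} \<Longrightarrow> \<bar>\<Sum>i\<le>d m. a m i * y ^ i\<bar> \<le> 2"
    using step_function_limit_of_polynomials[of "1 / (1 + t)"] by blast
  have c: "A w \<in> carrier_mat p p" for w using psd[of w] unfolding psd_def by auto
  have R: "resolv 1 (A w) \<in> carrier_mat p p" for w by (rule resolv_carrier[OF psd]) simp
  have tm: "(\<lambda>w. mat_trace (resolv 1 (A w) ^\<^sub>m j)) \<in> borel_measurable M" for j
  proof -
    have "dim_row (resolv 1 (A w) ^\<^sub>m j) = p" for w using pow_carrier_mat[OF R[of w], of j] by auto
    thus ?thesis unfolding mat_trace_def
      by simp (intro borel_measurable_sum pow_entry_measurable[OF R] resolv_entry_measurable[OF c m], auto)
  qed
  show ?thesis
  proof (rule borel_measurable_LIMSEQ_real)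
    show "(\<lambda>w. (\<Sum>j\<le>d n. a n j * mat_trace (resolv 1 (A w) ^\<^sub>m j)) / real p) \<in> borel_measurable M" for n
      using tm by (intro borel_measurable_divide borel_measurable_sum borel_measurable_times) auto
    fix w
    obtain l where l: "\<And>i. i < p \<Longrightarrow> l i \<ge> 0" and E: "\<And>t. ESD (A w) t = real (card {i. i < p \<and> l i \<le> t}) / real p"
      and T: "\<And>k. mat_trace (resolv 1 (A w) ^\<^sub>m k) = (\<Sum>i<p. rker 1 (l i) ^ k)"
      by (rule psd_resolv_pow_trace[OF psd[of w]]) (rule that)
    have b: "rker 1 s \<in> {0..1}" for s using rker_bounds[of 1 s] by auto
    have "(\<lambda>n. (\<Sum>i<p. \<Sum>j\<le>d n. a n j * rker 1 (l i) ^ j) / real p) \<longlonglongrightarrow> (\<Sum>i<p. if 1 / (1 + t) \<le> rker 1 (l i) then 1 else 0) / real p"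
      by (cases "p = 0") (auto intro!: tendsto_divide tendsto_sum ad(1)[OF b])
    moreover have "(\<Sum>i<p. \<Sum>j\<le>d n. a n j * rker 1 (l i) ^ j) = (\<Sum>j\<le>d n. a n j * mat_trace (resolv 1 (A w) ^\<^sub>m j))" for n
      unfolding T sum_distrib_left by (rule sum.swap)
    moreover have "(\<Sum>i<p. if 1 / (1 + t) \<le> rker 1 (l i) then 1 else 0) = real (card {i. i < p \<and> l i \<le> t})"
      unfolding rker_le_iff[OF True] by (simp add: sum.If_cases Int_def)
    ultimately show "(\<lambda>n. (\<Sum>j\<le>d n. a n j * mat_trace (resolv 1 (A w) ^\<^sub>m j)) / real p) \<longlonglongrightarrow> ESD (A w) t"
      unfolding E by simp
  qed
qed

text \<open>Makes the condition countable. The set of admissible \<open>e\<close> is closed upwards,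
  so a rational one can be found below \<open>a\<close>; and inequalities at rational points pass to
  any real point by approaching it from the right, where distribution functions are
  continuous.\<close>

lemma levy_dist_less_iff:
  assumes "real_distribution \<rho>" "real_distribution \<mu>"
  shows "levy_dist (cdf \<rho>) (cdf \<mu>) < a \<longleftrightarrow> (\<exists>e\<in>\<rat>. 0 < e \<and> e < a \<and>
    (\<forall>x\<in>\<rat>. cdf \<rho> (x - e) - e \<le> cdf \<mu> x \<and> cdf \<mu> x \<le> cdf \<rho> (x + e) + e))"
proof -
  interpret R: real_distribution \<rho> by fact
  interpret M: real_distribution \<mu> by fact
  let ?F = "cdf \<rho>" and ?G = "cdf \<mu>"
  let ?S = "{e. e > 0 \<and> (\<forall>x. ?F (x - e) - e \<le> ?G x \<and> ?G x \<le> ?F (x + e) + e)}"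
  have F01: "0 \<le> ?F x" "?F x \<le> 1" "0 \<le> ?G x" "?G x \<le> 1" for x
    by (auto intro: R.cdf_nonneg R.cdf_bounded_prob M.cdf_nonneg M.cdf_bounded_prob)
  have "?F (x - 1) - 1 \<le> ?G x \<and> ?G x \<le> ?F (x + 1) + 1" for x
    using F01[of x] F01[of "x - 1"] F01[of "x + 1"] by linarith
  hence "1 \<in> ?S" by (intro CollectI conjI allI) auto
  hence ne: "?S \<noteq> {}" by blast
  have bdd: "bdd_below ?S" by (intro bdd_belowI[of _ 0]) auto
  have up: "e' \<in> ?S" if "e \<in> ?S" "e < e'" for e e'
  proof -
    have "?F (x - e') - e' \<le> ?G x \<and> ?G x \<le> ?F (x + e') + e'" for x
    proof -
      have "?F (x - e') \<le> ?F (x - e)" "?F (x + e) \<le> ?F (x + e')" using that by (auto intro: R.cdf_nondecreasing)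
      moreover have "?F (x - e) - e \<le> ?G x" "?G x \<le> ?F (x + e) + e" using that(1) by auto
      ultimately show ?thesis using that(2) by linarith
    qed
    thus ?thesis using that by auto
  qed
  have rat: "e \<in> ?S" if e: "e > 0" and x: "\<And>x. x \<in> \<rat> \<Longrightarrow> ?F (x - e) - e \<le> ?G x \<and> ?G x \<le> ?F (x + e) + e" for e
  proof -
    have "?F (y - e) - e \<le> ?G y \<and> ?G y \<le> ?F (y + e) + e" for y
    proof -
      have "\<exists>q\<in>\<rat>. y < q \<and> q < y + 1 / real (Suc n)" for n using Rats_dense_in_real[of y "y + 1 / real (Suc n)"] by auto
      then obtain q where q: "\<And>n. q n \<in> \<rat>" "\<And>n. y < q n" "\<And>n. q n < y + 1 / real (Suc n)" by metis
      have lim: "q \<longlonglongrightarrow> y"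
      proof (rule tendsto_sandwich[of "\<lambda>_. y" _ _ "\<lambda>n. y + 1 / real (Suc n)"])
        show "(\<lambda>n. y + 1 / real (Suc n)) \<longlonglongrightarrow> y"
          using tendsto_add[OF tendsto_const[of y] LIMSEQ_inverse_real_of_nat] by (simp add: inverse_eq_divide)
      qed (use q in \<open>auto intro!: always_eventually less_imp_le\<close>)
      have rc: "(\<lambda>n. cdf \<kappa> (q n + b)) \<longlonglongrightarrow> cdf \<kappa> (y + b)" if "real_distribution \<kappa>" for \<kappa> b
      proof -
        interpret K: real_distribution \<kappa> by fact
        have "(cdf \<kappa> \<longlongrightarrow> cdf \<kappa> (y + b)) (at_right (y + b))"
          using K.cdf_is_right_cont[of "y + b"] by (simp add: continuous_within)
        moreover have "filterlim (\<lambda>n. q n + b) (at_right (y + b)) sequentially"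
          unfolding filterlim_at using tendsto_add[OF lim tendsto_const[of b]] q(2) by (auto intro!: always_eventually simp: less_imp_neq[symmetric])
        ultimately show ?thesis by (rule filterlim_compose)
      qed
      have "?F (y - e) - e \<le> ?G y"
      proof (rule LIMSEQ_le)
        show "(\<lambda>n. ?F (q n - e) - e) \<longlonglongrightarrow> ?F (y - e) - e" using tendsto_diff[OF rc[OF assms(1), of "- e"] tendsto_const] by simp
        show "(\<lambda>n. ?G (q n)) \<longlonglongrightarrow> ?G y" using rc[OF assms(2), of 0] by simp
      qed (use x[OF q(1)] in auto)
      moreover have "?G y \<le> ?F (y + e) + e"
      proof (rule LIMSEQ_le)
        show "(\<lambda>n. ?F (q n + e) + e) \<longlonglongrightarrow> ?F (y + e) + e" using tendsto_add[OF rc[OF assms(1), of e] tendsto_const] by simp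
        show "(\<lambda>n. ?G (q n)) \<longlonglongrightarrow> ?G y" using rc[OF assms(2), of 0] by simp
      qed (use x[OF q(1)] in auto)
      ultimately show ?thesis by simp
    qed
    thus ?thesis using e by auto
  qed
  show ?thesis
  proof
    assume "levy_dist ?F ?G < a"
    then obtain e where e: "e \<in> ?S" "e < a" unfolding levy_dist_def cInf_less_iff[OF ne bdd] by blast
    obtain r where r: "r \<in> \<rat>" "e < r" "r < a" using Rats_dense_in_real[OF e(2)] by auto
    have "r \<in> ?S" using up[OF e(1) r(2)] .
    thus "\<exists>e\<in>\<rat>. 0 < e \<and> e < a \<and> (\<forall>x\<in>\<rat>. ?F (x - e) - e \<le> ?G x \<and> ?G x \<le> ?F (x + e) + e)" using r by auto
  next
    assume "\<exists>e\<in>\<rat>. 0 < e \<and> e < a \<and> (\<forall>x\<in>\<rat>. ?F (x - e) - e \<le> ?G x \<and> ?G x \<le> ?F (x + e) + e)"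
    then obtain e where e: "e > 0" "e < a" "\<forall>x\<in>\<rat>. ?F (x - e) - e \<le> ?G x \<and> ?G x \<le> ?F (x + e) + e" by blast
    have "e \<in> ?S" by (rule rat[OF e(1) e(3)[rule_format]])
    thus "levy_dist ?F ?G < a" unfolding levy_dist_def cInf_less_iff[OF ne bdd] using e(2) by blast
  qed
qed

lemma levy_dist_measurable:
  assumes rd: "\<And>w. real_distribution (\<rho> w)" "real_distribution \<mu>"
    and m[measurable]: "\<And>t. (\<lambda>w. cdf (\<rho> w) t) \<in> borel_measurable M"
  shows "(\<lambda>w. levy_dist (cdf (\<rho> w)) (cdf \<mu>)) \<in> borel_measurable M"
proof (rule borel_measurable_iff_less[THEN iffD2], rule allI)
  fix a
  have "{w \<in> space M. levy_dist (cdf (\<rho> w)) (cdf \<mu>) < a} =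
    {w \<in> space M. \<exists>e\<in>\<rat>. 0 < e \<and> e < a \<and> (\<forall>x\<in>\<rat>. cdf (\<rho> w) (x - e) - e \<le> cdf \<mu> x \<and> cdf \<mu> x \<le> cdf (\<rho> w) (x + e) + e)}"
    unfolding levy_dist_less_iff[OF rd] ..
  also have "\<dots> \<in> sets M"
    by (intro sets.sets_Collect_countable_Ex' sets.sets_Collect_countable_All' sets.sets_Collect_conj
        sets.sets_Collect_const countable_rat) measurable
  finally show "{w \<in> space M. levy_dist (cdf (\<rho> w)) (cdf \<mu>) < a} \<in> sets M" .
qed

lemma sample_cov_entry_measurable:
  assumes "\<And>j i. j < N \<Longrightarrow> i < p \<Longrightarrow> (\<lambda>w. Y w j i) \<in> borel_measurable M" "i < p" "k < p"
  shows "(\<lambda>w. sample_cov p N (Y w) $$ (i,k)) \<in> borel_measurable M"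
proof -
  have "(\<lambda>w. (1 / real N) * (\<Sum>j<N. Y w j i * Y w j k)) \<in> borel_measurable M"
    using assms by (intro borel_measurable_times borel_measurable_const borel_measurable_sum) auto
  thus ?thesis using assms(2,3) by (simp add: sample_cov_def)
qed

section \<open>The leave-one-out estimate in fixed dimension\<close>

text \<open>The saturation produced by the rank-one formula. On the half-line it is increasing,
  bounded by 1 and 1-Lipschitz, so differences are controlled by \<open>min 1 |a - b|\<close>, which
  is integrable under any law.\<close>

definition hfun :: "real \<Rightarrow> real" where "hfun u = u / (1 + u)"

lemma hfun_bounds: "u \<ge> 0 \<Longrightarrow> 0 \<le> hfun u" "u \<ge> 0 \<Longrightarrow> hfun u \<le> 1"
  by (auto simp: hfun_def)

lemma hfun_mono: assumes "0 \<le> a" "a \<le> b" shows "hfun a \<le> hfun b"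
  using assms by (simp add: hfun_def frac_le_eq divide_nonpos_nonneg algebra_simps)

lemma hfun_diff:
  assumes "0 \<le> a" "0 \<le> b" shows "\<bar>hfun a - hfun b\<bar> \<le> min 1 \<bar>a - b\<bar>"
proof -
  have "\<bar>hfun a - hfun b\<bar> \<le> 1" using hfun_bounds[of a] hfun_bounds[of b] assms by linarith
  moreover have "\<bar>hfun a - hfun b\<bar> \<le> \<bar>a - b\<bar>"
  proof -
    have e: "hfun a - hfun b = (a - b) / ((1 + a) * (1 + b))" using assms by (simp add: hfun_def field_simps)
    have "1 \<le> (1 + a) * (1 + b)" using assms mult_mono[of 1 "1 + a" 1 "1 + b"] by simp
    hence "\<bar>a - b\<bar> / ((1 + a) * (1 + b)) \<le> \<bar>a - b\<bar> / 1" by (intro divide_left_mono) auto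
    moreover have "\<bar>hfun a - hfun b\<bar> = \<bar>a - b\<bar> / ((1 + a) * (1 + b))" unfolding e using assms by (simp add: abs_mult)
    ultimately show ?thesis by simp
  qed
  ultimately show ?thesis by simp
qed

lemma hfun_measurable [measurable]: "hfun \<in> borel_measurable borel"
  unfolding hfun_def by measurable

lemma norm_ratio_nonneg: "norm_ratio p v \<ge> 0"
  by (auto simp: norm_ratio_def intro!: divide_nonneg_nonneg sum_nonneg)

text \<open>\<open>D\<close> is the law of one sample, and everything takes place on the product
  space; the given random vectors enter later through their joint law only.\<close>

locale iid_sample =
  fixes p N :: nat and D :: "(nat \<Rightarrow> real) measure"
  assumes p0: "p > 0" and N0: "N > 0" and prob_D: "prob_space D" and sets_D: "sets D = sets (rvec p)"
begin

sublocale D: prob_space D by (rule prob_D)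

abbreviation "PN \<equiv> Pi\<^sub>M {..<N} (\<lambda>_. D)"

lemma prob_PN: "prob_space PN" by (intro prob_space_PiM prob_D)

sublocale PN: prob_space PN by (rule prob_PN)

lemma coord_measurable: "i < p \<Longrightarrow> (\<lambda>v. v i) \<in> borel_measurable D"
  unfolding measurable_cong_sets[OF sets_D refl] by (rule measurable_component_singleton) simp

lemma comp_measurable: "j < N \<Longrightarrow> (\<lambda>w. w j) \<in> measurable PN D"
  by (rule measurable_component_singleton) simp

lemma entry_measurable: "j < N \<Longrightarrow> i < p \<Longrightarrow> (\<lambda>w. w j i) \<in> borel_measurable PN"
  by (rule measurable_compose[OF comp_measurable coord_measurable])

lemma norm_ratio_measurable: "norm_ratio p \<in> borel_measurable D"
  unfolding norm_ratio_def[abs_def] using coord_measurable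
  by (intro borel_measurable_divide borel_measurable_sum borel_measurable_power borel_measurable_const) auto

lemma qform_measurable:
  assumes "A \<in> carrier_mat p p" shows "qform p A \<in> borel_measurable D"
  unfolding qform_sum[OF assms] using coord_measurable
  by (intro borel_measurable_sum borel_measurable_times borel_measurable_const) auto

text \<open>The mean saturation once the quadratic form has been replaced by the norm ratio times
  \<open>u\<close>; here \<open>u\<close> stands for the trace of the resolvent divided by
  \<open>N\<close>.\<close>

definition Hn :: "real \<Rightarrow> real" where "Hn u = (\<integral>v. hfun (norm_ratio p v * u) \<partial>D)"
text \<open>A modulus of continuity for \<open>Hn\<close>: the truncation at 1 replaces a first
  moment of the norm ratio.\<close>

definition \<theta> :: "real \<Rightarrow> real" where "\<theta> \<eta> = (\<integral>v. min 1 (norm_ratio p v * \<eta>) \<partial>D)"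

lemma Hn_integrable: "u \<ge> 0 \<Longrightarrow> integrable D (\<lambda>v. hfun (norm_ratio p v * u))"
  using norm_ratio_measurable hfun_bounds norm_ratio_nonneg
  by (intro D.integrable_const_bound[where B = 1]) auto

lemma \<theta>_integrable: "u \<ge> 0 \<Longrightarrow> integrable D (\<lambda>v. min 1 (norm_ratio p v * u))"
  using norm_ratio_measurable norm_ratio_nonneg
  by (intro D.integrable_const_bound[where B = 1]) auto

lemma Hn_mono: "0 \<le> a \<Longrightarrow> a \<le> b \<Longrightarrow> Hn a \<le> Hn b"
  unfolding Hn_def using norm_ratio_nonneg
  by (intro integral_mono Hn_integrable hfun_mono mult_left_mono) auto

lemma Hn_diff:
  assumes "0 \<le> a" "0 \<le> b" shows "\<bar>Hn a - Hn b\<bar> \<le> \<theta> \<bar>a - b\<bar>"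
proof -
  have "\<bar>Hn a - Hn b\<bar> = \<bar>\<integral>v. hfun (norm_ratio p v * a) - hfun (norm_ratio p v * b) \<partial>D\<bar>"
    unfolding Hn_def using Hn_integrable assms by simp
  also have "\<dots> \<le> (\<integral>v. \<bar>hfun (norm_ratio p v * a) - hfun (norm_ratio p v * b)\<bar> \<partial>D)"
    by (rule integral_abs_bound)
  also have "\<dots> \<le> \<theta> \<bar>a - b\<bar>" unfolding \<theta>_def
  proof (rule integral_mono)
    show "integrable D (\<lambda>v. \<bar>hfun (norm_ratio p v * a) - hfun (norm_ratio p v * b)\<bar>)"
      using Hn_integrable assms by (intro integrable_abs Bochner_Integration.integrable_diff) auto
    show "integrable D (\<lambda>v. min 1 (norm_ratio p v * \<bar>a - b\<bar>))" by (rule \<theta>_integrable) simp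
    fix v
    have "norm_ratio p v * a - norm_ratio p v * b = norm_ratio p v * (a - b)" by (simp add: algebra_simps)
    thus "\<bar>hfun (norm_ratio p v * a) - hfun (norm_ratio p v * b)\<bar> \<le> min 1 (norm_ratio p v * \<bar>a - b\<bar>)"
      using hfun_diff[of "norm_ratio p v * a" "norm_ratio p v * b"] norm_ratio_nonneg[of p v] assms
      by (simp add: abs_mult)
  qed
  finally show ?thesis .
qed

lemma \<theta>_mono: "0 \<le> a \<Longrightarrow> a \<le> b \<Longrightarrow> \<theta> a \<le> \<theta> b"
  unfolding \<theta>_def using norm_ratio_nonneg
  by (intro integral_mono \<theta>_integrable min.mono mult_left_mono) auto

lemma fubini_coord:
  fixes f :: "(nat \<Rightarrow> nat \<Rightarrow> real) \<Rightarrow> real"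
  assumes j: "j < N" and f: "integrable PN f"
  shows "integral\<^sup>L PN f = (\<integral>w. (\<integral>v. f (w(j := v)) \<partial>D) \<partial>Pi\<^sub>M ({..<N} - {j}) (\<lambda>_. D))"
proof -
  interpret product_sigma_finite "\<lambda>_. D"
    using prob_D by (simp add: product_sigma_finite_def prob_space_imp_sigma_finite)
  have e: "insert j ({..<N} - {j}) = {..<N}" using j by auto
  show ?thesis
    using product_integral_insert[of "{..<N} - {j}" j f] f unfolding e by simp
qed

lemma marginal:
  fixes f :: "(nat \<Rightarrow> real) \<Rightarrow> real"
  assumes j: "j < N" and f: "f \<in> borel_measurable D" and b: "\<And>v. \<bar>f v\<bar> \<le> B"
  shows "(\<integral>w. f (w j) \<partial>PN) = integral\<^sup>L D f"
proof -
  interpret P: prob_space "Pi\<^sub>M ({..<N} - {j}) (\<lambda>_. D)" by (intro prob_space_PiM prob_D)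
  have "integrable PN (\<lambda>w. f (w j))"
    using b measurable_compose[OF comp_measurable[OF j] f] by (intro PN.integrable_const_bound[where B = B]) auto
  from fubini_coord[OF j this] show ?thesis by (simp add: P.prob_space)
qed

end

section \<open>Traces of resolvents under the product law\<close>

locale iid_sample_resolv = iid_sample + fixes x :: real assumes x0: "x > 0"
begin

definition "T w = mat_trace (resolv x (sample_cov p N w))"
text \<open>Independent of the \<open>j\<close>-th coordinate of \<open>w\<close>, hence constant in
  the inner integral when Fubini is applied to that coordinate.\<close>

definition "G j w = resolv x (sample_cov p N (w(j := (\<lambda>_. 0))))"

lemma T_measurable: "T \<in> borel_measurable PN"
proof -
  have c: "sample_cov p N w \<in> carrier_mat p p" for w by (auto simp: sample_cov_def)
  have "dim_row (resolv x (sample_cov p N w)) = p" for w using resolv_carrier[OF psd_sample_cov x0, of p N w] by auto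
  thus ?thesis unfolding T_def[abs_def] mat_trace_def
    by simp (intro borel_measurable_sum resolv_entry_measurable[OF c sample_cov_entry_measurable] entry_measurable, auto)
qed

lemma G_carrier: "G j w \<in> carrier_mat p p" unfolding G_def by (rule resolv_carrier[OF psd_sample_cov x0])

lemma G_entry_measurable:
  assumes "i < p" "k < p" shows "(\<lambda>w. G j w $$ (i,k)) \<in> borel_measurable PN"
proof -
  have c: "sample_cov p N w \<in> carrier_mat p p" for w by (auto simp: sample_cov_def)
  have "(\<lambda>w. (w(j := (\<lambda>_. 0))) m a) \<in> borel_measurable PN" if "m < N" "a < p" for m a
    using entry_measurable[OF that] by (cases "m = j") auto
  thus ?thesis unfolding G_def using assms
    by (intro resolv_entry_measurable[OF c sample_cov_entry_measurable]) auto
qed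

lemma trG_measurable: "(\<lambda>w. mat_trace (G j w)) \<in> borel_measurable PN"
proof -
  have "dim_row (G j w) = p" for w using G_carrier[of j w] by auto
  thus ?thesis unfolding mat_trace_def by simp (intro borel_measurable_sum G_entry_measurable, auto)
qed

lemma qG_measurable: "j < N \<Longrightarrow> (\<lambda>w. qform p (G j w) (w j)) \<in> borel_measurable PN"
  unfolding qform_sum[OF G_carrier]
  by (intro borel_measurable_sum borel_measurable_times G_entry_measurable entry_measurable) auto

lemma T_bounds: "0 \<le> T w" "T w \<le> real p / x"
  unfolding T_def using trace_resolv_bounds[OF psd_sample_cov x0] by auto

lemma trG_nonneg: "0 \<le> mat_trace (G j w)"
  unfolding G_def using trace_resolv_bounds[OF psd_sample_cov x0] by auto

lemma T_G: "j < N \<Longrightarrow> \<bar>T w - mat_trace (G j w)\<bar> \<le> 1 / x"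
  unfolding T_def G_def by (rule loo_trace[OF _ N0 x0])

lemma qG_nonneg: "j < N \<Longrightarrow> 0 \<le> qform p (G j w) (w j) / real N"
  unfolding G_def by (rule loo_nonneg[OF _ N0 x0])

lemma G_upd: "G j (w(j := v)) = G j w" unfolding G_def by simp

text \<open>Before and after the change, the trace is within \<open>1 / x\<close> of the same
  leave-one-out trace.\<close>

lemma T_bounded_difference: "j < N \<Longrightarrow> \<bar>T (w(j := v)) - T w\<bar> \<le> 2 / x"
  using T_G[of j "w(j := v)"] T_G[of j w] unfolding G_upd by (simp add: field_simps abs_le_iff)

lemma T_integrable: "integrable PN T"
  using T_bounds T_measurable by (intro PN.integrable_const_bound[where B = "real p / x"]) auto

lemma ET_bounds: "0 \<le> integral\<^sup>L PN T" "integral\<^sup>L PN T \<le> real p / x"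
proof -
  show "0 \<le> integral\<^sup>L PN T" using T_bounds by (intro integral_nonneg_AE) auto
  have "integral\<^sup>L PN T \<le> (\<integral>w. real p / x \<partial>PN)" using T_bounds T_integrable by (intro integral_mono) auto
  thus "integral\<^sup>L PN T \<le> real p / x" by (simp add: PN.prob_space)
qed

lemma T_tail:
  assumes "e > 0"
  shows "measure PN {w \<in> space PN. \<bar>T w - integral\<^sup>L PN T\<bar> \<ge> e} \<le> 2 * exp (- (e\<^sup>2 * x\<^sup>2 / (8 * real N)))"
proof -
  have "measure PN {w \<in> space PN. \<bar>T w - integral\<^sup>L PN T\<bar> \<ge> e} \<le> 2 * exp (- (e\<^sup>2 / (2 * real (card {..<N}) * (2 / x)\<^sup>2)))"
    using N0 x0 assms T_bounds T_bounded_difference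
    by (intro bounded_difference_tail[OF prob_D _ _ _ _ T_measurable, where B = "real p / x"]) (auto simp: abs_of_nonneg)
  also have "e\<^sup>2 / (2 * real (card {..<N}) * (2 / x)\<^sup>2) = e\<^sup>2 * x\<^sup>2 / (8 * real N)"
    by (simp add: power2_eq_square)
  finally show ?thesis .
qed

lemma G_spectral:
  obtains U l where "orth_mat p U" "G j w = conj_diag p U l" "\<And>i. i < p \<Longrightarrow> 0 \<le> l i \<and> l i \<le> 1 / x"
proof (rule psd_resolv[OF psd_sample_cov x0, of p N "w(j := (\<lambda>_. 0))"])
  fix U and l :: "nat \<Rightarrow> real"
  assume U: "orth_mat p U" and l: "\<And>i. i < p \<Longrightarrow> 0 \<le> l i"
    and G: "resolv x (sample_cov p N (w(j := (\<lambda>_. 0)))) = conj_diag p U (\<lambda>i. 1 / (l i + x))"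
  have "0 \<le> 1 / (l i + x) \<and> 1 / (l i + x) \<le> 1 / x" if "i < p" for i
    using l[OF that] x0 by (auto intro!: frac_le)
  thus thesis by (rule that[OF U G[folded G_def]])
qed

text \<open>Two replacements. From \<open>?a\<close> to \<open>?b\<close>, the quadratic form
  becomes a trace: with the other samples frozen, \<open>G j w\<close> is a fixed matrix with
  spectrum in \<open>[0, 1 / x]\<close>, so the cost is \<delta>. From \<open>?b\<close> to
  \<open>?c\<close>, this trace becomes the mean trace: off the event \<open>?B\<close> the two
  differ by at most \<open>N * \<eta>\<close>, half from concentration and half from removing the
  sample, which costs \<open>\<theta> \<eta>\<close>; on \<open>?B\<close> the difference is at most
  1.\<close>

lemma leave_one_out_fixed_point:
  assumes j: "j < N"
    and \<delta>: "\<And>U l. orth_mat p U \<Longrightarrow> (\<And>i. i < p \<Longrightarrow> 0 \<le> l i \<and> l i \<le> 1 / x) \<Longrightarrow>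
      (\<integral>v. \<bar>hfun (qform p (conj_diag p U l) v / real N) - hfun (norm_ratio p v * (mat_trace (conj_diag p U l) / real N))\<bar> \<partial>D) \<le> \<delta>"
    and \<eta>: "\<eta> > 0" "1 / (x * real N) \<le> \<eta> / 2"
  shows "\<bar>(\<integral>w. hfun (qform p (G j w) (w j) / real N) \<partial>PN) - Hn (integral\<^sup>L PN T / real N)\<bar>
    \<le> \<delta> + \<theta> \<eta> + measure PN {w \<in> space PN. \<bar>T w - integral\<^sup>L PN T\<bar> \<ge> real N * \<eta> / 2}"
proof -
  define ET where "ET = integral\<^sup>L PN T"
  let ?a = "\<lambda>w. hfun (qform p (G j w) (w j) / real N)"
  let ?b = "\<lambda>w. hfun (norm_ratio p (w j) * (mat_trace (G j w) / real N))"
  let ?c = "\<lambda>w. hfun (norm_ratio p (w j) * (ET / real N))"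
  let ?B = "{w \<in> space PN. \<bar>T w - ET\<bar> \<ge> real N * \<eta> / 2}"
  note [measurable] = qG_measurable[OF j] trG_measurable T_measurable
    measurable_compose[OF comp_measurable[OF j] norm_ratio_measurable]
  have an: "0 \<le> qform p (G j w) (w j) / real N" for w by (rule qG_nonneg[OF j])
  have bn: "0 \<le> norm_ratio p v * (mat_trace (G j w) / real N)" for v w
    using norm_ratio_nonneg trG_nonneg by (intro mult_nonneg_nonneg divide_nonneg_nonneg) auto
  have cn: "0 \<le> norm_ratio p v * (ET / real N)" for v
    using norm_ratio_nonneg ET_bounds unfolding ET_def by (intro mult_nonneg_nonneg divide_nonneg_nonneg) auto
  have ai: "integrable PN ?a" using hfun_bounds an by (intro PN.integrable_const_bound[where B = 1]) auto
  have bi: "integrable PN ?b" using hfun_bounds bn by (intro PN.integrable_const_bound[where B = 1]) auto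
  have ci: "integrable PN ?c" using hfun_bounds cn by (intro PN.integrable_const_bound[where B = 1]) auto
  interpret P: prob_space "Pi\<^sub>M ({..<N} - {j}) (\<lambda>_. D)" by (intro prob_space_PiM prob_D)
  have 1: "(\<integral>w. \<bar>?a w - ?b w\<bar> \<partial>PN) \<le> \<delta>"
  proof -
    have d0: "(\<integral>v. \<bar>hfun (qform p (G j w) v / real N) - hfun (norm_ratio p v * (mat_trace (G j w) / real N))\<bar> \<partial>D) \<le> \<delta>" for w
    proof (rule G_spectral[of j w])
      fix U and l :: "nat \<Rightarrow> real"
      assume U: "orth_mat p U" and G: "G j w = conj_diag p U l" and l: "\<And>i. i < p \<Longrightarrow> 0 \<le> l i \<and> l i \<le> 1 / x"
      show ?thesis unfolding G by (rule \<delta>[OF U l])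
    qed
    have "(\<integral>w. \<bar>?a w - ?b w\<bar> \<partial>PN) = (\<integral>w. (\<integral>v. \<bar>?a (w(j := v)) - ?b (w(j := v))\<bar> \<partial>D) \<partial>Pi\<^sub>M ({..<N} - {j}) (\<lambda>_. D))"
      by (rule fubini_coord[OF j]) (intro integrable_abs Bochner_Integration.integrable_diff ai bi)
    also have "\<dots> = (\<integral>w. (\<integral>v. \<bar>hfun (qform p (G j w) v / real N) - hfun (norm_ratio p v * (mat_trace (G j w) / real N))\<bar> \<partial>D) \<partial>Pi\<^sub>M ({..<N} - {j}) (\<lambda>_. D))"
      unfolding G_upd by simp
    also have "\<dots> \<le> \<delta>"
    proof -
      let ?I = "\<lambda>w. (\<integral>v. \<bar>hfun (qform p (G j w) v / real N) - hfun (norm_ratio p v * (mat_trace (G j w) / real N))\<bar> \<partial>D)"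
      have "\<delta> \<ge> 0" using d0[of undefined] by (rule order_trans[rotated]) (intro integral_nonneg_AE, auto)
      show ?thesis
      \<comment> \<open>A case distinction in place of a measurability argument: the integral of a
        non-integrable function is 0 by convention, and \<delta> is nonnegative.\<close>
      proof (cases "integrable (Pi\<^sub>M ({..<N} - {j}) (\<lambda>_. D)) ?I")
        case True
        have "integral\<^sup>L (Pi\<^sub>M ({..<N} - {j}) (\<lambda>_. D)) ?I \<le> (\<integral>w. \<delta> \<partial>Pi\<^sub>M ({..<N} - {j}) (\<lambda>_. D))"
          by (rule integral_mono[OF True _ d0]) simp
        thus ?thesis by (simp add: P.prob_space)
      next
        case False
        from not_integrable_integral_eq[OF False] show ?thesis using \<open>\<delta> \<ge> 0\<close> by simp
      qed
    qed
    finally show ?thesis .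
  qed
  have tm: "(\<lambda>v. min 1 (norm_ratio p v * \<eta>)) \<in> borel_measurable D" using norm_ratio_measurable by measurable
  have tb: "\<bar>min 1 (norm_ratio p v * \<eta>)\<bar> \<le> 1" for v using norm_ratio_nonneg[of p v] \<eta> by (auto simp: min_def)
  have ti: "integrable PN (\<lambda>w. min 1 (norm_ratio p (w j) * \<eta>))"
    using tb by (intro PN.integrable_const_bound[where B = 1]) auto
  have Bs: "?B \<in> sets PN" by measurable
  have 2: "(\<integral>w. \<bar>?b w - ?c w\<bar> \<partial>PN) \<le> (\<integral>w. min 1 (norm_ratio p (w j) * \<eta>) + indicator ?B w \<partial>PN)"
  proof (rule integral_mono)
    show "integrable PN (\<lambda>w. \<bar>?b w - ?c w\<bar>)" by (intro integrable_abs Bochner_Integration.integrable_diff bi ci)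
    show "integrable PN (\<lambda>w. min 1 (norm_ratio p (w j) * \<eta>) + indicator ?B w)"
      using ti Bs by (intro Bochner_Integration.integrable_add) (auto simp: integrable_indicator_iff PN.emeasure_eq_measure)
    fix w assume w: "w \<in> space PN"
    let ?r = "norm_ratio p (w j)"
    have le1: "\<bar>?b w - ?c w\<bar> \<le> min 1 \<bar>?r * (mat_trace (G j w) / real N) - ?r * (ET / real N)\<bar>"
      by (rule hfun_diff[OF bn cn])
    show "\<bar>?b w - ?c w\<bar> \<le> min 1 (?r * \<eta>) + indicator ?B w"
    proof (cases "w \<in> ?B")
      case True
      have "0 \<le> min 1 (?r * \<eta>)" using norm_ratio_nonneg[of p "w j"] \<eta> by simp
      moreover have "\<bar>?b w - ?c w\<bar> \<le> 1" using le1 unfolding min.bounded_iff by (rule conjunct1)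
      moreover have "indicator ?B w = (1::real)" using True by (rule indicator_simps)
      ultimately show ?thesis by linarith
    next
      case False
      hence "\<bar>T w - ET\<bar> < real N * \<eta> / 2" using w by auto
      moreover have "1 / x \<le> real N * \<eta> / 2" using \<eta>(2) x0 N0 by (simp add: field_simps)
      ultimately have "\<bar>mat_trace (G j w) - ET\<bar> \<le> real N * \<eta>" using T_G[OF j, of w] by linarith
      hence "\<bar>mat_trace (G j w) - ET\<bar> / real N \<le> \<eta>" using N0 by (simp add: field_simps)
      hence "?r * (\<bar>mat_trace (G j w) - ET\<bar> / real N) \<le> ?r * \<eta>" using norm_ratio_nonneg by (rule mult_left_mono)
      moreover have "\<bar>?r * (mat_trace (G j w) / real N) - ?r * (ET / real N)\<bar> = ?r * (\<bar>mat_trace (G j w) - ET\<bar> / real N)"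
      proof -
        have "?r * (mat_trace (G j w) / real N) - ?r * (ET / real N) = ?r * ((mat_trace (G j w) - ET) / real N)"
          by (simp add: algebra_simps diff_divide_distrib)
        thus ?thesis using norm_ratio_nonneg[of p "w j"] by (simp add: abs_mult)
      qed
      ultimately have "\<bar>?b w - ?c w\<bar> \<le> min 1 (?r * \<eta>)" using le1 unfolding min.bounded_iff by (elim conjE, intro conjI) linarith+
      moreover have "indicator ?B w = (0::real)" using False by (rule indicator_simps)
      ultimately show ?thesis by linarith
    qed
  qed
  have "(\<integral>w. min 1 (norm_ratio p (w j) * \<eta>) + indicator ?B w \<partial>PN) = \<theta> \<eta> + measure PN ?B"
    using ti Bs marginal[OF j tm tb] unfolding \<theta>_def
    by (subst Bochner_Integration.integral_add) (auto simp: integrable_indicator_iff PN.emeasure_eq_measure)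
  with 2 have 2: "(\<integral>w. \<bar>?b w - ?c w\<bar> \<partial>PN) \<le> \<theta> \<eta> + measure PN ?B" by simp
  have c: "integral\<^sup>L PN ?c = Hn (ET / real N)"
    unfolding Hn_def
  proof (rule marginal[OF j, where B = 1])
    show "(\<lambda>v. hfun (norm_ratio p v * (ET / real N))) \<in> borel_measurable D" using norm_ratio_measurable by measurable
    show "\<bar>hfun (norm_ratio p v * (ET / real N))\<bar> \<le> 1" for v using hfun_bounds[OF cn] by simp
  qed
  have "\<bar>integral\<^sup>L PN ?a - integral\<^sup>L PN ?b\<bar> \<le> \<delta>"
  proof -
    have "\<bar>integral\<^sup>L PN ?a - integral\<^sup>L PN ?b\<bar> = \<bar>\<integral>w. ?a w - ?b w \<partial>PN\<bar>" using ai bi by simp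
    also have "\<dots> \<le> (\<integral>w. \<bar>?a w - ?b w\<bar> \<partial>PN)" by (rule integral_abs_bound)
    finally show ?thesis using 1 by linarith
  qed
  moreover have "\<bar>integral\<^sup>L PN ?b - integral\<^sup>L PN ?c\<bar> \<le> \<theta> \<eta> + measure PN ?B"
  proof -
    have "\<bar>integral\<^sup>L PN ?b - integral\<^sup>L PN ?c\<bar> = \<bar>\<integral>w. ?b w - ?c w \<partial>PN\<bar>" using bi ci by simp
    also have "\<dots> \<le> (\<integral>w. \<bar>?b w - ?c w\<bar> \<partial>PN)" by (rule integral_abs_bound)
    finally show ?thesis using 2 by linarith
  qed
  ultimately show ?thesis unfolding ET_def[symmetric] c[symmetric] by linarith
qed

text \<open>Taking expectations in the trace identity turns its left side into
  \<open>p * (1 - x * m)\<close> and its right side into \<open>N\<close> terms, each close to the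
  same value of \<open>Hn\<close>; dividing by \<open>N\<close> gives the claim. The deviation
  \<open>N * \<eta> / 2\<close> in \<open>T_tail\<close> produces the constant 32.\<close>

lemma mean_trace_fixed_point:
  assumes \<delta>: "\<And>U l. orth_mat p U \<Longrightarrow> (\<And>i. i < p \<Longrightarrow> 0 \<le> l i \<and> l i \<le> 1 / x) \<Longrightarrow>
      (\<integral>v. \<bar>hfun (qform p (conj_diag p U l) v / real N) - hfun (norm_ratio p v * (mat_trace (conj_diag p U l) / real N))\<bar> \<partial>D) \<le> \<delta>"
    and \<eta>: "\<eta> > 0" "1 / (x * real N) \<le> \<eta> / 2"
  defines "m \<equiv> integral\<^sup>L PN T / real p"
  shows "\<bar>(real p / real N) * (1 - x * m) - Hn (real p / real N * m)\<bar>
    \<le> \<delta> + \<theta> \<eta> + 2 * exp (- (real N * \<eta>\<^sup>2 * x\<^sup>2 / 32))"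
proof -
  let ?b = "\<delta> + \<theta> \<eta> + measure PN {w \<in> space PN. \<bar>T w - integral\<^sup>L PN T\<bar> \<ge> real N * \<eta> / 2}"
  let ?a = "\<lambda>j. \<integral>w. hfun (qform p (G j w) (w j) / real N) \<partial>PN"
  let ?H = "Hn (integral\<^sup>L PN T / real N)"
  have ai: "integrable PN (\<lambda>w. hfun (qform p (G j w) (w j) / real N))" if "j < N" for j
    using hfun_bounds[OF qG_nonneg[OF that]] measurable_compose[OF qG_measurable[OF that]]
    by (intro PN.integrable_const_bound[where B = 1]) (auto intro!: measurable_compose[OF borel_measurable_divide[OF qG_measurable[OF that] borel_measurable_const] hfun_measurable])
  have id: "real p - x * T w = (\<Sum>j<N. hfun (qform p (G j w) (w j) / real N))" for w
    unfolding T_def trace_resolv_identity[OF x0 N0]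
    by (intro sum.cong refl) (auto simp: loo_qform[OF _ N0 x0] hfun_def G_def)
  have "(\<integral>w. real p - x * T w \<partial>PN) = real p - x * integral\<^sup>L PN T"
    using T_integrable by (simp add: PN.prob_space)
  hence sum: "real p - x * integral\<^sup>L PN T = (\<Sum>j<N. ?a j)"
    unfolding id using ai by (subst (asm) Bochner_Integration.integral_sum) auto
  have "\<bar>(real p - x * integral\<^sup>L PN T) - real N * ?H\<bar> = \<bar>\<Sum>j<N. ?a j - ?H\<bar>"
    unfolding sum by (simp add: sum_subtractf)
  also have "\<dots> \<le> (\<Sum>j<N. \<bar>?a j - ?H\<bar>)" by (rule sum_abs)
  also have "\<dots> \<le> (\<Sum>j<N. ?b)"
  proof (rule sum_mono)
    fix j assume "j \<in> {..<N}"
    hence j: "j < N" by simp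
    show "\<bar>?a j - ?H\<bar> \<le> ?b" by (rule leave_one_out_fixed_point[OF j _ \<eta>]) (rule \<delta>)
  qed
  also have "\<dots> = real N * ?b" by simp
  finally have main: "\<bar>(real p - x * integral\<^sup>L PN T) - real N * ?H\<bar> \<le> real N * ?b" .
  have "\<bar>(real p - x * integral\<^sup>L PN T) / real N - ?H\<bar> = \<bar>((real p - x * integral\<^sup>L PN T) - real N * ?H) / real N\<bar>"
    using N0 by (simp add: diff_divide_distrib)
  also have "\<dots> = \<bar>(real p - x * integral\<^sup>L PN T) - real N * ?H\<bar> / real N" by simp
  also have "\<dots> \<le> ?b" using main N0 by (simp add: pos_divide_le_eq mult.commute)
  finally have "\<bar>(real p - x * integral\<^sup>L PN T) / real N - ?H\<bar> \<le> ?b" .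
  moreover have "(real p - x * integral\<^sup>L PN T) / real N = (real p / real N) * (1 - x * m)"
    unfolding m_def using p0 N0 by (simp add: field_simps)
  moreover have "integral\<^sup>L PN T / real N = real p / real N * m" unfolding m_def using p0 by simp
  moreover have "measure PN {w \<in> space PN. \<bar>T w - integral\<^sup>L PN T\<bar> \<ge> real N * \<eta> / 2} \<le> 2 * exp (- (real N * \<eta>\<^sup>2 * x\<^sup>2 / 32))"
  proof -
    have "(real N * \<eta> / 2)\<^sup>2 * x\<^sup>2 / (8 * real N) = real N * \<eta>\<^sup>2 * x\<^sup>2 / 32"
      using N0 by (simp add: power2_eq_square field_simps)
    moreover have "real N * \<eta> / 2 > 0" using N0 \<eta>(1) by simp
    ultimately show ?thesis using T_tail[of "real N * \<eta> / 2"] by (simp only:)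
  qed
  ultimately show ?thesis by simp
qed
end

section \<open>From projections to resolvents\<close>

lemma min_one_add: "a \<ge> 0 \<Longrightarrow> b \<ge> 0 \<Longrightarrow> min 1 (a + b) \<le> min 1 a + min 1 (b::real)"
  by (auto simp: min_def)

lemma min_one_sum:
  assumes "finite I" "\<And>i. i \<in> I \<Longrightarrow> f i \<ge> (0::real)"
  shows "min 1 (\<Sum>i\<in>I. f i) \<le> (\<Sum>i\<in>I. min 1 (f i))"
  using assms
proof (induct I rule: finite_induct)
  case (insert a I)
  have "min 1 (f a + (\<Sum>i\<in>I. f i)) \<le> min 1 (f a) + min 1 (\<Sum>i\<in>I. f i)"
    using insert by (intro min_one_add sum_nonneg) auto
  thus ?case using insert by force
qed simp

lemma min_one_mult:
  assumes "b \<ge> 0" "t \<ge> (0::real)" shows "min 1 (b * t) \<le> max 1 b * min 1 t"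
proof (cases "t \<le> 1")
  case True
  have "b * t \<le> max 1 b * t" using assms by (intro mult_right_mono) auto
  thus ?thesis using True by (auto simp: min_def)
next
  case False
  thus ?thesis by (auto simp: min_def)
qed

text \<open>The sum counts the integers from 1 to \<open>y\<close>, so it is the floor of
  \<open>y\<close>.\<close>

lemma unit_steps_approx:
  fixes y :: real
  assumes y: "0 \<le> y" "y \<le> real k"
  shows "0 \<le> y - (\<Sum>a=1..k. if real a \<le> y then 1 else 0)" "y - (\<Sum>a=1..k. if real a \<le> y then 1 else 0) \<le> 1"
proof -
  have le: "real a \<le> y \<longleftrightarrow> a \<le> nat \<lfloor>y\<rfloor>" for a
    using y by (simp add: le_nat_iff le_floor_iff)
  have "nat \<lfloor>y\<rfloor> \<le> k" using y by linarith
  hence "{a\<in>{1..k}. real a \<le> y} = {1..nat \<lfloor>y\<rfloor>}" unfolding le by auto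
  moreover have "(\<Sum>a=1..k. if real a \<le> y then 1 else 0) = real (card {a\<in>{1..k}. real a \<le> y})"
    by (simp add: sum.If_cases Int_def)
  ultimately have e: "(\<Sum>a=1..k. if real a \<le> y then 1 else 0) = real (nat \<lfloor>y\<rfloor>)" by simp
  show "0 \<le> y - (\<Sum>a=1..k. if real a \<le> y then 1 else 0)" unfolding e using y by (simp add: of_nat_floor)
  show "y - (\<Sum>a=1..k. if real a \<le> y then 1 else 0) \<le> 1" unfolding e using y by linarith
qed

lemma quad_dev_conj_diag:
  assumes U: "orth_mat p U"
  shows "quad_dev p (conj_diag p U l) v = (\<Sum>j<p. l j * (((rot p U v j)\<^sup>2 - norm_ratio p v) / real p))"
  unfolding quad_dev_def qform_conj_diag[OF U] mat_trace_conj_diag[OF U]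
  by (simp add: sum_divide_distrib sum_distrib_left sum_subtractf[symmetric] diff_divide_distrib algebra_simps)

text \<open>The quadratic form and the trace term both lie between 0 and
  \<open>b * norm_ratio p v\<close>, hence so does the absolute value of their difference.\<close>

lemma quad_dev_small:
  assumes U: "orth_mat p U" and p: "p > 0" and l: "\<And>i. i < p \<Longrightarrow> 0 \<le> l i \<and> l i \<le> b"
  shows "\<bar>quad_dev p (conj_diag p U l) v\<bar> \<le> b * norm_ratio p v"
proof -
  have R: "norm_ratio p v = (\<Sum>j<p. (rot p U v j)\<^sup>2) / real p" unfolding norm_ratio_def sum_rot_sq[OF U] ..
  let ?q = "(\<Sum>j<p. l j * (rot p U v j)\<^sup>2) / real p" and ?t = "norm_ratio p v * ((\<Sum>j<p. l j) / real p)"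
  have "0 \<le> ?q" using l by (intro divide_nonneg_nonneg sum_nonneg mult_nonneg_nonneg) auto
  moreover have "?q \<le> b * norm_ratio p v"
  proof -
    have "(\<Sum>j<p. l j * (rot p U v j)\<^sup>2) \<le> (\<Sum>j<p. b * (rot p U v j)\<^sup>2)"
      using l by (intro sum_mono mult_right_mono) auto
    also have "\<dots> = b * (\<Sum>j<p. (rot p U v j)\<^sup>2)" by (simp add: sum_distrib_left)
    finally have "?q \<le> b * (\<Sum>j<p. (rot p U v j)\<^sup>2) / real p" by (rule divide_right_mono) simp
    thus ?thesis unfolding R by simp
  qed
  moreover have "0 \<le> ?t" using l norm_ratio_nonneg by (intro mult_nonneg_nonneg divide_nonneg_nonneg sum_nonneg) auto
  moreover have "?t \<le> b * norm_ratio p v"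
  proof -
    have "(\<Sum>j<p. l j) \<le> (\<Sum>j<p. b)" using l by (intro sum_mono) auto
    hence "(\<Sum>j<p. l j) / real p \<le> b" using p by (simp add: field_simps)
    hence "?t \<le> norm_ratio p v * b" using norm_ratio_nonneg by (rule mult_left_mono)
    thus ?thesis by (simp add: mult.commute)
  qed
  ultimately show ?thesis unfolding quad_dev_def qform_conj_diag[OF U] mat_trace_conj_diag[OF U] by linarith
qed

lemma orth_proj_conj_diag:
  assumes U: "orth_mat p U" shows "orth_proj p (conj_diag p U (\<lambda>i. if Q i then 1 else 0))"
proof -
  have "(\<lambda>i. (if Q i then 1 else 0) * (if Q i then 1 else 0)) = (\<lambda>i. if Q i then 1 else (0::real))" by auto
  thus ?thesis unfolding orth_proj_def using U conj_diag_mult[OF U] conj_diag_transpose[OF U] by simp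
qed

context iid_sample
begin

lemma quad_dev_measurable:
  assumes "A \<in> carrier_mat p p" shows "quad_dev p A \<in> borel_measurable D"
  unfolding quad_dev_def[abs_def] using qform_measurable[OF assms] norm_ratio_measurable by measurable

lemma min_quad_integrable:
  assumes "A \<in> carrier_mat p p" "b \<ge> 0" shows "integrable D (\<lambda>v. min 1 (b * \<bar>quad_dev p A v\<bar>))"
  using quad_dev_measurable[OF assms(1)] assms(2) by (intro D.integrable_const_bound[where B = 1]) auto

text \<open>Rounding the spectrum down to multiples of \<open>\<kappa> / k\<close> writes the matrix as \<open>\<kappa> / k\<close> times a sum of \<open>k\<close>
  spectral projections plus an error with spectrum in \<open>[0, \<kappa> / k]\<close>.\<close>

lemma quad_dev_uniform:
  assumes proj: "\<And>P. orth_proj p P \<Longrightarrow> (\<integral>v. min 1 \<bar>quad_dev p P v\<bar> \<partial>D) \<le> \<epsilon>"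
    and k: "k > 0" and \<kappa>: "\<kappa> > 0" and C: "real p / real N \<le> C"
    and U: "orth_mat p U" and l: "\<And>i. i < p \<Longrightarrow> 0 \<le> l i \<and> l i \<le> \<kappa>"
  defines "b \<equiv> C * (\<kappa> / real k)"
  shows "(\<integral>v. \<bar>hfun (qform p (conj_diag p U l) v / real N) - hfun (norm_ratio p v * (mat_trace (conj_diag p U l) / real N))\<bar> \<partial>D)
    \<le> real k * (max 1 b * \<epsilon>) + \<theta> b"
proof -
  have C0: "C \<ge> 0" using C by (rule order_trans[rotated]) simp
  have b0: "b \<ge> 0" unfolding b_def using C0 \<kappa> k by simp
  let ?A = "conj_diag p U l"
  \<comment> \<open>The spectral projection onto eigenvalues at least
    \<open>a * \<kappa> / k\<close>.\<close>
  define P where "P a = conj_diag p U (\<lambda>i. if real a \<le> real k * l i / \<kappa> then 1 else 0)" for a :: nat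
  define e where "e i = l i - (\<kappa> / real k) * (\<Sum>a=1..k. if real a \<le> real k * l i / \<kappa> then 1 else 0)" for i
  have e: "0 \<le> e i \<and> e i \<le> \<kappa> / real k" if "i < p" for i
  proof -
    define y where "y = real k * l i / \<kappa>"
    have y: "0 \<le> y" "y \<le> real k" using l[OF that] \<kappa> k unfolding y_def by (auto simp: field_simps)
    have "e i = (\<kappa> / real k) * (y - (\<Sum>a=1..k. if real a \<le> y then 1 else 0))"
      unfolding e_def y_def[symmetric] using \<kappa> k by (simp add: right_diff_distrib y_def)
    moreover have "0 \<le> (\<kappa> / real k) * (y - (\<Sum>a=1..k. if real a \<le> y then 1 else 0))"
      using \<kappa> unit_steps_approx(1)[OF y] by (intro mult_nonneg_nonneg) auto
    moreover have "(\<kappa> / real k) * (y - (\<Sum>a=1..k. if real a \<le> y then 1 else 0)) \<le> (\<kappa> / real k) * 1"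
      using \<kappa> unit_steps_approx(2)[OF y] by (intro mult_left_mono) auto
    ultimately show ?thesis by (simp only: mult_1_right)
  qed
  \<comment> \<open>\<open>quad_dev\<close> is linear in the spectrum once \<open>U\<close> is
    fixed, so the decomposition of the eigenvalues carries over.\<close>
  have dec: "quad_dev p ?A v = (\<Sum>a=1..k. (\<kappa> / real k) * quad_dev p (P a) v) + quad_dev p (conj_diag p U e) v" for v
  proof -
    define z where "z j = ((rot p U v j)\<^sup>2 - norm_ratio p v) / real p" for j
    have "quad_dev p ?A v = (\<Sum>j<p. ((\<kappa> / real k) * (\<Sum>a=1..k. if real a \<le> real k * l j / \<kappa> then 1 else 0) + e j) * z j)"
      unfolding quad_dev_conj_diag[OF U] z_def[symmetric] e_def by simp
    also have "\<dots> = (\<Sum>j<p. \<Sum>a=1..k. (\<kappa> / real k) * ((if real a \<le> real k * l j / \<kappa> then 1 else 0) * z j)) + (\<Sum>j<p. e j * z j)"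
      by (simp only: distrib_right sum.distrib sum_distrib_left sum_distrib_right mult.assoc)
    also have "(\<Sum>j<p. \<Sum>a=1..k. (\<kappa> / real k) * ((if real a \<le> real k * l j / \<kappa> then 1 else 0) * z j)) =
        (\<Sum>a=1..k. \<Sum>j<p. (\<kappa> / real k) * ((if real a \<le> real k * l j / \<kappa> then 1 else 0) * z j))" by (rule sum.swap)
    finally show ?thesis
      unfolding P_def quad_dev_conj_diag[OF U] z_def[symmetric] sum_distrib_left .
  qed
  have Pc: "P a \<in> carrier_mat p p" for a unfolding P_def using U by simp
  have Ac: "?A \<in> carrier_mat p p" using U by simp
  have pw: "\<bar>hfun (qform p ?A v / real N) - hfun (norm_ratio p v * (mat_trace ?A / real N))\<bar>
      \<le> (\<Sum>a=1..k. max 1 b * min 1 \<bar>quad_dev p (P a) v\<bar>) + min 1 (norm_ratio p v * b)" for v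
  proof -
    have q0: "0 \<le> qform p ?A v / real N" unfolding qform_conj_diag[OF U] using l
      by (intro divide_nonneg_nonneg sum_nonneg mult_nonneg_nonneg) auto
    have t0: "0 \<le> norm_ratio p v * (mat_trace ?A / real N)" unfolding mat_trace_conj_diag[OF U] using l norm_ratio_nonneg
      by (intro mult_nonneg_nonneg divide_nonneg_nonneg sum_nonneg) auto
    \<comment> \<open>The quadratic form of a sample is divided by \<open>N\<close> whereas
      \<open>quad_dev\<close> is divided by \<open>p\<close>; the ratio, at most \<open>C\<close>,
      is absorbed into \<open>b\<close>.\<close>
    have "qform p ?A v / real N - norm_ratio p v * (mat_trace ?A / real N) = (real p / real N) * quad_dev p ?A v"
      unfolding quad_dev_def using p0 N0 by (simp add: field_simps)
    hence "\<bar>hfun (qform p ?A v / real N) - hfun (norm_ratio p v * (mat_trace ?A / real N))\<bar> \<le> min 1 ((real p / real N) * \<bar>quad_dev p ?A v\<bar>)"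
      using hfun_diff[OF q0 t0] by (simp add: abs_mult)
    also have "\<dots> \<le> min 1 ((\<Sum>a=1..k. b * \<bar>quad_dev p (P a) v\<bar>) + b * norm_ratio p v)"
    proof (rule min.mono[OF order_refl])
      have "\<bar>quad_dev p ?A v\<bar> \<le> \<bar>\<Sum>a=1..k. (\<kappa> / real k) * quad_dev p (P a) v\<bar> + \<bar>quad_dev p (conj_diag p U e) v\<bar>"
        unfolding dec by (rule abs_triangle_ineq)
      also have "\<dots> \<le> (\<Sum>a=1..k. \<bar>(\<kappa> / real k) * quad_dev p (P a) v\<bar>) + (\<kappa> / real k) * norm_ratio p v"
        by (intro add_mono sum_abs quad_dev_small[OF U p0 e])
      also have "(\<Sum>a=1..k. \<bar>(\<kappa> / real k) * quad_dev p (P a) v\<bar>) = (\<Sum>a=1..k. (\<kappa> / real k) * \<bar>quad_dev p (P a) v\<bar>)"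
        using \<kappa> by (simp add: abs_mult)
      finally have "(real p / real N) * \<bar>quad_dev p ?A v\<bar> \<le> C * ((\<Sum>a=1..k. (\<kappa> / real k) * \<bar>quad_dev p (P a) v\<bar>) + (\<kappa> / real k) * norm_ratio p v)"
        using C C0 by (intro mult_mono) auto
      also have "\<dots> = (\<Sum>a=1..k. b * \<bar>quad_dev p (P a) v\<bar>) + b * norm_ratio p v"
        unfolding b_def by (simp only: distrib_left sum_distrib_left mult.assoc)
      finally show "(real p / real N) * \<bar>quad_dev p ?A v\<bar> \<le> (\<Sum>a=1..k. b * \<bar>quad_dev p (P a) v\<bar>) + b * norm_ratio p v" .
    qed
    also have "\<dots> \<le> min 1 (\<Sum>a=1..k. b * \<bar>quad_dev p (P a) v\<bar>) + min 1 (b * norm_ratio p v)"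
      using b0 norm_ratio_nonneg by (intro min_one_add sum_nonneg mult_nonneg_nonneg) auto
    also have "\<dots> \<le> (\<Sum>a=1..k. min 1 (b * \<bar>quad_dev p (P a) v\<bar>)) + min 1 (norm_ratio p v * b)"
      using b0 by (intro add_mono min_one_sum) (auto simp: mult.commute)
    also have "\<dots> \<le> (\<Sum>a=1..k. max 1 b * min 1 \<bar>quad_dev p (P a) v\<bar>) + min 1 (norm_ratio p v * b)"
      using b0 by (intro add_mono sum_mono min_one_mult) auto
    finally show ?thesis .
  qed
  have Pi: "integrable D (\<lambda>v. min 1 \<bar>quad_dev p (P a) v\<bar>)" for a using min_quad_integrable[OF Pc, of 1] by simp
  have Si: "integrable D (\<lambda>v. \<Sum>a=1..k. max 1 b * min 1 \<bar>quad_dev p (P a) v\<bar>)"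
    by (intro Bochner_Integration.integrable_sum integrable_mult_right Pi)
  have "(\<integral>v. \<bar>hfun (qform p ?A v / real N) - hfun (norm_ratio p v * (mat_trace ?A / real N))\<bar> \<partial>D)
      \<le> (\<integral>v. (\<Sum>a=1..k. max 1 b * min 1 \<bar>quad_dev p (P a) v\<bar>) + min 1 (norm_ratio p v * b) \<partial>D)"
  proof (rule integral_mono'[OF _ pw])
    show "integrable D (\<lambda>v. (\<Sum>a=1..k. max 1 b * min 1 \<bar>quad_dev p (P a) v\<bar>) + min 1 (norm_ratio p v * b))"
      by (intro Bochner_Integration.integrable_add Si \<theta>_integrable b0)
    show "0 \<le> (\<Sum>a=1..k. max 1 b * min 1 \<bar>quad_dev p (P a) v\<bar>) + min 1 (norm_ratio p v * b)" for v
      using b0 norm_ratio_nonneg[of p v] by (intro add_nonneg_nonneg sum_nonneg mult_nonneg_nonneg) auto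
  qed
  also have "\<dots> = (\<integral>v. (\<Sum>a=1..k. max 1 b * min 1 \<bar>quad_dev p (P a) v\<bar>) \<partial>D) + \<theta> b"
    unfolding \<theta>_def by (rule Bochner_Integration.integral_add[OF Si \<theta>_integrable[OF b0]])
  also have "(\<integral>v. (\<Sum>a=1..k. max 1 b * min 1 \<bar>quad_dev p (P a) v\<bar>) \<partial>D) = (\<Sum>a=1..k. max 1 b * (\<integral>v. min 1 \<bar>quad_dev p (P a) v\<bar> \<partial>D))"
    using Pi by (subst Bochner_Integration.integral_sum) auto
  also have "\<dots> \<le> (\<Sum>a=1..k. max 1 b * \<epsilon>)"
    by (intro sum_mono mult_left_mono proj) (auto simp: P_def orth_proj_conj_diag[OF U])
  also have "\<dots> = real k * (max 1 b * \<epsilon>)" by simp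
  finally show ?thesis by simp
qed

end

section \<open>The limiting fixed-point equation\<close>

context real_distribution
begin

definition Hlim :: "real \<Rightarrow> real" where "Hlim u = (LINT r|M. hfun (max r 0 * u))"
definition \<Theta> :: "real \<Rightarrow> real" where "\<Theta> \<eta> = (LINT r|M. min 1 (max r 0 * \<eta>))"

lemma Hlim_integrable: "u \<ge> 0 \<Longrightarrow> integrable M (\<lambda>r. hfun (max r 0 * u))"
  using hfun_bounds[of "max r 0 * u" for r] by (intro integrable_bounded[where B = 1]) auto

lemma \<Theta>_integrable: "u \<ge> 0 \<Longrightarrow> integrable M (\<lambda>r. min 1 (max r 0 * u))"
  by (intro integrable_bounded[where B = 1]) auto

lemma Hlim_diff:
  assumes "0 \<le> a" "0 \<le> b" shows "\<bar>Hlim a - Hlim b\<bar> \<le> \<Theta> \<bar>a - b\<bar>"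
proof -
  have "\<bar>Hlim a - Hlim b\<bar> = \<bar>LINT r|M. hfun (max r 0 * a) - hfun (max r 0 * b)\<bar>"
    unfolding Hlim_def using Hlim_integrable assms by simp
  also have "\<dots> \<le> (LINT r|M. \<bar>hfun (max r 0 * a) - hfun (max r 0 * b)\<bar>)"
    by (rule integral_abs_bound)
  also have "\<dots> \<le> \<Theta> \<bar>a - b\<bar>" unfolding \<Theta>_def
  proof (rule integral_mono)
    show "integrable M (\<lambda>r. \<bar>hfun (max r 0 * a) - hfun (max r 0 * b)\<bar>)"
      using Hlim_integrable assms by (intro integrable_abs Bochner_Integration.integrable_diff) auto
    show "integrable M (\<lambda>r. min 1 (max r 0 * \<bar>a - b\<bar>))" by (rule \<Theta>_integrable) simp
    fix r :: real
    have "max r 0 * a - max r 0 * b = max r 0 * (a - b)" by (simp add: algebra_simps)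
    hence "\<bar>max r 0 * a - max r 0 * b\<bar> = max r 0 * \<bar>a - b\<bar>" by (simp add: abs_mult)
    thus "\<bar>hfun (max r 0 * a) - hfun (max r 0 * b)\<bar> \<le> min 1 (max r 0 * \<bar>a - b\<bar>)"
      using hfun_diff[of "max r 0 * a" "max r 0 * b"] assms by simp
  qed
  finally show ?thesis .
qed

lemma \<Theta>_mono: "0 \<le> a \<Longrightarrow> a \<le> b \<Longrightarrow> \<Theta> a \<le> \<Theta> b"
  unfolding \<Theta>_def by (intro integral_mono \<Theta>_integrable min.mono mult_left_mono) auto

text \<open>Dominated convergence with majorant 1, so the tail of the measure is irrelevant.\<close>

lemma \<Theta>_small:
  assumes "\<epsilon> > 0" shows "\<exists>\<eta>>0. \<Theta> \<eta> < \<epsilon>"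
proof -
  have "(\<lambda>n. LINT r|M. min 1 (max r 0 * inverse (real (Suc n)))) \<longlonglongrightarrow> (LINT r|M. 0)"
  proof (rule integral_dominated_convergence[where w = "\<lambda>_. 1"])
    show "AE r in M. (\<lambda>n. min 1 (max r 0 * inverse (real (Suc n)))) \<longlonglongrightarrow> 0"
    proof (rule AE_I2)
      fix r :: real
      have "(\<lambda>n. min 1 (max r 0 * inverse (real (Suc n)))) \<longlonglongrightarrow> min 1 (max r 0 * 0)"
        by (intro tendsto_intros LIMSEQ_inverse_real_of_nat)
      thus "(\<lambda>n. min 1 (max r 0 * inverse (real (Suc n)))) \<longlonglongrightarrow> 0" by simp
    qed
  qed auto
  hence "\<forall>\<^sub>F n in sequentially. \<Theta> (inverse (real (Suc n))) < \<epsilon>"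
    unfolding \<Theta>_def using assms by (intro order_tendstoD(2)) auto
  then obtain n where "\<Theta> (inverse (real (Suc n))) < \<epsilon>" by (auto simp: eventually_sequentially)
  thus ?thesis by (intro exI[of _ "inverse (real (Suc n))"]) auto
qed

lemma Hlim_continuous: "continuous_on {0..} Hlim"
  unfolding continuous_on_iff
proof (intro ballI allI impI)
  fix a e :: real assume a: "a \<in> {0..}" and e: "e > 0"
  obtain \<eta> where \<eta>: "\<eta> > 0" "\<Theta> \<eta> < e" using \<Theta>_small[OF e] by blast
  have "dist (Hlim b) (Hlim a) < e" if "b \<in> {0..}" "dist b a < \<eta>" for b
  proof -
    have "\<bar>Hlim b - Hlim a\<bar> \<le> \<Theta> \<bar>b - a\<bar>" using that a by (intro Hlim_diff) auto
    also have "\<dots> \<le> \<Theta> \<eta>" using that by (intro \<Theta>_mono) (auto simp: dist_real_def)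
    finally show ?thesis using \<eta> by (simp add: dist_real_def)
  qed
  thus "\<exists>d>0. \<forall>x'\<in>{0..}. dist x' a < d \<longrightarrow> dist (Hlim x') (Hlim a) < e" using \<eta>(1) by blast
qed

lemma Hlim_zero: "Hlim 0 = 0" unfolding Hlim_def hfun_def by simp

lemma Hlim_le: "u \<ge> 0 \<Longrightarrow> Hlim u \<le> \<Theta> u"
  using Hlim_diff[of u 0] Hlim_zero by simp

lemma Hlim_nonneg: "u \<ge> 0 \<Longrightarrow> Hlim u \<ge> 0"
  unfolding Hlim_def using hfun_bounds by (intro integral_nonneg_AE AE_I2) auto

text \<open>Intermediate values on \<open>[0, 1 / x]\<close>: the difference of the sides is
  \<open>- c\<close> at 0 and nonnegative at \<open>1 / x\<close>. The first value also shows that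
  the root is positive.\<close>

lemma fixed_point_exists:
  assumes c: "c > 0" and x: "x > 0"
  shows "\<exists>m. 0 < m \<and> m \<le> 1 / x \<and> c * (1 - x * m) = Hlim (c * m)"
proof -
  have "\<exists>m. 0 \<le> m \<and> m \<le> 1 / x \<and> Hlim (c * m) - c * (1 - x * m) = 0"
  proof (rule IVT')
    show "Hlim (c * 0) - c * (1 - x * 0) \<le> 0" using Hlim_zero c by simp
    show "0 \<le> Hlim (c * (1 / x)) - c * (1 - x * (1 / x))" using Hlim_nonneg[of "c * (1 / x)"] c x by simp
    show "continuous_on {0..1 / x} (\<lambda>m. Hlim (c * m) - c * (1 - x * m))"
      using c by (intro continuous_intros continuous_on_compose2[OF Hlim_continuous]) auto
  qed (use x in simp)
  then obtain m where m: "0 \<le> m" "m \<le> 1 / x" "Hlim (c * m) - c * (1 - x * m) = 0" by blast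
  have "m \<noteq> 0" using m(3) Hlim_zero c by auto
  thus ?thesis using m by (intro exI[of _ m]) auto
qed

end

section \<open>Asymptotics\<close>

locale cov_model =
  fixes p N :: "nat \<Rightarrow> nat"
    and M :: "nat \<Rightarrow> 'a measure"
    and x :: "nat \<Rightarrow> 'a \<Rightarrow> nat \<Rightarrow> real"
    and X :: "nat \<Rightarrow> nat \<Rightarrow> 'a \<Rightarrow> nat \<Rightarrow> real"
    and c :: real
    and \<nu> :: "real measure"
  assumes p_pos: "\<And>n. p n > 0"
    and N_pos: "\<And>n. N n > 0"
    and p_lim: "filterlim p at_top sequentially"
    and prob: "\<And>n. prob_space (M n)"
    and x_meas: "\<And>n. x n \<in> measurable (M n) (rvec (p n))"
    and X_indep: "\<And>n. prob_space.indep_vars (M n) (\<lambda>_. rvec (p n)) (X n) {..<N n}"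
    and X_law: "\<And>n j. j < N n \<Longrightarrow>
        distr (M n) (rvec (p n)) (X n j) = distr (M n) (rvec (p n)) (x n)"
    and c_pos: "c > 0"
    and c_lim: "(\<lambda>n. real (p n) / real (N n)) \<longlonglongrightarrow> c"
    and nu: "prob_on_nonneg \<nu>"
    and R_lim: "weak_conv_m (\<lambda>n. distr (M n) borel (\<lambda>\<omega>. norm_ratio (p n) (x n \<omega>))) \<nu>"
    and RQC: "\<And>P :: nat \<Rightarrow> real mat. (\<And>n. orth_proj (p n) (P n)) \<Longrightarrow>
        conv_in_prob M (\<lambda>n \<omega>. quad_dev (p n) (P n) (x n \<omega>)) 0"
begin

interpretation \<nu>: real_distribution \<nu> using nu by (rule prob_on_nonneg_rd)

definition "D n = distr (M n) (rvec (p n)) (x n)"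

lemma iid_sample_D: "iid_sample (p n) (N n) (D n)"
proof (rule iid_sample.intro)
  show "prob_space (D n)" unfolding D_def by (rule prob_space.prob_space_distr[OF prob x_meas])
  show "sets (D n) = sets (rvec (p n))" unfolding D_def by (rule sets_distr)
qed (rule p_pos N_pos)+

interpretation S: iid_sample "p n" "N n" "D n" for n by (rule iid_sample_D)

lemma norm_ratio_x_measurable: "(\<lambda>w. norm_ratio (p n) (x n w)) \<in> borel_measurable (M n)"
proof -
  have "norm_ratio (p n) \<in> borel_measurable (rvec (p n))"
    using S.norm_ratio_measurable[of n] unfolding D_def by simp
  thus ?thesis by (rule measurable_compose[OF x_meas])
qed

lemma norm_ratio_integral_limit:
  fixes f :: "real \<Rightarrow> real"
  assumes f: "\<And>r. isCont f r" "\<And>r. \<bar>f r\<bar> \<le> B"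
  shows "(\<lambda>n. \<integral>v. f (norm_ratio (p n) v) \<partial>D n) \<longlonglongrightarrow> integral\<^sup>L \<nu> f"
proof -
  have fm: "f \<in> borel_measurable borel" using f(1) by (intro borel_measurable_continuous_onI continuous_at_imp_continuous_on) auto
  have nm: "norm_ratio (p n) \<in> borel_measurable (rvec (p n))" for n
    using S.norm_ratio_measurable[of n] unfolding D_def by simp
  have "(\<integral>v. f (norm_ratio (p n) v) \<partial>D n) = integral\<^sup>L (distr (M n) borel (\<lambda>w. norm_ratio (p n) (x n w))) f" for n
    unfolding D_def integral_distr[OF x_meas measurable_compose[OF nm fm]] integral_distr[OF norm_ratio_x_measurable fm] ..
  moreover have "real_distribution (distr (M n) borel (\<lambda>w. norm_ratio (p n) (x n w)))" for n
    by (rule prob_space.real_distribution_distr[OF prob norm_ratio_x_measurable])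
  ultimately show ?thesis using weak_conv_integral[OF _ \<nu>.real_distribution_axioms R_lim f] by simp
qed

lemma \<theta>_limit: "\<eta> \<ge> 0 \<Longrightarrow> (\<lambda>n. S.\<theta> n \<eta>) \<longlonglongrightarrow> \<nu>.\<Theta> \<eta>"
proof -
  assume \<eta>: "\<eta> \<ge> 0"
  have "(\<lambda>n. \<integral>v. min 1 (max (norm_ratio (p n) v) 0 * \<eta>) \<partial>D n) \<longlonglongrightarrow> (LINT r|\<nu>. min 1 (max r 0 * \<eta>))"
  proof (rule norm_ratio_integral_limit)
    show "isCont (\<lambda>r. min 1 (max r 0 * \<eta>)) r" for r by (intro continuous_intros)
    show "\<bar>min 1 (max r 0 * \<eta>)\<bar> \<le> 1" for r using \<eta> by auto
  qed
  moreover have "max (norm_ratio (p n) v) 0 = norm_ratio (p n) v" for n v using norm_ratio_nonneg[of "p n" v] by simp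
  ultimately show ?thesis unfolding S.\<theta>_def \<nu>.\<Theta>_def by simp
qed

lemma Hn_limit: "u \<ge> 0 \<Longrightarrow> (\<lambda>n. S.Hn n u) \<longlonglongrightarrow> \<nu>.Hlim u"
proof -
  assume u: "u \<ge> 0"
  have "(\<lambda>n. \<integral>v. hfun (max (norm_ratio (p n) v) 0 * u) \<partial>D n) \<longlonglongrightarrow> (LINT r|\<nu>. hfun (max r 0 * u))"
  proof (rule norm_ratio_integral_limit)
    have "1 + max r 0 * u \<noteq> 0" for r
    proof -
      have "max r 0 * u \<ge> 0" using u by simp
      thus ?thesis by linarith
    qed
    thus "isCont (\<lambda>r. hfun (max r 0 * u)) r" for r unfolding hfun_def by (intro continuous_intros)
    show "\<bar>hfun (max r 0 * u)\<bar> \<le> 1" for r using hfun_bounds[of "max r 0 * u"] u by simp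
  qed
  moreover have "max (norm_ratio (p n) v) 0 = norm_ratio (p n) v" for n v using norm_ratio_nonneg[of "p n" v] by simp
  ultimately show ?thesis unfolding S.Hn_def \<nu>.Hlim_def by simp
qed

text \<open>Tightness of the norm ratios in the form used below: an \<eta> chosen for \<nu> works
  for all large \<open>n\<close>.\<close>

lemma \<theta>_small:
  assumes "\<epsilon> > 0" shows "\<exists>\<eta>>0. \<forall>\<^sub>F n in sequentially. S.\<theta> n \<eta> < \<epsilon>"
proof -
  obtain \<eta> where \<eta>: "\<eta> > 0" "\<nu>.\<Theta> \<eta> < \<epsilon>" using \<nu>.\<Theta>_small[OF assms] by blast
  have "\<forall>\<^sub>F n in sequentially. S.\<theta> n \<eta> < \<epsilon>" using \<theta>_limit[of \<eta>] \<eta> by (intro order_tendstoD(2)) auto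
  thus ?thesis using \<eta>(1) by blast
qed

text \<open>Convergence in probability rewritten as convergence of the mean of
  \<open>min 1 |Y|\<close>, by splitting at a small threshold. The mean depends only on the law
  \<open>D n\<close>, as the leave-one-out estimate requires.\<close>

lemma quad_dev_mean_limit:
  assumes P: "\<And>n. orth_proj (p n) (P n)"
  shows "(\<lambda>n. \<integral>v. min 1 \<bar>quad_dev (p n) (P n) v\<bar> \<partial>D n) \<longlonglongrightarrow> 0"
proof -
  let ?Y = "\<lambda>n w. quad_dev (p n) (P n) (x n w)"
  have Ym: "?Y n \<in> borel_measurable (M n)" for n using RQC[OF P] unfolding conv_in_prob_def by auto
  have Yl: "(\<lambda>n. measure (M n) {w \<in> space (M n). \<bar>?Y n w - 0\<bar> > \<epsilon>}) \<longlonglongrightarrow> 0" if "\<epsilon> > 0" for \<epsilon>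
    using RQC[OF P] that unfolding conv_in_prob_def by auto
  have qm: "quad_dev (p n) (P n) \<in> borel_measurable (rvec (p n))" for n
    using S.quad_dev_measurable[of "P n" n] P[of n] unfolding D_def orth_proj_def by simp
  have e: "(\<integral>v. min 1 \<bar>quad_dev (p n) (P n) v\<bar> \<partial>D n) = (\<integral>w. min 1 \<bar>?Y n w\<bar> \<partial>M n)" for n
    unfolding D_def by (rule integral_distr[OF x_meas]) (use qm in measurable)
  have bound: "(\<integral>w. min 1 \<bar>?Y n w\<bar> \<partial>M n) \<le> \<epsilon> + measure (M n) {w \<in> space (M n). \<bar>?Y n w - 0\<bar> > \<epsilon>}" if "\<epsilon> > 0" for \<epsilon> n
  proof -
    interpret prob_space "M n" by (rule prob)
    let ?B = "{w \<in> space (M n). \<bar>?Y n w - 0\<bar> > \<epsilon>}"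
    have B: "?B \<in> sets (M n)" using Ym[of n] by measurable
    have i: "integrable (M n) (\<lambda>w. indicator ?B w :: real)" using B by (simp add: integrable_indicator_iff emeasure_eq_measure)
    have "(\<integral>w. min 1 \<bar>?Y n w\<bar> \<partial>M n) \<le> (\<integral>w. \<epsilon> + indicator ?B w \<partial>M n)"
    proof (rule integral_mono)
      show "integrable (M n) (\<lambda>w. min 1 \<bar>?Y n w\<bar>)" using Ym[of n] by (intro integrable_const_bound[where B = 1]) auto
      show "integrable (M n) (\<lambda>w. \<epsilon> + indicator ?B w)" using i by simp
      fix w assume "w \<in> space (M n)"
      thus "min 1 \<bar>?Y n w\<bar> \<le> \<epsilon> + indicator ?B w" using that by (auto simp: indicator_def)
    qed
    also have "\<dots> = \<epsilon> + measure (M n) ?B" using i B prob_space by simp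
    finally show ?thesis .
  qed
  show ?thesis
  proof (rule LIMSEQ_I)
    fix r :: real assume r: "r > 0"
    have "\<forall>\<^sub>F n in sequentially. measure (M n) {w \<in> space (M n). \<bar>?Y n w - 0\<bar> > r / 2} < r / 2"
      using Yl[of "r / 2"] r by (intro order_tendstoD(2)) auto
    hence "\<forall>\<^sub>F n in sequentially. norm ((\<integral>v. min 1 \<bar>quad_dev (p n) (P n) v\<bar> \<partial>D n) - 0) < r"
    proof eventually_elim
      case (elim n)
      have "(\<integral>w. min 1 \<bar>?Y n w\<bar> \<partial>M n) \<ge> 0" by (intro integral_nonneg_AE) auto
      thus ?case using bound[of "r / 2" n] elim r unfolding e by simp
    qed
    thus "\<exists>n0. \<forall>n\<ge>n0. norm ((\<integral>v. min 1 \<bar>quad_dev (p n) (P n) v\<bar> \<partial>D n) - 0) < r"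
      unfolding eventually_sequentially .
  qed
qed

text \<open>The condition is stated for single sequences of projections; picking a nearly worst projection
  for every \<open>n\<close> makes it uniform over all projections.\<close>

lemma quad_dev_uniform_limit:
  assumes \<epsilon>: "\<epsilon> > 0"
  shows "\<forall>\<^sub>F n in sequentially. \<forall>P. orth_proj (p n) P \<longrightarrow> (\<integral>v. min 1 \<bar>quad_dev (p n) P v\<bar> \<partial>D n) \<le> \<epsilon>"
proof -
  let ?I = "\<lambda>n P. \<integral>v. min 1 \<bar>quad_dev (p n) P v\<bar> \<partial>D n"
  \<comment> \<open>Where no projection is bad, the zero matrix is the default: it is an orthogonal
    projection, so the hypothesis applies to the whole sequence.\<close>
  define P where "P n = (if \<exists>P. orth_proj (p n) P \<and> ?I n P > \<epsilon> then SOME P. orth_proj (p n) P \<and> ?I n P > \<epsilon> else 0\<^sub>m (p n) (p n))" for n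
  have s: "orth_proj (p n) (P n) \<and> ?I n (P n) > \<epsilon>" if "\<exists>P. orth_proj (p n) P \<and> ?I n P > \<epsilon>" for n
    using someI_ex[OF that] that unfolding P_def by simp
  have z: "orth_proj (p n) (0\<^sub>m (p n) (p n))" for n unfolding orth_proj_def by auto
  have "orth_proj (p n) (P n)" for n
  proof (cases "\<exists>P. orth_proj (p n) P \<and> ?I n P > \<epsilon>")
    case False
    hence "P n = 0\<^sub>m (p n) (p n)" unfolding P_def by (rule if_not_P)
    thus ?thesis using z by simp
  qed (use s in blast)
  hence "(\<lambda>n. ?I n (P n)) \<longlonglongrightarrow> 0" by (rule quad_dev_mean_limit)
  hence "\<forall>\<^sub>F n in sequentially. ?I n (P n) < \<epsilon>" using \<epsilon> by (intro order_tendstoD(2)) auto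
  thus ?thesis
  proof eventually_elim
    case (elim n)
    show ?case
    proof (intro allI impI, rule ccontr)
      fix Q assume "orth_proj (p n) Q" "\<not> ?I n Q \<le> \<epsilon>"
      hence "\<exists>P. orth_proj (p n) P \<and> ?I n P > \<epsilon>" by (intro exI[of _ Q]) simp
      from conjunct2[OF s[OF this]] elim show False by linarith
    qed
  qed
qed

section \<open>Convergence of the mean trace\<close>

lemma N_lim: "filterlim (\<lambda>n. real (N n)) at_top sequentially"
proof -
  have "filterlim (\<lambda>n. real (p n)) at_top sequentially"
    by (rule filterlim_compose[OF filterlim_real_sequentially p_lim])
  hence "filterlim (\<lambda>n. inverse (real (p n) / real (N n)) * real (p n)) at_top sequentially"
    using c_pos by (intro filterlim_tendsto_pos_mult_at_top[OF tendsto_inverse[OF c_lim]]) auto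
  moreover have "inverse (real (p n) / real (N n)) * real (p n) = real (N n)" for n
    using p_pos[of n] by simp
  ultimately show ?thesis by simp
qed

lemma c_bounds: "\<forall>\<^sub>F n in sequentially. c / 2 < real (p n) / real (N n) \<and> real (p n) / real (N n) < 2 * c"
  using order_tendstoD(1)[OF c_lim, of "c / 2"] order_tendstoD(2)[OF c_lim, of "2 * c"] c_pos
  by (intro eventually_conj) simp_all

text \<open>The order of choices matters: \<eta> makes \<theta> small for all large
  \<open>n\<close>, then the number \<open>k\<close> of projections makes the rounding error
  \<open>b\<close> at most \<eta>, and only then is the accuracy \<open>\<epsilon>'\<close> for a
  single projection fixed, small enough to be summed \<open>k\<close> times.\<close>

lemma hfun_qform_uniform_limit:
  assumes \<epsilon>: "\<epsilon> > 0" and \<kappa>: "\<kappa> > 0"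
  shows "\<forall>\<^sub>F n in sequentially. \<forall>U l. orth_mat (p n) U \<longrightarrow> (\<forall>i<p n. 0 \<le> l i \<and> l i \<le> \<kappa>) \<longrightarrow>
    (\<integral>v. \<bar>hfun (qform (p n) (conj_diag (p n) U l) v / real (N n)) - hfun (norm_ratio (p n) v * (mat_trace (conj_diag (p n) U l) / real (N n)))\<bar> \<partial>D n) \<le> \<epsilon>"
proof -
  obtain \<eta> where \<eta>: "\<eta> > 0" "\<forall>\<^sub>F n in sequentially. S.\<theta> n \<eta> < \<epsilon> / 2" using \<theta>_small[of "\<epsilon> / 2"] \<epsilon> by auto
  obtain k :: nat where k: "2 * c * \<kappa> < real k * \<eta>" using reals_Archimedean3[OF \<eta>(1)] by blast
  have k0: "k > 0" using k mult_pos_pos[OF \<kappa> c_pos] by (cases k) auto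
  define b where "b = 2 * c * (\<kappa> / real k)"
  have b: "0 \<le> b" "b \<le> \<eta>" using k k0 c_pos \<kappa> unfolding b_def by (auto simp: field_simps)
  define K where "K = real k * max 1 b"
  have K: "K > 0" using k0 by (simp add: K_def max_def)
  define \<epsilon>' where "\<epsilon>' = \<epsilon> / (2 * K)"
  have "\<epsilon>' > 0" "K * \<epsilon>' = \<epsilon> / 2" using \<epsilon> K unfolding \<epsilon>'_def by auto
  hence \<epsilon>': "\<epsilon>' > 0" "real k * (max 1 b * \<epsilon>') = \<epsilon> / 2" unfolding K_def by (simp_all only: mult.assoc)
  show ?thesis using \<eta>(2) quad_dev_uniform_limit[OF \<epsilon>'(1)] c_bounds
  proof eventually_elim
    case (elim n)
    show ?case
    proof (intro allI impI)
      fix U and l :: "nat \<Rightarrow> real" assume U: "orth_mat (p n) U" and l: "\<forall>i<p n. 0 \<le> l i \<and> l i \<le> \<kappa>"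
      have "(\<integral>v. \<bar>hfun (qform (p n) (conj_diag (p n) U l) v / real (N n)) - hfun (norm_ratio (p n) v * (mat_trace (conj_diag (p n) U l) / real (N n)))\<bar> \<partial>D n)
        \<le> real k * (max 1 b * \<epsilon>') + S.\<theta> n b"
        unfolding b_def
      proof (rule S.quad_dev_uniform[OF _ k0 \<kappa> _ U])
        show "(\<integral>v. min 1 \<bar>quad_dev (p n) P v\<bar> \<partial>D n) \<le> \<epsilon>'" if "orth_proj (p n) P" for P using elim(2) that by blast
        show "real (p n) / real (N n) \<le> 2 * c" using elim(3) by simp
        show "0 \<le> l i \<and> l i \<le> \<kappa>" if "i < p n" for i using l that by blast
      qed
      also have "\<dots> \<le> \<epsilon> / 2 + S.\<theta> n \<eta>" unfolding \<epsilon>'(2) using S.\<theta>_mono[OF b] by simp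
      also have "\<dots> \<le> \<epsilon>" using elim(1) by simp
      finally show "(\<integral>v. \<bar>hfun (qform (p n) (conj_diag (p n) U l) v / real (N n)) - hfun (norm_ratio (p n) v * (mat_trace (conj_diag (p n) U l) / real (N n)))\<bar> \<partial>D n) \<le> \<epsilon>" .
    qed
  qed
qed

definition mean_tr :: "real \<Rightarrow> nat \<Rightarrow> real" where
  "mean_tr y n = (\<integral>w. mat_trace (resolv y (sample_cov (p n) (N n) w)) \<partial>Pi\<^sub>M {..<N n} (\<lambda>_. D n)) / real (p n)"

lemma iid_sample_resolv_D: "y > 0 \<Longrightarrow> iid_sample_resolv (p n) (N n) (D n) y"
  by (intro iid_sample_resolv.intro iid_sample_D iid_sample_resolv_axioms.intro)

lemma mean_tr_bounds:
  assumes "y > 0" shows "0 \<le> mean_tr y n" "mean_tr y n \<le> 1 / y"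
proof -
  interpret T: iid_sample_resolv "p n" "N n" "D n" y by (rule iid_sample_resolv_D[OF assms])
  have e: "mean_tr y n = integral\<^sup>L (Pi\<^sub>M {..<N n} (\<lambda>_. D n)) T.T / real (p n)"
    unfolding mean_tr_def T.T_def[abs_def] ..
  show "0 \<le> mean_tr y n" unfolding e using T.ET_bounds(1) by (intro divide_nonneg_nonneg) auto
  have "mean_tr y n \<le> (real (p n) / y) / real (p n)" unfolding e by (rule divide_right_mono[OF T.ET_bounds(2)]) simp
  thus "mean_tr y n \<le> 1 / y" using p_pos[of n] by simp
qed

lemma exp_N_limit: "a > 0 \<Longrightarrow> (\<lambda>n. exp (- (real (N n) * a))) \<longlonglongrightarrow> 0"
proof -
  assume a: "a > 0"
  have "filterlim (\<lambda>n. real (N n) * a) at_top sequentially"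
    using filterlim_tendsto_pos_mult_at_top[OF tendsto_const a N_lim] by (simp add: mult.commute)
  hence "filterlim (\<lambda>n. - (real (N n) * a)) at_bot sequentially" by (simp add: filterlim_uminus_at_top)
  thus ?thesis by (rule filterlim_compose[OF exp_at_bot])
qed

text \<open>The three errors of \<open>mean_trace_fixed_point\<close> receive \<open>r / 4\<close>
  each; the exponential carries a factor 2, hence \<open>r / 8\<close>. The resolvents involved have
  spectrum in \<open>[0, 1 / y]\<close>, which fixes the bound passed to the uniform
  estimate.\<close>

lemma mean_tr_fixed_point:
  assumes y: "y > 0"
  shows "(\<lambda>n. (real (p n) / real (N n)) * (1 - y * mean_tr y n) - S.Hn n (real (p n) / real (N n) * mean_tr y n)) \<longlonglongrightarrow> 0"
proof (rule LIMSEQ_I)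
  fix r :: real assume r: "r > 0"
  obtain \<eta> where \<eta>: "\<eta> > 0" "\<forall>\<^sub>F n in sequentially. S.\<theta> n \<eta> < r / 4" using \<theta>_small[of "r / 4"] r by auto
  have iy: "1 / y > 0" using y by simp
  have r4: "r / 4 > 0" using r by simp
  have ay: "\<eta>\<^sup>2 * y\<^sup>2 / 32 > 0" using \<eta>(1) y by simp
  have ex: "\<forall>\<^sub>F n in sequentially. exp (- (real (N n) * (\<eta>\<^sup>2 * y\<^sup>2 / 32))) < r / 8"
    using order_tendstoD(2)[OF exp_N_limit[OF ay], of "r / 8"] r by simp
  have Nl: "\<forall>\<^sub>F n in sequentially. real (N n) \<ge> 2 / (y * \<eta>)" using N_lim unfolding filterlim_at_top by blast
  have "\<forall>\<^sub>F n in sequentially. norm ((real (p n) / real (N n)) * (1 - y * mean_tr y n) - S.Hn n (real (p n) / real (N n) * mean_tr y n) - 0) < r"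
    using \<eta>(2) hfun_qform_uniform_limit[OF r4 iy] ex Nl
  proof eventually_elim
    case (elim n)
    interpret T: iid_sample_resolv "p n" "N n" "D n" y by (rule iid_sample_resolv_D[OF y])
    have small: "1 / (y * real (N n)) \<le> \<eta> / 2"
      using elim(4) y \<eta>(1) N_pos[of n] by (simp add: field_simps)
    have bound: "\<bar>(real (p n) / real (N n)) * (1 - y * mean_tr y n) - S.Hn n (real (p n) / real (N n) * mean_tr y n)\<bar>
      \<le> r / 4 + S.\<theta> n \<eta> + 2 * exp (- (real (N n) * \<eta>\<^sup>2 * y\<^sup>2 / 32))"
      unfolding mean_tr_def T.T_def[symmetric]
    proof (rule T.mean_trace_fixed_point[OF _ \<eta>(1) small])
      fix U and l :: "nat \<Rightarrow> real" assume "orth_mat (p n) U" "\<And>i. i < p n \<Longrightarrow> 0 \<le> l i \<and> l i \<le> 1 / y"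
      thus "(\<integral>v. \<bar>hfun (qform (p n) (conj_diag (p n) U l) v / real (N n)) - hfun (norm_ratio (p n) v * (mat_trace (conj_diag (p n) U l) / real (N n)))\<bar> \<partial>D n) \<le> r / 4"
        using elim(2) by blast
    qed
    have e: "real (N n) * (\<eta>\<^sup>2 * y\<^sup>2 / 32) = real (N n) * \<eta>\<^sup>2 * y\<^sup>2 / 32" by simp
    have "A < r" if "A \<le> r / 4 + t + 2 * u" "t < r / 4" "u < r / 8" for A t u using that r by linarith
    from this[OF bound elim(1) elim(3)[unfolded e]] show ?case unfolding real_norm_def diff_zero .
  qed
  thus "\<exists>n0. \<forall>n\<ge>n0. norm ((real (p n) / real (N n)) * (1 - y * mean_tr y n) - S.Hn n (real (p n) / real (N n) * mean_tr y n) - 0) < r"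
    unfolding eventually_sequentially .
qed

text \<open>An arbitrary root of the limiting equation; \<open>mean_tr_limit\<close> identifies it
  as the limit of the mean traces.\<close>

definition mstar :: "real \<Rightarrow> real" where
  "mstar y = (SOME m. 0 < m \<and> m \<le> 1 / y \<and> c * (1 - y * m) = \<nu>.Hlim (c * m))"

lemma mstar:
  assumes "y > 0" shows "0 < mstar y" "mstar y \<le> 1 / y" "c * (1 - y * mstar y) = \<nu>.Hlim (c * mstar y)"
  using someI_ex[OF \<nu>.fixed_point_exists[OF c_pos assms]] unfolding mstar_def by auto

lemma \<theta>_vanish:
  assumes "d \<longlonglongrightarrow> 0" "\<And>n. d n \<ge> 0" shows "(\<lambda>n. S.\<theta> n (d n)) \<longlonglongrightarrow> 0"
proof (rule LIMSEQ_I)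
  fix r :: real assume r: "r > 0"
  obtain \<eta> where \<eta>: "\<eta> > 0" "\<forall>\<^sub>F n in sequentially. S.\<theta> n \<eta> < r" using \<theta>_small[OF r] by auto
  have "\<forall>\<^sub>F n in sequentially. d n < \<eta>" by (rule order_tendstoD(2)[OF assms(1) \<eta>(1)])
  with \<eta>(2) have "\<forall>\<^sub>F n in sequentially. norm (S.\<theta> n (d n) - 0) < r"
  proof eventually_elim
    case (elim n)
    have "S.\<theta> n (d n) \<le> S.\<theta> n \<eta>" using elim assms(2) by (intro S.\<theta>_mono) auto
    moreover have "0 \<le> S.\<theta> n (d n)" unfolding S.\<theta>_def using assms(2) norm_ratio_nonneg
      by (intro integral_nonneg_AE AE_I2) auto
    ultimately show ?case using elim by simp
  qed
  thus "\<exists>n0. \<forall>n\<ge>n0. norm (S.\<theta> n (d n) - 0) < r" unfolding eventually_sequentially .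
qed

text \<open>Since \<open>Hn\<close> is increasing, \<open>\<Psi> n\<close> decreases with slope at
  least \<open>cn n * y\<close> in absolute value. Both \<open>mean_tr y n\<close> and
  \<open>mstar y\<close> make \<open>\<Psi> n\<close> tend to 0, so their distance tends to 0 as
  well.\<close>

lemma mean_tr_limit:
  assumes y: "y > 0" shows "(\<lambda>n. mean_tr y n) \<longlonglongrightarrow> mstar y"
proof -
  define cn where "cn n = real (p n) / real (N n)" for n
  define \<Psi> where "\<Psi> n m = cn n * (1 - y * m) - S.Hn n (cn n * m)" for n m
  have cn: "cn n > 0" for n unfolding cn_def using p_pos N_pos by simp
  have cl: "cn \<longlonglongrightarrow> c" unfolding cn_def using c_lim .
  note m = mstar[OF y]
  \<comment> \<open>The ratio \<open>cn n\<close> is replaced by its limit inside \<open>Hn\<close>,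
    at the cost of the modulus \<theta> at an argument that tends to 0.\<close>
  have H1: "(\<lambda>n. S.Hn n (cn n * mstar y) - S.Hn n (c * mstar y)) \<longlonglongrightarrow> 0"
  proof (rule Lim_null_comparison)
    show "\<forall>\<^sub>F n in sequentially. norm (S.Hn n (cn n * mstar y) - S.Hn n (c * mstar y)) \<le> S.\<theta> n \<bar>cn n * mstar y - c * mstar y\<bar>"
      using S.Hn_diff cn m(1) c_pos by (intro always_eventually allI) (simp add: less_imp_le)
    have "(\<lambda>n. \<bar>cn n * mstar y - c * mstar y\<bar>) \<longlonglongrightarrow> \<bar>c * mstar y - c * mstar y\<bar>" by (intro tendsto_intros cl)
    thus "(\<lambda>n. S.\<theta> n \<bar>cn n * mstar y - c * mstar y\<bar>) \<longlonglongrightarrow> 0" by (intro \<theta>_vanish) auto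
  qed
  have "(\<lambda>n. S.Hn n (c * mstar y)) \<longlonglongrightarrow> \<nu>.Hlim (c * mstar y)" using c_pos m(1) by (intro Hn_limit) simp
  from tendsto_add[OF H1 this] have H2: "(\<lambda>n. S.Hn n (cn n * mstar y)) \<longlonglongrightarrow> \<nu>.Hlim (c * mstar y)" by simp
  have "(\<lambda>n. cn n * (1 - y * mstar y) - S.Hn n (cn n * mstar y)) \<longlonglongrightarrow> c * (1 - y * mstar y) - \<nu>.Hlim (c * mstar y)"
    by (intro tendsto_diff tendsto_mult cl H2 tendsto_const)
  hence \<Psi>0: "(\<lambda>n. \<Psi> n (mstar y)) \<longlonglongrightarrow> 0" unfolding \<Psi>_def using m(3) by simp
  have \<Psi>1: "(\<lambda>n. \<Psi> n (mean_tr y n)) \<longlonglongrightarrow> 0" using mean_tr_fixed_point[OF y] unfolding \<Psi>_def cn_def .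
  have dec: "cn n * y * (b - a) \<le> \<Psi> n a - \<Psi> n b" if "0 \<le> a" "a \<le> b" for n a b
  proof -
    have "S.Hn n (cn n * a) \<le> S.Hn n (cn n * b)" using that cn[of n] by (intro S.Hn_mono mult_nonneg_nonneg mult_left_mono) auto
    moreover have "cn n * (1 - y * a) - cn n * (1 - y * b) = cn n * y * (b - a)" by (simp add: algebra_simps)
    ultimately show ?thesis unfolding \<Psi>_def by linarith
  qed
  have main: "cn n * y * \<bar>mean_tr y n - mstar y\<bar> \<le> \<bar>\<Psi> n (mean_tr y n) - \<Psi> n (mstar y)\<bar>" for n
  proof (cases "mean_tr y n \<le> mstar y")
    case True
    from dec[OF mean_tr_bounds(1)[OF y] True, of n] show ?thesis using True by (simp add: abs_if algebra_simps)
  next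
    case False
    hence "mstar y \<le> mean_tr y n" by simp
    from dec[OF less_imp_le[OF m(1)] this, of n] have "cn n * y * (mean_tr y n - mstar y) \<le> \<bar>\<Psi> n (mean_tr y n) - \<Psi> n (mstar y)\<bar>" by linarith
    thus ?thesis using False by (simp add: abs_if)
  qed
  have "(\<lambda>n. mean_tr y n - mstar y) \<longlonglongrightarrow> 0"
  proof (rule Lim_null_comparison)
    show "\<forall>\<^sub>F n in sequentially. norm (mean_tr y n - mstar y) \<le> \<bar>\<Psi> n (mean_tr y n) - \<Psi> n (mstar y)\<bar> / (cn n * y)"
      using main cn y by (intro always_eventually allI) (simp add: pos_le_divide_eq mult.commute)
    have "(\<lambda>n. \<bar>\<Psi> n (mean_tr y n) - \<Psi> n (mstar y)\<bar> / (cn n * y)) \<longlonglongrightarrow> \<bar>0 - 0\<bar> / (c * y)"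
      using c_pos y by (intro tendsto_intros \<Psi>0 \<Psi>1 cl) auto
    thus "(\<lambda>n. \<bar>\<Psi> n (mean_tr y n) - \<Psi> n (mstar y)\<bar> / (cn n * y)) \<longlonglongrightarrow> 0" by simp
  qed
  thus ?thesis by (rule LIM_zero_cancel)
qed

text \<open>As \<open>mstar y <= 1 / y\<close>, the fixed-point equation bounds
  \<open>c * (1 - y * mstar y)\<close> by \<open>\<Theta> (c / y)\<close>, which vanishes for large
  \<open>y\<close>. This is the mass condition of the tightness lemma.\<close>

lemma mstar_no_escape:
  assumes "\<epsilon> > 0" shows "\<exists>y\<in>\<rat>. y > 0 \<and> 1 - y * mstar y < \<epsilon>"
proof -
  have "c * \<epsilon> > 0" using c_pos assms by simp
  then obtain \<eta> where \<eta>: "\<eta> > 0" "\<nu>.\<Theta> \<eta> < c * \<epsilon>" using \<nu>.\<Theta>_small by blast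
  obtain k :: nat where k: "c < real k * \<eta>" using reals_Archimedean3[OF \<eta>(1)] by blast
  have k0: "real k > 0" using k c_pos by (cases k) auto
  note m = mstar[OF k0]
  have "c * mstar (real k) \<le> c * (1 / real k)" using m(2) c_pos by (intro mult_left_mono) auto
  also have "\<dots> \<le> \<eta>" using k k0 by (simp add: field_simps)
  finally have le: "c * mstar (real k) \<le> \<eta>" .
  have "c * (1 - real k * mstar (real k)) \<le> \<nu>.\<Theta> (c * mstar (real k))"
    unfolding m(3) using c_pos m(1) by (intro \<nu>.Hlim_le) simp
  also have "\<dots> \<le> \<nu>.\<Theta> \<eta>" using c_pos m(1) le by (intro \<nu>.\<Theta>_mono) auto
  finally have "c * (1 - real k * mstar (real k)) < c * \<epsilon>" using \<eta>(2) by simp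
  hence "1 - real k * mstar (real k) < \<epsilon>" using c_pos by simp
  thus ?thesis using k0 by (intro bexI[of _ "real k"]) auto
qed

lemma mstar_equation:
  assumes y: "y > 0" shows "1 / mstar y - y = (LINT r|\<nu>. max r 0 / (1 + c * max r 0 * mstar y))"
proof -
  note m = mstar[OF y]
  have "hfun (max r 0 * (c * mstar y)) = (c * mstar y) * (max r 0 / (1 + c * max r 0 * mstar y))" for r
    unfolding hfun_def by (simp add: mult_ac)
  hence "\<nu>.Hlim (c * mstar y) = (c * mstar y) * (LINT r|\<nu>. max r 0 / (1 + c * max r 0 * mstar y))"
    unfolding \<nu>.Hlim_def by (simp only: integral_mult_right_zero)
  hence "c * (1 - y * mstar y) = c * (mstar y * (LINT r|\<nu>. max r 0 / (1 + c * max r 0 * mstar y)))"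
    using m(3) by simp
  hence "1 - y * mstar y = mstar y * (LINT r|\<nu>. max r 0 / (1 + c * max r 0 * mstar y))" using c_pos by simp
  thus ?thesis using m(1) by (simp add: field_simps)
qed

section \<open>Concentration for the given samples\<close>

lemma X_measurable: "j < N n \<Longrightarrow> X n j \<in> measurable (M n) (rvec (p n))"
proof -
  interpret prob_space "M n" by (rule prob)
  show "j < N n \<Longrightarrow> X n j \<in> measurable (M n) (rvec (p n))" using X_indep[of n] unfolding indep_vars_def by auto
qed

lemma X_entry_measurable:
  assumes "j < N n" "i < p n" shows "(\<lambda>w. X n j w i) \<in> borel_measurable (M n)"
  by (rule measurable_compose[OF X_measurable[OF assms(1)] measurable_component_singleton]) (use assms in simp)

lemma joint_law:
  "distr (M n) (Pi\<^sub>M {..<N n} (\<lambda>_. D n)) (\<lambda>w. \<lambda>j\<in>{..<N n}. X n j w) = Pi\<^sub>M {..<N n} (\<lambda>_. D n)"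
proof -
  interpret prob_space "M n" by (rule prob)
  have ne: "{..<N n} \<noteq> {}" using N_pos[of n] by auto
  have "distr (M n) (Pi\<^sub>M {..<N n} (\<lambda>_. rvec (p n))) (\<lambda>w. \<lambda>j\<in>{..<N n}. X n j w) =
    Pi\<^sub>M {..<N n} (\<lambda>j. distr (M n) (rvec (p n)) (X n j))"
    by (rule indep_vars_iff_distr_eq_PiM'[THEN iffD1, OF ne X_measurable X_indep]) simp
  also have "\<dots> = Pi\<^sub>M {..<N n} (\<lambda>_. D n)" by (rule PiM_cong) (auto simp: D_def X_law)
  finally have e: "distr (M n) (Pi\<^sub>M {..<N n} (\<lambda>_. rvec (p n))) (\<lambda>w. \<lambda>j\<in>{..<N n}. X n j w) = Pi\<^sub>M {..<N n} (\<lambda>_. D n)" .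
  have "sets (Pi\<^sub>M {..<N n} (\<lambda>_. D n)) = sets (Pi\<^sub>M {..<N n} (\<lambda>_. rvec (p n)))"
    by (rule sets_PiM_cong) (auto simp: D_def)
  thus ?thesis using e by (metis distr_cong)
qed

definition tr_obs :: "real \<Rightarrow> nat \<Rightarrow> 'a \<Rightarrow> real" where
  "tr_obs y n w = mat_trace (resolv y (sample_cov (p n) (N n) (\<lambda>j. X n j w))) / real (p n)"

lemma tr_obs_measurable:
  assumes "y > 0" shows "tr_obs y n \<in> borel_measurable (M n)"
proof -
  have c: "sample_cov (p n) (N n) Y \<in> carrier_mat (p n) (p n)" for Y by (auto simp: sample_cov_def)
  have d: "dim_row (resolv y (sample_cov (p n) (N n) Y)) = p n" for Y
    using resolv_carrier[OF psd_sample_cov assms, of "p n" "N n" Y] by auto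
  have "(\<lambda>w. \<Sum>i<p n. resolv y (sample_cov (p n) (N n) (\<lambda>j. X n j w)) $$ (i,i)) \<in> borel_measurable (M n)"
    by (intro borel_measurable_sum resolv_entry_measurable[OF c sample_cov_entry_measurable] X_entry_measurable) auto
  thus ?thesis unfolding tr_obs_def[abs_def] mat_trace_def d by simp
qed

text \<open>A deviation \<open>e\<close> of the normalized trace is a deviation \<open>p * e\<close>
  of the trace. The exponent \<open>(p * e)^2 / N\<close> is then \<open>p * (p / N) * e^2\<close>,
  linear in \<open>p\<close>.\<close>

lemma tr_obs_tail:
  assumes y: "y > 0" and e: "e > 0"
  shows "measure (M n) {w \<in> space (M n). \<bar>tr_obs y n w - mean_tr y n\<bar> \<ge> e}
    \<le> 2 * exp (- (real (p n) * (real (p n) / real (N n)) * e\<^sup>2 * y\<^sup>2 / 8))"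
proof -
  interpret T: iid_sample_resolv "p n" "N n" "D n" y by (rule iid_sample_resolv_D[OF y])
  let ?P = "Pi\<^sub>M {..<N n} (\<lambda>_. D n)"
  let ?R = "\<lambda>w. \<lambda>j\<in>{..<N n}. X n j w"
  let ?A = "{w \<in> space ?P. \<bar>T.T w - integral\<^sup>L ?P T.T\<bar> \<ge> real (p n) * e}"
  have Rm: "?R \<in> measurable (M n) ?P"
  proof (rule measurable_restrict)
    fix j assume "j \<in> {..<N n}"
    thus "X n j \<in> measurable (M n) (D n)"
      using X_measurable[of j n] measurable_cong_sets[OF refl, of "D n" "rvec (p n)" "M n"] unfolding D_def by simp
  qed
  have TR: "T.T (?R w) = real (p n) * tr_obs y n w" for w
  proof -
    have "sample_cov (p n) (N n) (?R w) = sample_cov (p n) (N n) (\<lambda>j. X n j w)"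
      unfolding sample_cov_def by (intro cong_mat) auto
    thus ?thesis unfolding T.T_def tr_obs_def using p_pos[of n] by simp
  qed
  have ET: "integral\<^sup>L ?P T.T = real (p n) * mean_tr y n"
    unfolding mean_tr_def T.T_def[abs_def] using p_pos[of n] by simp
  have As: "?A \<in> sets ?P" using T.T_measurable by measurable
  have "{w \<in> space (M n). \<bar>tr_obs y n w - mean_tr y n\<bar> \<ge> e} = ?R -` ?A \<inter> space (M n)"
  proof -
    have "\<bar>T.T (?R w) - integral\<^sup>L ?P T.T\<bar> \<ge> real (p n) * e \<longleftrightarrow> \<bar>tr_obs y n w - mean_tr y n\<bar> \<ge> e" for w
    proof -
      have "T.T (?R w) - integral\<^sup>L ?P T.T = real (p n) * (tr_obs y n w - mean_tr y n)"
        unfolding TR ET by (simp add: algebra_simps)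
      hence "\<bar>T.T (?R w) - integral\<^sup>L ?P T.T\<bar> = real (p n) * \<bar>tr_obs y n w - mean_tr y n\<bar>" by (simp add: abs_mult)
      thus ?thesis using p_pos[of n] by simp
    qed
    thus ?thesis using measurable_space[OF Rm] by auto
  qed
  hence "measure (M n) {w \<in> space (M n). \<bar>tr_obs y n w - mean_tr y n\<bar> \<ge> e} = measure (distr (M n) ?P ?R) ?A"
    using measure_distr[OF Rm As] by simp
  also have "\<dots> = measure ?P ?A" unfolding joint_law ..
  also have "\<dots> \<le> 2 * exp (- ((real (p n) * e)\<^sup>2 * y\<^sup>2 / (8 * real (N n))))"
    using p_pos[of n] e by (intro T.T_tail) simp
  also have "(real (p n) * e)\<^sup>2 * y\<^sup>2 / (8 * real (N n)) = real (p n) * (real (p n) / real (N n)) * e\<^sup>2 * y\<^sup>2 / 8"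
    by (simp add: power2_eq_square mult_ac)
  finally show ?thesis .
qed

lemma tr_obs_concentration:
  assumes y: "y > 0" and e: "e > 0"
  shows "\<exists>a>0. \<forall>\<^sub>F n in sequentially. measure (M n) {w \<in> space (M n). \<bar>tr_obs y n w - mstar y\<bar> \<ge> e} \<le> 2 * exp (- a * real (p n))"
proof -
  \<comment> \<open>Half of \<open>e\<close> is spent on the distance of the mean from its limit,
    and \<open>c / 2\<close> is an eventual lower bound for \<open>p / N\<close>.\<close>
  define a where "a = (c / 2) * (e / 2)\<^sup>2 * y\<^sup>2 / 8"
  have a: "a > 0" unfolding a_def using c_pos e y by simp
  have "\<forall>\<^sub>F n in sequentially. \<bar>mean_tr y n - mstar y\<bar> < e / 2"
    using tendstoD[OF mean_tr_limit[OF y], of "e / 2"] e by (simp add: dist_real_def)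
  with c_bounds have "\<forall>\<^sub>F n in sequentially. measure (M n) {w \<in> space (M n). \<bar>tr_obs y n w - mstar y\<bar> \<ge> e} \<le> 2 * exp (- a * real (p n))"
  proof eventually_elim
    case (elim n)
    interpret prob_space "M n" by (rule prob)
    note [measurable] = tr_obs_measurable[OF y, of n]
    have "measure (M n) {w \<in> space (M n). \<bar>tr_obs y n w - mstar y\<bar> \<ge> e} \<le>
      measure (M n) {w \<in> space (M n). \<bar>tr_obs y n w - mean_tr y n\<bar> \<ge> e / 2}"
    proof (rule finite_measure_mono)
      have "\<bar>tr_obs y n w - mean_tr y n\<bar> \<ge> e / 2" if "\<bar>tr_obs y n w - mstar y\<bar> \<ge> e" for w
        using that elim(2) by linarith
      thus "{w \<in> space (M n). \<bar>tr_obs y n w - mstar y\<bar> \<ge> e} \<subseteq> {w \<in> space (M n). \<bar>tr_obs y n w - mean_tr y n\<bar> \<ge> e / 2}"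
        by auto
    qed measurable
    also have "\<dots> \<le> 2 * exp (- (real (p n) * (real (p n) / real (N n)) * (e / 2)\<^sup>2 * y\<^sup>2 / 8))"
      using e by (intro tr_obs_tail y) simp
    also have "\<dots> \<le> 2 * exp (- a * real (p n))"
    proof -
      have "real (p n) * ((c / 2) * ((e / 2)\<^sup>2 * y\<^sup>2 / 8)) \<le> real (p n) * ((real (p n) / real (N n)) * ((e / 2)\<^sup>2 * y\<^sup>2 / 8))"
        using elim(1) by (intro mult_left_mono mult_right_mono) auto
      thus ?thesis unfolding a_def by (simp add: mult_ac)
    qed
    finally show ?case .
  qed
  thus ?thesis using a by blast
qed

text \<open>Union bound; the smallest of finitely many rates is still positive.\<close>

lemma tr_obs_concentration_finite:
  assumes "finite F" "\<And>y. y \<in> F \<Longrightarrow> y > 0" and e: "e > 0"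
  shows "\<exists>a>0. \<forall>\<^sub>F n in sequentially. measure (M n) {w \<in> space (M n). \<exists>y\<in>F. \<bar>tr_obs y n w - mstar y\<bar> \<ge> e}
    \<le> 2 * real (card F) * exp (- a * real (p n))"
  using assms(1,2)
proof (induct F rule: finite_induct)
  case empty
  show ?case by (intro exI[of _ 1]) auto
next
  case (insert y F)
  have y0: "y > 0" and pF: "\<And>z. z \<in> F \<Longrightarrow> z > 0" using insert.prems by simp_all
  have "\<exists>a>0. \<forall>\<^sub>F n in sequentially. measure (M n) {w \<in> space (M n). \<exists>y\<in>F. \<bar>tr_obs y n w - mstar y\<bar> \<ge> e}
    \<le> 2 * real (card F) * exp (- a * real (p n))"
    by (rule insert.hyps(3), rule pF)
  then obtain a1 where a1: "a1 > 0" "\<forall>\<^sub>F n in sequentially. measure (M n) {w \<in> space (M n). \<exists>y\<in>F. \<bar>tr_obs y n w - mstar y\<bar> \<ge> e}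
    \<le> 2 * real (card F) * exp (- a1 * real (p n))" by (elim exE conjE)
  from tr_obs_concentration[OF y0 e]
  obtain a2 where a2: "a2 > 0" "\<forall>\<^sub>F n in sequentially. measure (M n) {w \<in> space (M n). \<bar>tr_obs y n w - mstar y\<bar> \<ge> e} \<le> 2 * exp (- a2 * real (p n))"
    by (elim exE conjE)
  define a where "a = min a1 a2"
  have a: "a > 0" "a \<le> a1" "a \<le> a2" using a1 a2 by (auto simp: a_def)
  have "\<forall>\<^sub>F n in sequentially. measure (M n) {w \<in> space (M n). \<exists>y\<in>insert y F. \<bar>tr_obs y n w - mstar y\<bar> \<ge> e}
    \<le> 2 * real (card (insert y F)) * exp (- a * real (p n))"
    using a1(2) a2(2)
  proof eventually_elim
    case (elim n)
    interpret prob_space "M n" by (rule prob)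
    have 1: "{w \<in> space (M n). \<bar>tr_obs y n w - mstar y\<bar> \<ge> e} \<in> sets (M n)" if "y > 0" for y
      using tr_obs_measurable[OF that, of n] by measurable
    have 2: "{w \<in> space (M n). \<exists>y\<in>F. \<bar>tr_obs y n w - mstar y\<bar> \<ge> e} \<in> sets (M n)"
      by (rule sets.sets_Collect_finite_Ex[OF 1 insert.hyps(1)]) (use insert.prems in simp)
    have "{w \<in> space (M n). \<exists>y\<in>insert y F. \<bar>tr_obs y n w - mstar y\<bar> \<ge> e} =
      {w \<in> space (M n). \<bar>tr_obs y n w - mstar y\<bar> \<ge> e} \<union> {w \<in> space (M n). \<exists>y\<in>F. \<bar>tr_obs y n w - mstar y\<bar> \<ge> e}" by auto
    hence le: "measure (M n) {w \<in> space (M n). \<exists>y\<in>insert y F. \<bar>tr_obs y n w - mstar y\<bar> \<ge> e} \<le>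
      measure (M n) {w \<in> space (M n). \<bar>tr_obs y n w - mstar y\<bar> \<ge> e} + measure (M n) {w \<in> space (M n). \<exists>y\<in>F. \<bar>tr_obs y n w - mstar y\<bar> \<ge> e}"
      using measure_Un_le[OF 1[OF y0] 2] by simp
    have "exp (- a2 * real (p n)) \<le> exp (- a * real (p n))" "exp (- a1 * real (p n)) \<le> exp (- a * real (p n))"
      using a by (simp_all add: mult_right_mono)
    moreover from this(2) have "2 * real (card F) * exp (- a1 * real (p n)) \<le> 2 * real (card F) * exp (- a * real (p n))"
      by (intro mult_left_mono) auto
    moreover have "2 * real (card (insert y F)) * exp (- a * real (p n)) = 2 * exp (- a * real (p n)) + 2 * real (card F) * exp (- a * real (p n))"
      using insert.hyps by (simp add: distrib_right)
    ultimately show ?case using le elim by linarith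
  qed
  hence "a > 0 \<and> (\<forall>\<^sub>F n in sequentially. measure (M n) {w \<in> space (M n). \<exists>y\<in>insert y F. \<bar>tr_obs y n w - mstar y\<bar> \<ge> e}
    \<le> 2 * real (card (insert y F)) * exp (- a * real (p n)))" using a(1) by (intro conjI)
  thus ?case by (rule exI)
qed

section \<open>Construction of the limit measure\<close>

abbreviation scov :: "nat \<Rightarrow> 'a \<Rightarrow> real mat" where
  "scov n w \<equiv> sample_cov (p n) (N n) (\<lambda>j. X n j w)"

lemma empirical_exists:
  "\<exists>\<rho>. prob_on_nonneg \<rho> \<and> ESD (scov n w) = cdf \<rho> \<and> (\<forall>y>0. rst \<rho> y = tr_obs y n w)"
proof -
  obtain \<rho> where "prob_on_nonneg \<rho>" "ESD (scov n w) = cdf \<rho>"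
    "\<And>y. y > 0 \<Longrightarrow> rst \<rho> y = mat_trace (resolv y (scov n w)) / real (p n)"
    by (rule psd_empirical[OF psd_sample_cov p_pos]) (rule that)
  thus ?thesis unfolding tr_obs_def by auto
qed

text \<open>Chosen separately for each \<open>w\<close>; measurability in \<open>w\<close> is used
  only for its distribution function, which equals the spectral distribution.\<close>

definition emp :: "nat \<Rightarrow> 'a \<Rightarrow> real measure" where
  "emp n w = (SOME \<rho>. prob_on_nonneg \<rho> \<and> ESD (scov n w) = cdf \<rho> \<and> (\<forall>y>0. rst \<rho> y = tr_obs y n w))"

lemma emp:
  shows emp_nonneg: "prob_on_nonneg (emp n w)"
    and ESD_emp: "ESD (scov n w) = cdf (emp n w)"
    and rst_emp: "y > 0 \<Longrightarrow> rst (emp n w) y = tr_obs y n w"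
  using someI_ex[OF empirical_exists[of n w]] unfolding emp_def[symmetric] by auto

lemma exp_p_limit: "a > 0 \<Longrightarrow> (\<lambda>n. K * exp (- a * real (p n))) \<longlonglongrightarrow> 0"
proof -
  assume a: "a > 0"
  have "filterlim (\<lambda>n. real (p n)) at_top sequentially"
    by (rule filterlim_compose[OF filterlim_real_sequentially p_lim])
  hence "filterlim (\<lambda>n. a * real (p n)) at_top sequentially"
    by (rule filterlim_tendsto_pos_mult_at_top[OF tendsto_const a])
  hence "filterlim (\<lambda>n. - a * real (p n)) at_bot sequentially" by (simp add: filterlim_uminus_at_top)
  hence "(\<lambda>n. exp (- a * real (p n))) \<longlonglongrightarrow> 0" by (rule filterlim_compose[OF exp_at_bot])
  thus ?thesis using tendsto_mult_right_zero by blast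
qed

text \<open>Probabilistic existence: the exceptional event eventually has probability below 1, so it
  misses some point.\<close>

lemma tr_obs_close_exists:
  assumes F: "finite F" "\<And>y. y \<in> F \<Longrightarrow> y > 0" and e: "e > 0"
  shows "\<exists>n w. \<forall>y\<in>F. \<bar>tr_obs y n w - mstar y\<bar> < e"
proof -
  have "\<exists>a>0. \<forall>\<^sub>F n in sequentially. measure (M n) {w \<in> space (M n). \<exists>y\<in>F. \<bar>tr_obs y n w - mstar y\<bar> \<ge> e}
    \<le> 2 * real (card F) * exp (- a * real (p n))"
    by (rule tr_obs_concentration_finite[OF F(1) _ e]) (rule F(2))
  then obtain a where a: "a > 0" "\<forall>\<^sub>F n in sequentially. measure (M n) {w \<in> space (M n). \<exists>y\<in>F. \<bar>tr_obs y n w - mstar y\<bar> \<ge> e}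
    \<le> 2 * real (card F) * exp (- a * real (p n))" by (elim exE conjE)
  have "\<forall>\<^sub>F n in sequentially. 2 * real (card F) * exp (- a * real (p n)) < 1"
    by (rule order_tendstoD(2)[OF exp_p_limit[OF a(1)]]) simp
  with a(2) have "\<forall>\<^sub>F n in sequentially. measure (M n) {w \<in> space (M n). \<exists>y\<in>F. \<bar>tr_obs y n w - mstar y\<bar> \<ge> e} < 1"
    by eventually_elim (rule le_less_trans)
  from eventually_happens'[OF sequentially_bot this]
  obtain n where n: "measure (M n) {w \<in> space (M n). \<exists>y\<in>F. \<bar>tr_obs y n w - mstar y\<bar> \<ge> e} < 1" by (elim exE)
  interpret prob_space "M n" by (rule prob)
  have "{w \<in> space (M n). \<exists>y\<in>F. \<bar>tr_obs y n w - mstar y\<bar> \<ge> e} \<noteq> space (M n)"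
  proof
    assume "{w \<in> space (M n). \<exists>y\<in>F. \<bar>tr_obs y n w - mstar y\<bar> \<ge> e} = space (M n)"
    with n show False by (simp only: prob_space less_irrefl)
  qed
  then obtain w where "\<not> (\<exists>y\<in>F. \<bar>tr_obs y n w - mstar y\<bar> \<ge> e)" by auto
  thus ?thesis by (intro exI[of _ n] exI[of _ w] ballI) (simp add: not_le)
qed

text \<open>The approximating measures are empirical spectral measures of well-chosen realizations,
  the \<open>k\<close>-th being accurate at the first \<open>k + 1\<close> rational points of an
  enumeration. This also works when the models for different \<open>n\<close> live on unrelated
  probability spaces.\<close>

lemma limit_measure_exists: "\<exists>\<mu>. prob_on_nonneg \<mu> \<and> (\<forall>y\<in>\<rat>. y > 0 \<longrightarrow> rst \<mu> y = mstar y)"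
proof -
  let ?Q = "{y\<in>\<rat>. y > (0::real)}"
  have cnt: "countable ?Q" "?Q \<noteq> {}" using countable_rat by (auto intro: countable_subset[of _ \<rat>] exI[of _ 1])
  define f where "f = from_nat_into ?Q"
  have fQ: "f i \<in> ?Q" for i unfolding f_def using from_nat_into[OF cnt(2)] .
  have "\<exists>\<rho>. prob_on_nonneg \<rho> \<and> (\<forall>i\<le>k. \<bar>rst \<rho> (f i) - mstar (f i)\<bar> < 1 / real (Suc k))" for k
  proof -
    have "\<exists>n w. \<forall>y\<in>f ` {..k}. \<bar>tr_obs y n w - mstar y\<bar> < 1 / real (Suc k)"
      by (rule tr_obs_close_exists) (use fQ in auto)
    then obtain n w where nw: "\<forall>y\<in>f ` {..k}. \<bar>tr_obs y n w - mstar y\<bar> < 1 / real (Suc k)" by (elim exE)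
    have "\<bar>rst (emp n w) (f i) - mstar (f i)\<bar> < 1 / real (Suc k)" if "i \<le> k" for i
    proof -
      have "rst (emp n w) (f i) = tr_obs (f i) n w" using fQ[of i] by (intro rst_emp) simp
      thus ?thesis using bspec[OF nw, of "f i"] that by simp
    qed
    thus ?thesis by (intro exI[of _ "emp n w"] conjI emp_nonneg allI impI)
  qed
  hence "\<forall>k. \<exists>\<rho>. prob_on_nonneg \<rho> \<and> (\<forall>i\<le>k. \<bar>rst \<rho> (f i) - mstar (f i)\<bar> < 1 / real (Suc k))" ..
  from choice[OF this] obtain \<rho>
    where \<rho>': "\<forall>k. prob_on_nonneg (\<rho> k) \<and> (\<forall>i\<le>k. \<bar>rst (\<rho> k) (f i) - mstar (f i)\<bar> < 1 / real (Suc k))"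
    by (elim exE)
  have \<rho>: "prob_on_nonneg (\<rho> k)" "i \<le> k \<Longrightarrow> \<bar>rst (\<rho> k) (f i) - mstar (f i)\<bar> < 1 / real (Suc k)" for i k
    using spec[OF \<rho>', of k] by simp_all
  show ?thesis
  proof (rule rst_limit_exists[OF \<rho>(1) _ mstar_no_escape])
    fix y :: real assume "y \<in> \<rat>" "y > 0"
    then obtain i where i: "f i = y" unfolding f_def using from_nat_into_surj[OF cnt(1), of y] by auto
    have "(\<lambda>k. rst (\<rho> k) y - mstar y) \<longlonglongrightarrow> 0"
    proof (rule Lim_null_comparison)
      have "\<forall>\<^sub>F k in sequentially. i \<le> k" by (rule eventually_ge_at_top)
      thus "\<forall>\<^sub>F k in sequentially. norm (rst (\<rho> k) y - mstar y) \<le> 1 / real (Suc k)"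
        by eventually_elim (use \<rho>(2) i in \<open>auto intro: less_imp_le\<close>)
      show "(\<lambda>k. 1 / real (Suc k)) \<longlonglongrightarrow> 0" by (rule LIMSEQ_Suc[OF lim_1_over_n])
    qed
    thus "(\<lambda>k. rst (\<rho> k) y) \<longlonglongrightarrow> mstar y" by (rule LIM_zero_cancel)
  qed
qed

section \<open>Convergence to the limit measure\<close>

context
  fixes \<mu> :: "real measure"
  assumes \<mu>: "prob_on_nonneg \<mu>" and \<mu>_rst: "\<forall>y\<in>\<rat>. y > 0 \<longrightarrow> rst \<mu> y = mstar y"
begin

abbreviation Lev :: "nat \<Rightarrow> 'a \<Rightarrow> real" where
  "Lev n w \<equiv> levy_dist (ESD (scov n w)) (cdf \<mu>)"

lemma Lev_measurable: "Lev n \<in> borel_measurable (M n)"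
proof -
  have "(\<lambda>w. ESD (scov n w) t) \<in> borel_measurable (M n)" for t
    by (rule ESD_measurable[OF psd_sample_cov])
      (auto intro!: sample_cov_entry_measurable X_entry_measurable)
  hence m: "(\<lambda>w. cdf (emp n w) t) \<in> borel_measurable (M n)" for t unfolding ESD_emp .
  show ?thesis unfolding ESD_emp
    by (rule levy_dist_measurable[OF prob_on_nonneg_rd[OF emp_nonneg] prob_on_nonneg_rd[OF \<mu>] m])
qed

lemma Lev_nonneg: "0 \<le> Lev n w"
proof -
  interpret E: real_distribution "emp n w" by (rule prob_on_nonneg_rd[OF emp_nonneg])
  interpret U: real_distribution \<mu> by (rule prob_on_nonneg_rd[OF \<mu>])
  show ?thesis unfolding ESD_emp
    by (rule levy_dist_nonneg_le(1)) (auto simp: E.cdf_nonneg U.cdf_nonneg E.cdf_bounded_prob U.cdf_bounded_prob)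
qed

text \<open>A Levy distance above \<epsilon> forces the transform to be off by \<delta> at one of
  finitely many points, and each of these events is exponentially unlikely.\<close>

lemma Lev_tail:
  assumes e: "\<epsilon> > 0"
  shows "\<exists>a>0. \<exists>K. \<forall>\<^sub>F n in sequentially. measure (M n) {w \<in> space (M n). Lev n w > \<epsilon>} \<le> K * exp (- a * real (p n))"
proof (rule rst_close_levy[OF \<mu> e])
  fix F \<delta>
  assume F: "finite F" "F \<subseteq> {x\<in>\<rat>. x > 0}" "\<delta> > 0"
    and close: "\<And>\<rho>. prob_on_nonneg \<rho> \<Longrightarrow> (\<And>x. x \<in> F \<Longrightarrow> \<bar>rst \<rho> x - rst \<mu> x\<bar> < \<delta>) \<Longrightarrow> levy_dist (cdf \<rho>) (cdf \<mu>) \<le> \<epsilon>"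
  have FQ: "y \<in> \<rat>" and F0: "y > 0" if "y \<in> F" for y using subsetD[OF F(2) that] by simp_all
  have "\<exists>a>0. \<forall>\<^sub>F n in sequentially. measure (M n) {w \<in> space (M n). \<exists>y\<in>F. \<bar>tr_obs y n w - mstar y\<bar> \<ge> \<delta>}
    \<le> 2 * real (card F) * exp (- a * real (p n))"
    by (rule tr_obs_concentration_finite[OF F(1) _ F(3)]) (rule F0)
  then obtain a where a: "a > 0" "\<forall>\<^sub>F n in sequentially. measure (M n) {w \<in> space (M n). \<exists>y\<in>F. \<bar>tr_obs y n w - mstar y\<bar> \<ge> \<delta>}
    \<le> 2 * real (card F) * exp (- a * real (p n))" by (elim exE conjE)
  have "\<exists>y\<in>F. \<bar>tr_obs y n w - mstar y\<bar> \<ge> \<delta>" if w: "Lev n w > \<epsilon>" for n w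
  proof (rule ccontr)
    assume neg: "\<not> (\<exists>y\<in>F. \<bar>tr_obs y n w - mstar y\<bar> \<ge> \<delta>)"
    have far: "\<bar>tr_obs y n w - mstar y\<bar> < \<delta>" if "y \<in> F" for y
      by (rule ccontr, rule notE[OF neg], rule bexI[OF _ that]) (simp add: not_less)
    have "\<bar>rst (emp n w) y - rst \<mu> y\<bar> < \<delta>" if "y \<in> F" for y
      unfolding rst_emp[OF F0[OF that]] \<mu>_rst[rule_format, OF FQ[OF that] F0[OF that]] by (rule far[OF that])
    from close[OF emp_nonneg this] have "Lev n w \<le> \<epsilon>" unfolding ESD_emp .
    thus False using w by (rule leD[THEN notE])
  qed
  note dev = this
  have sub: "{w \<in> space (M n). Lev n w > \<epsilon>} \<subseteq> {w \<in> space (M n). \<exists>y\<in>F. \<bar>tr_obs y n w - mstar y\<bar> \<ge> \<delta>}" for n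
    by (intro subsetI CollectI conjI) (use dev in simp_all)
  have S: "{w \<in> space (M n). \<exists>y\<in>F. \<bar>tr_obs y n w - mstar y\<bar> \<ge> \<delta>} \<in> sets (M n)" for n
  proof (rule sets.sets_Collect_finite_Ex[OF _ F(1)])
    fix y assume "y \<in> F"
    from tr_obs_measurable[OF F0[OF this], of n] show "{w \<in> space (M n). \<bar>tr_obs y n w - mstar y\<bar> \<ge> \<delta>} \<in> sets (M n)"
      by measurable
  qed
  have le: "measure (M n) {w \<in> space (M n). Lev n w > \<epsilon>} \<le> measure (M n) {w \<in> space (M n). \<exists>y\<in>F. \<bar>tr_obs y n w - mstar y\<bar> \<ge> \<delta>}" for n
  proof -
    interpret prob_space "M n" by (rule prob)
    show ?thesis by (rule finite_measure_mono[OF sub S])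
  qed
  have "\<forall>\<^sub>F n in sequentially. measure (M n) {w \<in> space (M n). Lev n w > \<epsilon>} \<le> (2 * real (card F)) * exp (- a * real (p n))"
    using a(2) by eventually_elim (rule order_trans[OF le])
  with a(1) show "\<exists>a>0. \<exists>K. \<forall>\<^sub>F n in sequentially. measure (M n) {w \<in> space (M n). Lev n w > \<epsilon>} \<le> K * exp (- a * real (p n))"
    by (intro exI conjI)
qed

lemma Lev_conv_in_prob: "conv_in_prob M Lev 0"
  unfolding conv_in_prob_def
proof (intro conjI allI impI Lev_measurable)
  fix \<epsilon> :: real assume "\<epsilon> > 0"
  from Lev_tail[OF this] obtain a K where a: "a > 0"
    and le: "\<forall>\<^sub>F n in sequentially. measure (M n) {w \<in> space (M n). Lev n w > \<epsilon>} \<le> K * exp (- a * real (p n))" by (elim exE conjE)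
  have "(\<lambda>n. measure (M n) {w \<in> space (M n). Lev n w > \<epsilon>}) \<longlonglongrightarrow> 0"
    by (rule Lim_null_comparison[OF _ exp_p_limit[OF a, of K]]) (use le in simp)
  thus "(\<lambda>n. measure (M n) {w \<in> space (M n). \<bar>Lev n w - 0\<bar> > \<epsilon>}) \<longlonglongrightarrow> 0"
    using Lev_nonneg by simp
qed

text \<open>Borel-Cantelli for each threshold \<open>1 / (k + 1)\<close>, followed by an
  intersection over countably many \<open>k\<close>. The assumed summability for every
  \<open>a\<close> covers the rates, which depend on the threshold.\<close>

lemma Lev_AE:
  assumes M: "\<And>n. M n = M 0" and s: "\<And>a. a > 0 \<Longrightarrow> summable (\<lambda>n. exp (- a * real (p n)))"
  shows "AE w in M 0. (\<lambda>n. Lev n w) \<longlonglongrightarrow> 0"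
proof -
  interpret prob_space "M 0" by (rule prob)
  have mes: "{w \<in> space (M 0). Lev n w > \<epsilon>} \<in> sets (M 0)" for n \<epsilon>
    using Lev_measurable[of n] unfolding M[of n] by measurable
  have "AE w in M 0. \<forall>\<^sub>F n in sequentially. w \<in> space (M 0) - {w \<in> space (M 0). Lev n w > 1 / real (Suc k)}" for k
  proof (rule borel_cantelli_AE1[OF mes])
    obtain a K where a: "a > 0"
      and le: "\<forall>\<^sub>F n in sequentially. measure (M n) {w \<in> space (M n). Lev n w > 1 / real (Suc k)} \<le> K * exp (- a * real (p n))"
      using Lev_tail[of "1 / real (Suc k)"] by auto
    show "summable (\<lambda>n. measure (M 0) {w \<in> space (M 0). Lev n w > 1 / real (Suc k)})"
    proof (rule summable_comparison_test_ev[OF _ summable_mult[OF s[OF a]]])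
      show "\<forall>\<^sub>F n in sequentially. norm (measure (M 0) {w \<in> space (M 0). Lev n w > 1 / real (Suc k)}) \<le> K * exp (- a * real (p n))"
        using le
      proof eventually_elim
        case (elim n)
        thus ?case unfolding M[of n] by simp
      qed
    qed
  qed (simp add: less_top[symmetric])
  hence "AE w in M 0. \<forall>k. \<forall>\<^sub>F n in sequentially. w \<in> space (M 0) - {w \<in> space (M 0). Lev n w > 1 / real (Suc k)}"
    by (intro AE_all_countable[THEN iffD2] allI)
  thus ?thesis
  proof eventually_elim
    case (elim w)
    show ?case
    proof (rule LIMSEQ_I)
      fix r :: real assume "r > 0"
      then obtain k where k: "1 / real (Suc k) < r" by (rule nat_approx_posE)
      from spec[OF elim, of k] have "\<forall>\<^sub>F n in sequentially. norm (Lev n w - 0) < r"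
      proof eventually_elim
        case (elim n)
        hence "Lev n w \<le> 1 / real (Suc k)" by (simp only: mem_Collect_eq Diff_iff simp_thms not_less[symmetric]) blast
        thus ?case using k Lev_nonneg[of n w] by (simp only: real_norm_def diff_zero abs_of_nonneg)
      qed
      thus "\<exists>n0. \<forall>n\<ge>n0. norm (Lev n w - 0) < r" unfolding eventually_sequentially .
    qed
  qed
qed

lemma limit_equation:
  assumes z: "Im z > 0"
  shows "Im (stieltjes \<mu> z) > 0" "solves_eq c \<nu> z (stieltjes \<mu> z)"
    "Im s > 0 \<Longrightarrow> solves_eq c \<nu> z s \<Longrightarrow> s = stieltjes \<mu> z"
proof -
  show 1: "Im (stieltjes \<mu> z) > 0" unfolding stieltjes_eq_cst[OF \<mu>] by (rule cst_Im_pos[OF \<mu> z])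
  show 2: "solves_eq c \<nu> z (stieltjes \<mu> z)"
  proof (rule stieltjes_solves_eq[OF \<mu> nu c_pos _ z])
    fix y :: real assume y: "y \<in> \<rat>" "y > 0"
    show "1 / rst \<mu> y - y = (LINT r|\<nu>. max r 0 / (1 + c * max r 0 * rst \<mu> y))"
      unfolding \<mu>_rst[rule_format, OF y] by (rule mstar_equation[OF y(2)])
  qed
  show "s = stieltjes \<mu> z" if "Im s > 0" "solves_eq c \<nu> z s"
    by (rule solves_eq_unique[OF nu c_pos z that 1 2])
qed

end

end

theorem theorem2p5:
  fixes p N :: "nat \<Rightarrow> nat"
    and M :: "nat \<Rightarrow> 'a measure"
    and x :: "nat \<Rightarrow> 'a \<Rightarrow> nat \<Rightarrow> real"
    and X :: "nat \<Rightarrow> nat \<Rightarrow> 'a \<Rightarrow> nat \<Rightarrow> real"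
    and c :: real
    and \<nu> :: "real measure"
  assumes p_pos: "\<And>n. p n > 0"
    and N_pos: "\<And>n. N n > 0"
    and p_lim: "filterlim p at_top sequentially"
    and prob: "\<And>n. prob_space (M n)"
    and x_meas: "\<And>n. x n \<in> measurable (M n) (rvec (p n))"
    and X_indep: "\<And>n. prob_space.indep_vars (M n) (\<lambda>_. rvec (p n)) (X n) {..<N n}"
    and X_law: "\<And>n j. j < N n \<Longrightarrow>
        distr (M n) (rvec (p n)) (X n j) = distr (M n) (rvec (p n)) (x n)"
    and c_pos: "c > 0"
    and c_lim: "(\<lambda>n. real (p n) / real (N n)) \<longlonglongrightarrow> c"
    and nu: "prob_on_nonneg \<nu>"
    and R_lim: "weak_conv_m (\<lambda>n. distr (M n) borel (\<lambda>\<omega>. norm_ratio (p n) (x n \<omega>))) \<nu>"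
    and RQC: "\<And>P :: nat \<Rightarrow> real mat. (\<And>n. orth_proj (p n) (P n)) \<Longrightarrow>
        conv_in_prob M (\<lambda>n \<omega>. quad_dev (p n) (P n) (x n \<omega>)) 0"
  shows "\<exists>\<mu>. prob_on_nonneg \<mu> \<and>
      conv_in_prob M
        (\<lambda>n \<omega>. levy_dist (ESD (sample_cov (p n) (N n) (\<lambda>j. X n j \<omega>))) (cdf \<mu>)) 0 \<and>
      (\<forall>z. Im z > 0 \<longrightarrow>
        Im (stieltjes \<mu> z) > 0 \<and> solves_eq c \<nu> z (stieltjes \<mu> z) \<and>
        (\<forall>s. Im s > 0 \<and> solves_eq c \<nu> z s \<longrightarrow> s = stieltjes \<mu> z)) \<and>
      ((\<forall>n. M n = M 0) \<longrightarrow> (\<forall>a>0. summable (\<lambda>n. exp (- a * real (p n)))) \<longrightarrow>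
        (AE \<omega> in M 0.
          (\<lambda>n. levy_dist (ESD (sample_cov (p n) (N n) (\<lambda>j. X n j \<omega>))) (cdf \<mu>)) \<longlonglongrightarrow> 0))"
proof -
  interpret cov_model p N M x X c \<nu> by (rule cov_model.intro; fact)
  obtain \<mu> where \<mu>: "prob_on_nonneg \<mu>" "\<forall>y\<in>\<rat>. y > 0 \<longrightarrow> rst \<mu> y = mstar y"
    using limit_measure_exists by (elim exE conjE)
  show ?thesis
  proof (intro exI[of _ \<mu>] conjI allI impI)
    show "prob_on_nonneg \<mu>" by (rule \<mu>(1))
    show "conv_in_prob M (\<lambda>n \<omega>. levy_dist (ESD (sample_cov (p n) (N n) (\<lambda>j. X n j \<omega>))) (cdf \<mu>)) 0"
      by (rule Lev_conv_in_prob[OF \<mu>])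
    show "Im (stieltjes \<mu> z) > 0" "solves_eq c \<nu> z (stieltjes \<mu> z)" if "Im z > 0" for z
      by (rule limit_equation[OF \<mu> that])+
    show "s = stieltjes \<mu> z" if "Im z > 0" "Im s > 0 \<and> solves_eq c \<nu> z s" for z s
      by (rule limit_equation(3)[OF \<mu> that(1)]) (use that(2) in simp_all)
    show "AE \<omega> in M 0. (\<lambda>n. levy_dist (ESD (sample_cov (p n) (N n) (\<lambda>j. X n j \<omega>))) (cdf \<mu>)) \<longlonglongrightarrow> 0"
      if "\<forall>n. M n = M 0" "\<forall>a>0. summable (\<lambda>n. exp (- a * real (p n)))"
      by (rule Lev_AE[OF \<mu> that(1)[rule_format] that(2)[rule_format]])
  qed
qed

end
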